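(* Let $G$ be an arbitrary subgroup of $\Gamma=\mathrm{PSL}_2(\mathbb{Z})$. 1. The graph $Y_{\mathrm{comb}}(G)$ is a combinatorial model for the Riemann surface $Y(G)=G\backslash\mathbb{H}$, i.e. $Y_{\mathrm{comb}}(G)$ is homotopy equivalent to $Y(G)$. 2. Cut $Y_{\mathrm{comb}}(G)$ in some of the vertices of valency 2 to obtain a tree $Y'$, and take a lift $\jmath:Y'\to\mathbf{T}$ of this tree into $\mathbf{T}$, so that the composite $Y'\xrightarrow{\jmath}\mathbf{T}\to G\backslash\mathbf{T}=Y_{\mathrm{comb}}(G)$ is the natural map $Y'\to Y_{\mathrm{comb}}(G)$. Then the set $P=p^{-1}\big(f(\jmath(Y'))\big)$ is a convex hyperbolic polygon which is a union of $\Gamma$-copies of $\triangle$, and a fundamental domain for the action of $G$ on $\mathbb{H}$.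
   Context: $\mathbb{H}$ is the upper half-plane with its standard hyperbolic metric, on which $\Gamma=\mathrm{PSL}_2(\mathbb{Z})$ acts by isometries. $\triangle$ is the hyperbolic triangle with vertices $e^{\pi i/3},0,\infty$; it is a fundamental domain for the action of $\Gamma$ on $\mathbb{H}$. Let $G_0,G_1\subset\Gamma$ be the subgroups of order 2 and 3 generated by the classes of $\left(\begin{smallmatrix}0&-1\\1&0\end{smallmatrix}\right)$ and $\left(\begin{smallmatrix}0&1\\-1&1\end{smallmatrix}\right)$ respectively. For a subgroup $G\subset\Gamma$, consider the right action of $\Gamma$ on the set $G\backslash\Gamma$ of cosets $Gx$. The graph $Y_{\mathrm{comb}}(G)$ has vertex set $(G\backslash\Gamma/G_0)\sqcup(G\backslash\Gamma/G_1)$, i.e. the disjoint union of the set of $G_0$-orbits (vertices of type (0), of valency 1 or 2) and the set of $G_1$-orbits (vertices of type (1), of valency 1 or 3) in $G\backslash\Gamma$, and edge set $G\backslash\Gamma$; an edge $x\in G\backslash\Gamma$ joins the $G_0$-orbit containing $x$ with the $G_1$-orbit containing $x$. $\mathbf{T}=Y_{\mathrm{comb}}(\{\mathrm{Id}\})$ is an infinite tree with edge set $\Gamma$ and vertex set $(\Gamma/G_0)\sqcup(\Gamma/G_1)$; $\Gamma$ acts on it on the left and $G\backslash\mathbf{T}=Y_{\mathrm{comb}}(G)$. Let $\mathcal{T}\subset\mathbb{H}$ be the union of all $\Gamma$-copies of the hyperbolic line segment $[i,e^{\pi i/3}]$; it is a tree. Let $f:\mathbf{T}\to\mathcal{T}$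 be the unique $\Gamma$-equivariant isomorphism such that the vertex of $\mathbf{T}$ corresponding to $G_0$ (as a left $G_0$-coset) goes to $i$ and the vertex corresponding to $G_1$ (as a left $G_1$-coset) goes to $e^{\pi i/3}$. Let $p:\mathbb{H}\to\mathcal{T}$ be a $\Gamma$-equivariant strong deformation retraction. Cutting a graph at a vertex of valency 2 means replacing this vertex by two univalent vertices, each incident to one of the two edges that met at it; there is a natural map from the cut graph to the original one. Graphs are not distinguished from their geometric realisations.
   Formalization: Part 2 assumes p maps the open triangle into its open edge (i,ρ), and its claims are made for the closure Q of the interior of P, where P is Q plus the fibres of p over univalent type-(1) vertices; literally it fails, e.g. G=Γ gives the triangle plus a ray. *)

theory Defs
  imports
    "HOL-Analysis.Analysis"
    "HOL-Algebra.Generated_Groups"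
    "HOL-Algebra.Group_Action"
    "Graph_Theory.Digraph_Component"
begin

section \<open>The modular group and its action on the upper half-plane\<close>

definition SL2Z :: "(int^2^2) monoid" where
  "SL2Z = \<lparr>carrier = {A. det A = 1}, mult = (\<lambda>A B. A ** B), one = mat 1\<rparr>"

definition centre :: "(int^2^2) set" where
  "centre = {mat 1, - mat 1}"

definition PSL2Z :: "(int^2^2) set monoid" (\<open>\<Gamma>\<close>) where
  "\<Gamma> = SL2Z Mod centre"

lemma group_SL2Z: "group SL2Z"
proof (rule groupI)
  fix A assume "A \<in> carrier SL2Z"
  then have A: "det A = 1" by (simp add: SL2Z_def)
  define B :: "int^2^2"
    where "B = vector [vector [A$2$2, - (A$1$2)], vector [- (A$2$1), A$1$1]]"
  have "B ** A = mat 1"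
    using A by (auto simp: B_def vec_eq_iff forall_2 matrix_matrix_mult_def sum_2 mat_def det_2
        algebra_simps)
  moreover have "det B = 1"
    using A by (simp add: B_def det_2 algebra_simps)
  ultimately show "\<exists>B\<in>carrier SL2Z. B \<otimes>\<^bsub>SL2Z\<^esub> A = \<one>\<^bsub>SL2Z\<^esub>"
    by (auto simp: SL2Z_def)
qed (auto simp: SL2Z_def det_mul matrix_mul_assoc)

lemma normal_centre: "centre \<lhd> SL2Z"
proof -
  interpret group SL2Z by (rule group_SL2Z)
  have neg: "- mat 1 ** A = - A" "A ** (- mat 1) = - A" for A :: "int^2^2"
    by (simp_all add: vec_eq_iff forall_2 matrix_matrix_mult_def sum_2 mat_def)
  have det_neg: "det (- mat 1 :: int^2^2) = 1" by (simp add: det_2 mat_def)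
  have inv_neg: "inv\<^bsub>SL2Z\<^esub> (- mat 1) = - mat 1"
    by (rule inv_equality) (auto simp: SL2Z_def neg det_neg)
  have inv_one': "inv\<^bsub>SL2Z\<^esub> (mat 1) = mat 1"
    by (rule inv_equality) (auto simp: SL2Z_def)
  have "subgroup centre SL2Z"
    using inv_neg inv_one'
    by (intro subgroupI) (auto simp: centre_def SL2Z_def neg det_neg)
  moreover have "A \<otimes>\<^bsub>SL2Z\<^esub> h \<otimes>\<^bsub>SL2Z\<^esub> inv\<^bsub>SL2Z\<^esub> A \<in> centre"
    if A: "A \<in> carrier SL2Z" and h: "h \<in> centre" for A h
  proof -
    have comm: "A \<otimes>\<^bsub>SL2Z\<^esub> h = h \<otimes>\<^bsub>SL2Z\<^esub> A"
      using h by (auto simp: centre_def SL2Z_def neg)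
    have hc: "h \<in> carrier SL2Z" using h det_neg by (auto simp: centre_def SL2Z_def)
    show ?thesis unfolding comm using A hc h by (simp add: m_assoc)
  qed
  ultimately show ?thesis by (simp add: normal_inv_iff)
qed

lemma group_PSL2Z: "group \<Gamma>"
  unfolding PSL2Z_def by (rule normal.factorgroup_is_group[OF normal_centre])

definition psl_class :: "int^2^2 \<Rightarrow> (int^2^2) set" where
  "psl_class A = centre #>\<^bsub>SL2Z\<^esub> A"

definition G0 :: "(int^2^2) set set" where
  "G0 = generate \<Gamma> {psl_class (vector [vector [0, -1], vector [1, 0]])}"

definition G1 :: "(int^2^2) set set" where
  "G1 = generate \<Gamma> {psl_class (vector [vector [0, 1], vector [-1, 1]])}"

definition upper_half_plane :: "complex set" (\<open>\<H>\<close>) where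
  "\<H> = {z. Im z > 0}"

definition moebius :: "int^2^2 \<Rightarrow> complex \<Rightarrow> complex" where
  "moebius A z = (of_int (A$1$1) * z + of_int (A$1$2)) / (of_int (A$2$1) * z + of_int (A$2$2))"

text \<open>A class \<open>{A, -A}\<close> acts by the common value of its two representatives.\<close>
definition act :: "(int^2^2) set \<Rightarrow> complex \<Rightarrow> complex" where
  "act \<gamma> z = the_elem ((\<lambda>A. moebius A z) ` \<gamma>)"

definition quotient_topology :: "'a topology \<Rightarrow> ('a \<Rightarrow> 'b) \<Rightarrow> 'b topology" where
  "quotient_topology X q =
     topology (\<lambda>U. U \<subseteq> q ` topspace X \<and> openin X {x \<in> topspace X. q x \<in> U})"

lemma openin_quotient_topology:
  "openin (quotient_topology X q) U \<longleftrightarrow>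
     U \<subseteq> q ` topspace X \<and> openin X {x \<in> topspace X. q x \<in> U}"
proof -
  have "istopology (\<lambda>U. U \<subseteq> q ` topspace X \<and> openin X {x \<in> topspace X. q x \<in> U})"
    unfolding istopology_def
  proof (rule conjI; clarify)
    fix S T
    assume "openin X {x \<in> topspace X. q x \<in> S}" "openin X {x \<in> topspace X. q x \<in> T}"
      "S \<subseteq> q ` topspace X"
    then have "openin X ({x \<in> topspace X. q x \<in> S} \<inter> {x \<in> topspace X. q x \<in> T})" by blast
    moreover have "{x \<in> topspace X. q x \<in> S \<inter> T} =
      {x \<in> topspace X. q x \<in> S} \<inter> {x \<in> topspace X. q x \<in> T}" by blast
    ultimately show "S \<inter> T \<subseteq> q ` topspace X \<and> openin X {x \<in> topspace X. q x \<in> S \<inter> T}"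
      using \<open>S \<subseteq> q ` topspace X\<close> by auto
  next
    fix K
    assume K: "\<forall>S\<in>K. S \<subseteq> q ` topspace X \<and> openin X {x \<in> topspace X. q x \<in> S}"
    have "{x \<in> topspace X. q x \<in> \<Union>K} = \<Union>((\<lambda>S. {x \<in> topspace X. q x \<in> S}) ` K)" by blast
    then show "\<Union>K \<subseteq> q ` topspace X \<and> openin X {x \<in> topspace X. q x \<in> \<Union>K}"
      using K by auto
  qed
  then show ?thesis by (simp add: quotient_topology_def)
qed

text \<open>The underlying topological space of \<open>Y(G) = G\H\<close>.\<close>
definition Y :: "(int^2^2) set set \<Rightarrow> complex set topology" where
  "Y G = quotient_topology (top_of_set \<H>) (orbit (\<Gamma>\<lparr>carrier := G\<rparr>) act)"


section \<open>Hyperbolic geometry\<close>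

definition hdist :: "complex \<Rightarrow> complex \<Rightarrow> real" where
  "hdist z w = arcosh (1 + (cmod (z - w))\<^sup>2 / (2 * Im z * Im w))"

definition hsegment :: "complex \<Rightarrow> complex \<Rightarrow> complex set" where
  "hsegment z w = {u \<in> \<H>. hdist z u + hdist u w = hdist z w}"

definition hconvex :: "complex set \<Rightarrow> bool" where
  "hconvex P \<longleftrightarrow> P \<subseteq> \<H> \<and> (\<forall>z\<in>P. \<forall>w\<in>P. hsegment z w \<subseteq> P)"

text \<open>Geodesic lines are exactly the perpendicular bisectors of pairs of distinct points.\<close>
definition closed_half_plane :: "complex set \<Rightarrow> bool" where
  "closed_half_plane D \<longleftrightarrow>
     (\<exists>u\<in>\<H>. \<exists>w\<in>\<H>. u \<noteq> w \<and> D = {z \<in> \<H>. hdist z u \<le> hdist z w})"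

text \<open>Polygons may have infinitely many sides (a locally finite family), ideal vertices and
  infinite area, and the whole plane is allowed: all this occurs for subgroups of infinite index.\<close>
definition convex_hyperbolic_polygon :: "complex set \<Rightarrow> bool" where
  "convex_hyperbolic_polygon P \<longleftrightarrow>
     hconvex P \<and> interior P \<noteq> {} \<and>
     (\<exists>\<D>. (\<forall>D\<in>\<D>. closed_half_plane D) \<and>
          locally_finite_in (top_of_set \<H>) ((\<lambda>D. \<H> \<inter> frontier D) ` \<D>) \<and>
          P = \<H> \<inter> \<Inter>\<D>)"

definition fundamental_domain :: "(int^2^2) set set \<Rightarrow> complex set \<Rightarrow> bool" where
  "fundamental_domain G D \<longleftrightarrow>
     D = \<H> \<inter> closure (interior D) \<and> interior D \<noteq> {} \<and>
     (\<Union>\<gamma>\<in>G. act \<gamma> ` D) = \<H> \<and>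
     (\<forall>\<gamma>\<in>G. \<gamma> \<noteq> \<one>\<^bsub>\<Gamma>\<^esub> \<longrightarrow> interior D \<inter> act \<gamma> ` interior D = {})"

definition \<rho> :: complex where
  "\<rho> = exp (pi * \<i> / 3)"

text \<open>The triangle with vertices \<open>\<rho>\<close>, \<open>0\<close>, \<open>\<infinity>\<close>: its sides lie on the geodesics \<open>Re z = 0\<close>
  (from \<open>0\<close> to \<open>\<infinity>\<close>), \<open>Re z = 1/2\<close> (from \<open>\<rho>\<close> to \<open>\<infinity>\<close>) and \<open>\<bar>z - 1\<bar> = 1\<close> (from \<open>0\<close> to \<open>\<rho>\<close>).\<close>
definition triangle :: "complex set" (\<open>\<triangle>\<close>) where
  "\<triangle> = {z \<in> \<H>. 0 \<le> Re z \<and> Re z \<le> 1/2 \<and> 1 \<le> cmod (z - 1)}"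

definition hyp_tree :: "complex set" (\<open>\<T>\<close>) where
  "\<T> = (\<Union>\<gamma>\<in>carrier \<Gamma>. act \<gamma> ` hsegment \<i> \<rho>)"

definition equivariant_retraction :: "(complex \<Rightarrow> complex) \<Rightarrow> bool" where
  "equivariant_retraction p \<longleftrightarrow>
     p ` \<H> \<subseteq> \<T> \<and>
     homotopic_with
       (\<lambda>k. (\<forall>z\<in>\<T>. k z = z) \<and> (\<forall>\<gamma>\<in>carrier \<Gamma>. \<forall>z\<in>\<H>. k (act \<gamma> z) = act \<gamma> (k z)))
       (top_of_set \<H>) (top_of_set \<H>) id p"

text \<open>Compatibility of a retraction with the tessellation by copies of \<open>\<triangle>\<close>: the open triangle is
  sent into its own open edge. Then, by equivariance and continuity, the fibres over the vertices
  of \<open>\<T>\<close> are made up of sides of triangles. Equivariance alone does not imply this.\<close>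
definition adapted :: "(complex \<Rightarrow> complex) \<Rightarrow> bool" where
  "adapted p \<longleftrightarrow> p ` interior \<triangle> \<subseteq> hsegment \<i> \<rho> - {\<i>, \<rho>}"


section \<open>Graphs\<close>

text \<open>Undirected multigraphs are represented by \<^typ>\<open>('v, 'e) pre_digraph\<close> with an arbitrarily
  chosen orientation of the edges.\<close>

definition valency :: "('v, 'e) pre_digraph \<Rightarrow> 'v \<Rightarrow> nat" where
  "valency X v = in_degree X v + out_degree X v"

text \<open>Every edge \<open>e\<close> becomes two opposite arcs \<open>(e, False)\<close> and \<open>(e, True)\<close>.\<close>
definition doubled :: "('v, 'e) pre_digraph \<Rightarrow> ('v, 'e \<times> bool) pre_digraph" where
  "doubled X =
     \<lparr>verts = verts X, arcs = arcs X \<times> UNIV,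
      tail = (\<lambda>(e, b). if b then head X e else tail X e),
      head = (\<lambda>(e, b). if b then tail X e else head X e)\<rparr>"

text \<open>The library's \<^const>\<open>tree\<close> only excludes directed cycles. Here a cycle is undirected and
  uses every edge at most once, so that double edges and loops are cycles, but going back and
  forth along one edge is not.\<close>
definition undirected_tree :: "('v, 'e) pre_digraph \<Rightarrow> bool" where
  "undirected_tree X \<longleftrightarrow>
     Digraph_Component.connected X \<and>
     (\<nexists>c. pre_digraph.cycle (doubled X) c \<and> distinct (map fst c))"

definition graph_morphism ::
    "('v, 'e) pre_digraph \<Rightarrow> ('w, 'f) pre_digraph \<Rightarrow> ('v \<Rightarrow> 'w) \<Rightarrow> ('e \<Rightarrow> 'f) \<Rightarrow> bool" where
  "graph_morphism X Z \<phi>V \<phi>E \<longleftrightarrow>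
     \<phi>V ` verts X \<subseteq> verts Z \<and> \<phi>E ` arcs X \<subseteq> arcs Z \<and>
     (\<forall>e\<in>arcs X. tail Z (\<phi>E e) = \<phi>V (tail X e) \<and> head Z (\<phi>E e) = \<phi>V (head X e))"

text \<open>Cutting a loopless graph at a set \<open>C\<close> of vertices: \<open>v \<in> C\<close> is replaced by the vertices
  \<open>Inr (v, e)\<close>, one for each edge \<open>e\<close> at \<open>v\<close>.\<close>
definition cut_graph :: "('v, 'e) pre_digraph \<Rightarrow> 'v set \<Rightarrow> ('v + 'v \<times> 'e, 'e) pre_digraph" where
  "cut_graph X C =
     \<lparr>verts = Inl ` (verts X - C) \<union>
              Inr ` {(v, e). v \<in> C \<and> e \<in> arcs X \<and> (tail X e = v \<or> head X e = v)},
      arcs = arcs X,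
      tail = (\<lambda>e. if tail X e \<in> C then Inr (tail X e, e) else Inl (tail X e)),
      head = (\<lambda>e. if head X e \<in> C then Inr (head X e, e) else Inl (head X e))\<rparr>"

text \<open>The natural map from the cut graph to the original one; on edges it is the identity.\<close>
definition uncut :: "'v + 'v \<times> 'e \<Rightarrow> 'v" where
  "uncut = case_sum id fst"

text \<open>Points of the geometric realisation are vertices \<open>Inl v\<close> and interior points \<open>Inr (e, t)\<close>
  of edges, \<open>0 < t < 1\<close>. The topology is the final one for the maps \<open>t \<mapsto> edge_point X e t\<close>, i.e.
  that of the CW complex obtained by gluing the intervals \<open>{e} \<times> [0,1]\<close> to the vertices.\<close>
definition edge_point :: "('v, 'e) pre_digraph \<Rightarrow> 'e \<Rightarrow> real \<Rightarrow> 'v + 'e \<times> real" where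
  "edge_point X e t =
     (if t = 0 then Inl (tail X e) else if t = 1 then Inl (head X e) else Inr (e, t))"

definition points :: "('v, 'e) pre_digraph \<Rightarrow> ('v + 'e \<times> real) set" where
  "points X = Inl ` verts X \<union> Inr ` (arcs X \<times> {0<..<1})"

definition realisation :: "('v, 'e) pre_digraph \<Rightarrow> ('v + 'e \<times> real) topology" where
  "realisation X = topology (\<lambda>U. U \<subseteq> points X \<and>
     (\<forall>e\<in>arcs X. openin (top_of_set {0..1}) {t \<in> {0..1}. edge_point X e t \<in> U}))"

lemma openin_realisation:
  "openin (realisation X) U \<longleftrightarrow> U \<subseteq> points X \<and>
     (\<forall>e\<in>arcs X. openin (top_of_set {0..1}) {t \<in> {0..1}. edge_point X e t \<in> U})"
proof -
  have "istopology (\<lambda>U. U \<subseteq> points X \<and>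
     (\<forall>e\<in>arcs X. openin (top_of_set {0..1}) {t \<in> {0..1}. edge_point X e t \<in> U}))"
    unfolding istopology_def
  proof (rule conjI; intro allI impI)
    fix S T
    assume S: "S \<subseteq> points X \<and>
      (\<forall>e\<in>arcs X. openin (top_of_set {0..1}) {t \<in> {0..1}. edge_point X e t \<in> S})"
      and T: "T \<subseteq> points X \<and>
      (\<forall>e\<in>arcs X. openin (top_of_set {0..1}) {t \<in> {0..1}. edge_point X e t \<in> T})"
    have "{t \<in> {0..1}. edge_point X e t \<in> S \<inter> T} =
      {t \<in> {0..1}. edge_point X e t \<in> S} \<inter> {t \<in> {0..1}. edge_point X e t \<in> T}" for e by blast
    with S T show "S \<inter> T \<subseteq> points X \<and>
      (\<forall>e\<in>arcs X. openin (top_of_set {0..1}) {t \<in> {0..1}. edge_point X e t \<in> S \<inter> T})"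
      by (metis (no_types, lifting) inf.coboundedI1 openin_Int)
  next
    fix K
    assume K: "\<forall>S\<in>K. S \<subseteq> points X \<and>
      (\<forall>e\<in>arcs X. openin (top_of_set {0..1}) {t \<in> {0..1}. edge_point X e t \<in> S})"
    have "{t \<in> {0..1}. edge_point X e t \<in> \<Union>K} =
      \<Union>((\<lambda>S. {t \<in> {0..1}. edge_point X e t \<in> S}) ` K)" for e by blast
    then have "openin (top_of_set {0..1}) {t \<in> {0..1}. edge_point X e t \<in> \<Union>K}"
      if "e \<in> arcs X" for e
      using K that by (metis (no_types, lifting) imageE openin_Union)
    with K show "\<Union>K \<subseteq> points X \<and>
      (\<forall>e\<in>arcs X. openin (top_of_set {0..1}) {t \<in> {0..1}. edge_point X e t \<in> \<Union>K})" by blast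
  qed
  then show ?thesis by (simp add: realisation_def)
qed

definition realise_map :: "('v \<Rightarrow> 'w) \<Rightarrow> ('e \<Rightarrow> 'f) \<Rightarrow> 'v + 'e \<times> real \<Rightarrow> 'w + 'f \<times> real" where
  "realise_map \<phi>V \<phi>E = map_sum \<phi>V (map_prod \<phi>E id)"


section \<open>The graph of a subgroup\<close>

type_synonym edge = "(int^2^2) set set"    \<comment> \<open>a coset \<open>Gx\<close>\<close>
type_synonym vertex = "edge set + edge set"    \<comment> \<open>orbits of \<open>G0\<close>: type (0); of \<open>G1\<close>: type (1)\<close>

definition right_orbit :: "(int^2^2) set set \<Rightarrow> edge \<Rightarrow> edge set" where
  "right_orbit K x = (\<lambda>g. x #>\<^bsub>\<Gamma>\<^esub> g) ` K"

text \<open>The orientation is from type (0) to type (1).\<close>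
definition Ycomb :: "(int^2^2) set set \<Rightarrow> (vertex, edge) pre_digraph" where
  "Ycomb G =
     \<lparr>verts = Inl ` right_orbit G0 ` (rcosets\<^bsub>\<Gamma>\<^esub> G) \<union> Inr ` right_orbit G1 ` (rcosets\<^bsub>\<Gamma>\<^esub> G),
      arcs = rcosets\<^bsub>\<Gamma>\<^esub> G,
      tail = (\<lambda>x. Inl (right_orbit G0 x)),
      head = (\<lambda>x. Inr (right_orbit G1 x))\<rparr>"

text \<open>The edges of \<open>T\<close> are the singletons \<open>{\<gamma>}\<close>, \<open>\<gamma> \<in> \<Gamma>\<close>.\<close>
definition T :: "(vertex, edge) pre_digraph" where
  "T = Ycomb {\<one>\<^bsub>\<Gamma>\<^esub>}"

definition on_vertex :: "(edge \<Rightarrow> edge) \<Rightarrow> vertex \<Rightarrow> vertex" where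
  "on_vertex \<phi> = map_sum (image \<phi>) (image \<phi>)"

definition T_act :: "(int^2^2) set \<Rightarrow> vertex + edge \<times> real \<Rightarrow> vertex + edge \<times> real" where
  "T_act \<gamma> = realise_map (on_vertex (\<lambda>x. \<gamma> <#\<^bsub>\<Gamma>\<^esub> x)) (\<lambda>x. \<gamma> <#\<^bsub>\<Gamma>\<^esub> x)"

text \<open>The \<open>\<Gamma>\<close>-equivariant isomorphism from \<open>T\<close> to \<open>\<T>\<close>; it is unique up to the parametrisation of
  the edges. The two normalised vertices are the ends of the edge \<open>{\<one>}\<close>.\<close>
definition tree_isomorphism :: "(vertex + edge \<times> real \<Rightarrow> complex) \<Rightarrow> bool" where
  "tree_isomorphism f \<longleftrightarrow>
     homeomorphic_map (realisation T) (top_of_set \<T>) f \<and>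
     (\<forall>\<gamma>\<in>carrier \<Gamma>. \<forall>x\<in>points T. f (T_act \<gamma> x) = act \<gamma> (f x)) \<and>
     f (Inl (Inl (right_orbit G0 {\<one>\<^bsub>\<Gamma>\<^esub>}))) = \<i> \<and>
     f (Inl (Inr (right_orbit G1 {\<one>\<^bsub>\<Gamma>\<^esub>}))) = \<rho>"

text \<open>A lift to \<open>T\<close> of the graph obtained by cutting \<open>Ycomb G\<close> at \<open>C\<close>; the projection from \<open>T\<close> to
  \<open>Ycomb G\<close> sends the edge \<open>{\<gamma>}\<close> to \<open>G <#> {\<gamma>} = G #> \<gamma>\<close>.\<close>
definition is_lift ::
    "(int^2^2) set set \<Rightarrow> vertex set \<Rightarrow> (vertex + vertex \<times> edge \<Rightarrow> vertex) \<Rightarrow> (edge \<Rightarrow> edge) \<Rightarrow> bool"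
  where
  "is_lift G C jV jE \<longleftrightarrow>
     graph_morphism (cut_graph (Ycomb G) C) T jV jE \<and>
     (\<forall>v\<in>verts (cut_graph (Ycomb G) C). on_vertex (\<lambda>x. G <#>\<^bsub>\<Gamma>\<^esub> x) (jV v) = uncut v) \<and>
     (\<forall>e\<in>arcs (cut_graph (Ycomb G) C). G <#>\<^bsub>\<Gamma>\<^esub> jE e = e)"

end

theory Submission
  imports Defs
begin

text \<open>Write \<open>S z = - 1 / z\<close> and \<open>R z = 1 / (1 - z)\<close>. Playing ping-pong with the half-plane
  \<open>Re z \<le> 0\<close> and the wedge beyond the two rays from \<open>\<rho>\<close> to \<open>0\<close> and \<open>\<infinity>\<close> shows that a copy of the
  triangle whose reduced word starts with \<open>S\<close> lies in the half-plane, and one whose word starts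
  with \<open>R\<close> or \<open>R\<^sup>2\<close> lies in the wedge; so two copies meet only along a side or at a vertex, where
  the edges of the tree inside them meet as well. Hence a family of paths indexed by the edges of
  the tree glues to a map on the upper half-plane. This gives an equivariant retraction onto the
  tree, joined to the identity by linear interpolation of the quadratic forms attached to points,
  and everything descends to the quotient by \<open>G\<close>.

  For the polygon, equivariance forces \<open>p\<close> to collapse the copy \<open>\<gamma>\<triangle>\<close> to the edge \<open>\<gamma>[\<i>, \<rho>]\<close>, so
  \<open>Q\<close> is the union of the copies \<open>\<gamma>\<triangle>\<close> with \<open>\<gamma>\<close> in the lifted subtree. Where the subtree stops at
  a vertex, ping-pong confines it to one side of the geodesics carrying the sides of the last
  triangle at that vertex, and everything beyond the vertex lies on the other side.\<close>

section \<open>Computing in the modular group\<close>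

text \<open>The set \<open>P\<close> of the theorem can be larger than the polygon. The fibre of
  \<open>p\<close> over a vertex \<gamma>\<rho> consists of the three sides through that vertex. If
  the lifted tree ends there, which happens when \<open>G\<close> contains a conjugate of
  \<open>gR\<close> fixing it, just one tile of the polygon touches the vertex, and the third side
  sticks out like a whisker. Over a vertex \<gamma>i the fibre is a side of the tile itself, so
  nothing sticks out. Hence the polygon is the regularisation \<open>Q\<close>, and the fibres over
  the leaves of type (1) are added separately. Quadratic forms replace motion along geodesics
  because positive forms make up a convex cone on which the group acts linearly: equivariance then
  needs checking on two generators only. What is needed about words, such as the identity not being
  one of them, is read off from the position of the tiles and not from the algebra of a free
  product.\<close>

interpretation PSL: group \<Gamma>
  by (rule group_PSL2Z)

abbreviation gmult :: "(int^2^2) set \<Rightarrow> (int^2^2) set \<Rightarrow> (int^2^2) set" (infixl \<open>\<odot>\<close> 70)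
  where "a \<odot> b \<equiv> a \<otimes>\<^bsub>\<Gamma>\<^esub> b"

abbreviation gone :: "(int^2^2) set" (\<open>\<e>\<close>)
  where "\<e> \<equiv> \<one>\<^bsub>\<Gamma>\<^esub>"

abbreviation ginv :: "(int^2^2) set \<Rightarrow> (int^2^2) set" (\<open>\<iota>\<close>)
  where "\<iota> a \<equiv> inv\<^bsub>\<Gamma>\<^esub> a"

abbreviation PSL :: "(int^2^2) set set"
  where "PSL \<equiv> carrier \<Gamma>"

section \<open>Integer matrices and their classes up to sign\<close>

definition mat22 :: "int \<Rightarrow> int \<Rightarrow> int \<Rightarrow> int \<Rightarrow> int^2^2"
  where "mat22 a b c d = vector [vector [a, b], vector [c, d]]"

lemma mat22_sel [simp]:
  "mat22 a b c d $1$1 = a" "mat22 a b c d $1$2 = b"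
  "mat22 a b c d $2$1 = c" "mat22 a b c d $2$2 = d"
  by (simp_all add: mat22_def)

lemma mat22_eq_iff: "A = mat22 a b c d \<longleftrightarrow> A$1$1 = a \<and> A$1$2 = b \<and> A$2$1 = c \<and> A$2$2 = d"
  by (auto simp: vec_eq_iff forall_2)

lemma mat22_cases: obtains a b c d where "A = mat22 a b c d"
  by (metis mat22_eq_iff)

lemma mat22_mult:
  "mat22 a b c d ** mat22 a' b' c' d' =
     mat22 (a*a' + b*c') (a*b' + b*d') (c*a' + d*c') (c*b' + d*d')"
  by (simp add: mat22_eq_iff matrix_matrix_mult_def sum_2)

lemma det_mat22 [simp]: "det (mat22 a b c d) = a*d - b*c"
  by (simp add: det_2)

lemma uminus_mat22 [simp]: "- mat22 a b c d = mat22 (-a) (-b) (-c) (-d)"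
  by (simp add: mat22_eq_iff)

lemma mat22_inj: "mat22 a b c d = mat22 a' b' c' d' \<longleftrightarrow> a = a' \<and> b = b' \<and> c = c' \<and> d = d'"
  by (metis mat22_sel)

lemma mat1_mat22: "(mat 1 :: int^2^2) = mat22 1 0 0 1"
  by (simp add: mat22_eq_iff mat_def)

lemma psl_class_eq: "psl_class A = {A, - A}"
proof -
  have "- mat 1 ** A = - A" for A :: "int^2^2"
    by (simp add: vec_eq_iff forall_2 matrix_matrix_mult_def sum_2 mat_def)
  then show ?thesis
    by (simp add: psl_class_def r_coset_def centre_def SL2Z_def insert_commute)
qed

lemma psl_class_in [simp]: "det A = 1 \<Longrightarrow> psl_class A \<in> PSL"
  by (auto simp: PSL2Z_def FactGroup_def RCOSETS_def psl_class_def SL2Z_def)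

lemma modular_cases:
  assumes "\<gamma> \<in> PSL"
  obtains a b c d where "\<gamma> = psl_class (mat22 a b c d)" "a*d - b*c = 1"
proof -
  obtain A where "\<gamma> = psl_class A" "det A = 1"
    using assms by (auto simp: PSL2Z_def FactGroup_def RCOSETS_def psl_class_def SL2Z_def)
  then show ?thesis
    using that by (metis det_mat22 mat22_cases)
qed

lemma psl_class_mult:
  assumes "det A = 1" "det B = 1"
  shows "psl_class A \<odot> psl_class B = psl_class (A ** B)"
proof -
  interpret normal centre SL2Z by (rule normal_centre)
  show ?thesis
    using rcos_sum[of A B] assms by (simp add: PSL2Z_def FactGroup_def psl_class_def SL2Z_def)
qed

lemma one_modular: "\<e> = psl_class (mat22 1 0 0 1)"
  by (simp add: PSL2Z_def FactGroup_def psl_class_eq centre_def mat1_mat22)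

lemma psl_class_eq_iff:
  "psl_class (mat22 a b c d) = psl_class (mat22 a' b' c' d') \<longleftrightarrow>
     (a = a' \<and> b = b' \<and> c = c' \<and> d = d') \<or> (a = -a' \<and> b = -b' \<and> c = -c' \<and> d = -d')"
  by (auto simp: psl_class_eq doubleton_eq_iff mat22_inj)

lemma moebius_uminus: "moebius (- A) z = moebius A z"
proof -
  have "(- x - y) / (- u - v) = (x + y) / (u + v)" for x y u v :: complex
    using minus_divide_divide[of "x + y" "u + v"] by (simp only: minus_add_distrib diff_conv_add_uminus)
  then show ?thesis by (simp add: moebius_def)
qed

lemma act_psl_class [simp]: "act (psl_class A) z = moebius A z"
  by (simp add: act_def psl_class_eq moebius_uminus)

text \<open>Real coefficients, because \<open>hsegment_i_rho\<close> uses the Cayley transform, of determinant \<open>2\<close>.\<close>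

definition rmoebius :: "real \<Rightarrow> real \<Rightarrow> real \<Rightarrow> real \<Rightarrow> complex \<Rightarrow> complex" where
  "rmoebius a b c d z = (of_real a * z + of_real b) / (of_real c * z + of_real d)"

lemma moebius_mat22:
  "moebius (mat22 a b c d) = rmoebius (of_int a) (of_int b) (of_int c) (of_int d)"
  by (simp add: moebius_def rmoebius_def fun_eq_iff)

lemma rmoebius_denominator:
  assumes "a*d - b*c > 0" "Im z > 0"
  shows "of_real c * z + of_real d \<noteq> 0"
proof
  assume 0: "of_real c * z + of_real d = 0"
  then have "c * Im z = 0" by (simp add: complex_eq_iff)
  with assms have "c = 0" by simp
  with 0 have "d = 0" by simp
  with \<open>c = 0\<close> assms show False by simp
qed

lemma Im_rmoebius:
  assumes "a*d - b*c > 0" "Im z > 0"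
  shows "Im (rmoebius a b c d z) = (a*d - b*c) * Im z / (cmod (of_real c * z + of_real d))\<^sup>2"
  by (simp add: rmoebius_def Im_divide cmod_power2 algebra_simps)

lemma rmoebius_upper:
  assumes "a*d - b*c > 0" "Im z > 0"
  shows "Im (rmoebius a b c d z) > 0"
  using Im_rmoebius[OF assms] rmoebius_denominator[OF assms] assms by simp

lemma rmoebius_diff:
  assumes "a*d - b*c > 0" "Im z > 0" "Im w > 0"
  shows "rmoebius a b c d z - rmoebius a b c d w =
    of_real (a*d - b*c) * (z - w) / ((of_real c * z + of_real d) * (of_real c * w + of_real d))"
  using rmoebius_denominator[OF assms(1,2)] rmoebius_denominator[OF assms(1,3)]
  by (simp add: rmoebius_def diff_frac_eq algebra_simps)

lemma rmoebius_mult: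
  assumes "a'*d' - b'*c' > 0" "Im z > 0"
  shows "rmoebius a b c d (rmoebius a' b' c' d' z) =
    rmoebius (a*a' + b*c') (a*b' + b*d') (c*a' + d*c') (c*b' + d*d') z"
proof -
  define N D where "N = of_real a' * z + of_real b'" and "D = of_real c' * z + of_real d'"
  have D: "D \<noteq> 0" using rmoebius_denominator[OF assms] by (simp add: D_def)
  then have "(x * (N / D) + y) = (x * N + y * D) / D" for x y by (simp add: field_simps)
  then have "rmoebius a b c d (N / D) = (a * N + b * D) / (c * N + d * D)"
    using D by (simp add: rmoebius_def)
  also have "\<dots> = rmoebius (a*a' + b*c') (a*b' + b*d') (c*a' + d*c') (c*b' + d*d') z"
    by (simp add: rmoebius_def N_def D_def algebra_simps)
  finally show ?thesis by (simp add: rmoebius_def N_def D_def)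
qed

section \<open>The action on the upper half-plane by homeomorphisms\<close>

lemma act_in [simp]: "\<gamma> \<in> PSL \<Longrightarrow> z \<in> \<H> \<Longrightarrow> act \<gamma> z \<in> \<H>"
  by (erule modular_cases)
     (auto simp: moebius_mat22 upper_half_plane_def intro!: rmoebius_upper simp flip: of_int_mult of_int_diff)

lemma act_mult:
  assumes "\<gamma> \<in> PSL" "\<delta> \<in> PSL" "z \<in> \<H>"
  shows "act (\<gamma> \<odot> \<delta>) z = act \<gamma> (act \<delta> z)"
proof -
  obtain a b c d where \<gamma>: "\<gamma> = psl_class (mat22 a b c d)" "a*d - b*c = 1"
    using assms(1) by (rule modular_cases)
  obtain a' b' c' d' where \<delta>: "\<delta> = psl_class (mat22 a' b' c' d')" "a'*d' - b'*c' = 1"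
    using assms(2) by (rule modular_cases)
  have "real_of_int a' * of_int d' - of_int b' * of_int c' > 0"
    using \<delta>(2) by (metis of_int_1 of_int_diff of_int_mult zero_less_one)
  from rmoebius_mult[OF this] assms(3) show ?thesis
    by (simp add: \<gamma> \<delta> psl_class_mult mat22_mult moebius_mat22 upper_half_plane_def)
qed

lemma act_one [simp]: "act \<e> z = z"
  by (simp add: one_modular moebius_def)

lemma act_inv_act [simp]: "\<gamma> \<in> PSL \<Longrightarrow> z \<in> \<H> \<Longrightarrow> act (\<iota> \<gamma>) (act \<gamma> z) = z"
  by (simp flip: act_mult)

lemma act_act_inv [simp]: "\<gamma> \<in> PSL \<Longrightarrow> z \<in> \<H> \<Longrightarrow> act \<gamma> (act (\<iota> \<gamma>) z) = z"
  by (simp flip: act_mult)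

lemma inj_on_act: "\<gamma> \<in> PSL \<Longrightarrow> inj_on (act \<gamma>) \<H>"
  by (metis act_inv_act inj_onI)

lemma act_image_upper: "\<gamma> \<in> PSL \<Longrightarrow> act \<gamma> ` \<H> = \<H>"
  by (auto simp: image_iff) (metis act_act_inv act_in PSL.inv_closed)

lemma act_image_iff:
  assumes "\<gamma> \<in> PSL" "X \<subseteq> \<H>"
  shows "z \<in> act \<gamma> ` X \<longleftrightarrow> z \<in> \<H> \<and> act (\<iota> \<gamma>) z \<in> X"
  using assms by (auto simp: image_iff subset_iff) (metis act_act_inv)

lemma act_image_mult:
  assumes "\<gamma> \<in> PSL" "\<delta> \<in> PSL" "X \<subseteq> \<H>"
  shows "act (\<gamma> \<odot> \<delta>) ` X = act \<gamma> ` act \<delta> ` X"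
  using assms by (auto simp: image_image act_mult subset_iff intro!: image_cong)

lemma continuous_on_act [continuous_intros]:
  assumes "\<gamma> \<in> PSL" shows "continuous_on \<H> (act \<gamma>)"
proof -
  obtain a b c d where \<gamma>: "\<gamma> = psl_class (mat22 a b c d)" "a*d - b*c = 1"
    using assms by (rule modular_cases)
  have "real_of_int a * of_int d - of_int b * of_int c > 0"
    using \<gamma>(2) by (metis of_int_1 of_int_diff of_int_mult zero_less_one)
  from rmoebius_denominator[OF this]
  have "continuous_on \<H> (rmoebius (of_int a) (of_int b) (of_int c) (of_int d))"
    unfolding rmoebius_def by (intro continuous_intros) (auto simp: upper_half_plane_def)
  then show ?thesis by (simp add: \<gamma> moebius_mat22[symmetric] cong: continuous_on_cong)
qed

lemma open_upper [simp]: "open \<H>"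
  unfolding upper_half_plane_def by (rule open_halfspace_Im_gt)

lemma open_act_image:
  assumes "\<gamma> \<in> PSL" "open U" "U \<subseteq> \<H>"
  shows "open (act \<gamma> ` U)"
proof -
  have "act \<gamma> ` U = \<H> \<inter> act (\<iota> \<gamma>) -` U"
    using act_image_iff[OF assms(1,3)] by auto
  moreover have "open (\<H> \<inter> act (\<iota> \<gamma>) -` U)"
    by (intro continuous_open_preimage assms continuous_on_act PSL.inv_closed) auto
  ultimately show ?thesis by simp
qed

lemma closedin_act_image:
  assumes "\<gamma> \<in> PSL" "closedin (top_of_set \<H>) X"
  shows "closedin (top_of_set \<H>) (act \<gamma> ` X)"
proof -
  have X: "X \<subseteq> \<H>" using assms(2) closedin_imp_subset by blast
  have "act \<gamma> ` X = \<H> \<inter> act (\<iota> \<gamma>) -` X"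
    using act_image_iff[OF assms(1) X] by auto
  moreover have "closedin (top_of_set \<H>) (\<H> \<inter> act (\<iota> \<gamma>) -` X)"
    by (rule continuous_closedin_preimage_gen[where T = \<H>])
       (use assms in \<open>auto intro: continuous_on_act\<close>)
  ultimately show ?thesis by simp
qed


section \<open>Normal forms\<close>

text \<open>As maps these are -1/z, the rotation 1/(1 - z) of order 3 about \<rho>, and the inverse
  of that rotation. The square of \<open>gR\<close> has a name of its own so that alternating words
  need neither exponents nor inverses.\<close>

definition gS :: "(int^2^2) set" where "gS = psl_class (mat22 0 (-1) 1 0)"
definition gR :: "(int^2^2) set" where "gR = psl_class (mat22 0 1 (-1) 1)"
definition gR2 :: "(int^2^2) set" where "gR2 = psl_class (mat22 (-1) 1 (-1) 0)"

lemma gens_in [simp]: "gS \<in> PSL" "gR \<in> PSL" "gR2 \<in> PSL"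
  by (simp_all add: gS_def gR_def gR2_def)

lemma gens_mult [simp]:
  "gS \<odot> gS = \<e>" "gR \<odot> gR = gR2" "gR \<odot> gR2 = \<e>" "gR2 \<odot> gR = \<e>" "gR2 \<odot> gR2 = gR"
  by (simp_all add: gS_def gR_def gR2_def one_modular psl_class_mult mat22_mult psl_class_eq_iff)

lemma gens_mult_assoc [simp]:
  assumes "\<gamma> \<in> PSL"
  shows "gS \<odot> (gS \<odot> \<gamma>) = \<gamma>" "gR \<odot> (gR \<odot> \<gamma>) = gR2 \<odot> \<gamma>" "gR \<odot> (gR2 \<odot> \<gamma>) = \<gamma>"
    "gR2 \<odot> (gR \<odot> \<gamma>) = \<gamma>" "gR2 \<odot> (gR2 \<odot> \<gamma>) = gR \<odot> \<gamma>"
    "\<gamma> \<odot> gS \<odot> gS = \<gamma>" "\<gamma> \<odot> gR \<odot> gR = \<gamma> \<odot> gR2" "\<gamma> \<odot> gR \<odot> gR2 = \<gamma>"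
    "\<gamma> \<odot> gR2 \<odot> gR = \<gamma>" "\<gamma> \<odot> gR2 \<odot> gR2 = \<gamma> \<odot> gR"
  using assms by (simp_all flip: PSL.m_assoc)
    (simp_all add: PSL.m_assoc)

lemma gens_neq [simp]: "gS \<noteq> \<e>" "gR \<noteq> \<e>" "gR2 \<noteq> \<e>" "gR \<noteq> gR2" "gS \<noteq> gR" "gS \<noteq> gR2"
  "\<e> \<noteq> gS" "\<e> \<noteq> gR" "\<e> \<noteq> gR2" "gR2 \<noteq> gR" "gR \<noteq> gS" "gR2 \<noteq> gS"
  by (auto simp: gS_def gR_def gR2_def one_modular psl_class_eq_iff)

lemma inv_gens [simp]: "\<iota> gS = gS" "\<iota> gR = gR2" "\<iota> gR2 = gR"
  by (rule PSL.inv_equality; simp)+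

text \<open>Nonempty alternating words, sorted by their leftmost letter. This letter acts last, so
  it decides in which of the two ping-pong regions the image of the triangle ends up.\<close>

inductive_set wordS :: "(int^2^2) set set" and wordR :: "(int^2^2) set set" where
  S: "gS \<in> wordS"
| SR: "\<delta> \<in> wordR \<Longrightarrow> gS \<odot> \<delta> \<in> wordS"
| R: "gR \<in> wordR"
| R2: "gR2 \<in> wordR"
| RS: "\<delta> \<in> wordS \<Longrightarrow> gR \<odot> \<delta> \<in> wordR"
| R2S: "\<delta> \<in> wordS \<Longrightarrow> gR2 \<odot> \<delta> \<in> wordR"

lemma word_in_aux: "(\<gamma> \<in> wordS \<longrightarrow> \<gamma> \<in> PSL)" "(\<gamma> \<in> wordR \<longrightarrow> \<gamma> \<in> PSL)"
proof -
  have "(x \<in> wordS \<longrightarrow> x \<in> PSL) \<and> (y \<in> wordR \<longrightarrow> y \<in> PSL)" for x y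
    by (rule wordS_wordR.induct) simp_all
  then show "(\<gamma> \<in> wordS \<longrightarrow> \<gamma> \<in> PSL)" "(\<gamma> \<in> wordR \<longrightarrow> \<gamma> \<in> PSL)" by blast+
qed

lemma word_in [simp]: "\<gamma> \<in> wordS \<Longrightarrow> \<gamma> \<in> PSL" "\<gamma> \<in> wordR \<Longrightarrow> \<gamma> \<in> PSL"
  using word_in_aux by auto

definition words :: "(int^2^2) set set" where
  "words = insert \<e> (wordS \<union> wordR)"

lemma words_in: "\<gamma> \<in> words \<Longrightarrow> \<gamma> \<in> PSL"
  by (auto simp: words_def)

lemma words_left_mult:
  assumes "\<gamma> \<in> words"
  shows "gS \<odot> \<gamma> \<in> words" "gR \<odot> \<gamma> \<in> words" "gR2 \<odot> \<gamma> \<in> words"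
proof -
  consider "\<gamma> = \<e>" | "\<gamma> \<in> wordS" | "\<gamma> \<in> wordR" using assms by (auto simp: words_def)
  then have "gS \<odot> \<gamma> \<in> words \<and> gR \<odot> \<gamma> \<in> words \<and> gR2 \<odot> \<gamma> \<in> words"
  proof cases
    case 1 then show ?thesis by (auto simp: words_def intro: wordS_wordR.intros)
  next
    case 2
    then have "gS \<odot> \<gamma> \<in> words"
      by (cases rule: wordS.cases) (auto simp: words_def)
    then show ?thesis using 2 by (auto simp: words_def intro: wordS_wordR.intros)
  next
    case 3
    then have "gR \<odot> \<gamma> \<in> words \<and> gR2 \<odot> \<gamma> \<in> words"
      by (cases rule: wordR.cases) (auto simp: words_def intro: wordS_wordR.intros)
    then show ?thesis using 3 by (auto simp: words_def intro: wordS_wordR.intros)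
  qed
  then show "gS \<odot> \<gamma> \<in> words" "gR \<odot> \<gamma> \<in> words" "gR2 \<odot> \<gamma> \<in> words" by auto
qed

definition gT :: "int \<Rightarrow> (int^2^2) set" where "gT n = psl_class (mat22 1 n 0 1)"

lemma gT_in [simp]: "gT n \<in> PSL"
  by (simp add: gT_def)

lemma gT_mult: "gT m \<odot> gT n = gT (m + n)"
  by (simp add: gT_def psl_class_mult mat22_mult algebra_simps)

lemma gT_1: "gT 1 = gR2 \<odot> gS" "gT (-1) = gS \<odot> gR"
  by (simp_all add: gT_def gS_def gR_def gR2_def psl_class_mult mat22_mult psl_class_eq_iff)

text \<open>Translation by 1 is \<open>gR2\<close> times \<open>gS\<close>, its inverse is
  \<open>gS\<close> times \<open>gR\<close>; so each unit of \<open>n\<close> prepends two letters,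
  and \<open>words\<close> is closed under prepending letters.\<close>

lemma gT_word:
  assumes "\<gamma> \<in> words" shows "gT n \<odot> \<gamma> \<in> words"
proof (induction n rule: int_induct[where k = 0])
  case base
  show ?case using assms words_in[OF assms] by (simp add: gT_def flip: one_modular)
next
  case (step1 i)
  have "gT (i + 1) \<odot> \<gamma> = gR2 \<odot> (gS \<odot> (gT i \<odot> \<gamma>))"
    using words_in[OF assms] by (simp add: add.commute[of i] flip: gT_mult gT_1 PSL.m_assoc)
  with step1 show ?case by (simp add: words_left_mult)
next
  case (step2 i)
  have "gT (i - 1) = gT (-1) \<odot> gT i" by (simp add: gT_mult)
  then have "gT (i - 1) \<odot> \<gamma> = gS \<odot> (gR \<odot> (gT i \<odot> \<gamma>))"
    using words_in[OF assms] by (simp add: gT_1 flip: PSL.m_assoc)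
  with step2 show ?case by (simp add: words_left_mult)
qed

text \<open>Euclid's algorithm on the first column.\<close>

lemma psl_class_word: "a*d - b*c = 1 \<Longrightarrow> psl_class (mat22 a b c d) \<in> words"
proof (induction "nat \<bar>c\<bar>" arbitrary: a b c d rule: less_induct)
  case less
  show ?case
  proof (cases "c = 0")
    case True
    with less.prems have ad: "a * d = 1" by simp
    then have "a = 1 \<and> d = 1 \<or> a = -1 \<and> d = -1" by (rule zmult_eq_1_iff[THEN iffD1])
    then have "psl_class (mat22 a b c d) = gT (a*b) \<odot> \<e>"
      using True by (auto simp: gT_def psl_class_eq_iff)
    then show ?thesis using gT_word[of \<e> "a*b"] by (simp add: words_def)
  next
    case False
    \<comment> \<open>Removing the translation by \<open>q\<close> and applying \<open>gS\<close>
      turns the bottom row into \<open>(a - q*c, b - q*d)\<close>, whose first entry is the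
      remainder \<open>a mod c\<close>, smaller than \<open>c\<close> in absolute value.\<close>
    define q where "q = a div c"
    have r: "a - q * c = a mod c" by (simp add: q_def minus_div_mult_eq_mod)
    have "\<bar>a mod c\<bar> < \<bar>c\<bar>" using False by (simp add: abs_mod_less)
    then have lt: "nat \<bar>a - q*c\<bar> < nat \<bar>c\<bar>" by (simp add: r)
    have det: "(-c) * (b - q*d) - (-d) * (a - q*c) = 1" using less.prems by (simp add: algebra_simps)
    have "psl_class (mat22 (-c) (-d) (a - q*c) (b - q*d)) \<in> words"
      by (rule less.hyps[OF lt]) (rule det)
    then have "gT q \<odot> (gS \<odot> psl_class (mat22 (-c) (-d) (a - q*c) (b - q*d))) \<in> words"
      by (intro gT_word words_left_mult)
    moreover have "gT q \<odot> (gS \<odot> psl_class (mat22 (-c) (-d) (a - q*c) (b - q*d)))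
        = psl_class (mat22 a b c d)"
      using det by (simp add: gT_def gS_def psl_class_mult mat22_mult psl_class_eq_iff algebra_simps)
    ultimately show ?thesis by simp
  qed
qed

lemma modular_words: "PSL = words"
  using words_in psl_class_word by (auto elim!: modular_cases)

lemma modular_word_cases:
  assumes "\<gamma> \<in> PSL"
  obtains "\<gamma> = \<e>" | "\<gamma> \<in> wordS" | "\<gamma> \<in> wordR"
  using assms by (auto simp: modular_words words_def)

text \<open>A letter appended on the right only touches the last letter of the word. The first
  letter survives unless it is also the last one and cancels.\<close>

lemma word_right_mult_aux:
  "(x \<in> wordS \<longrightarrow> (x \<odot> gS \<in> wordS \<or> x = gS) \<and> x \<odot> gR \<in> wordS \<and> x \<odot> gR2 \<in> wordS) \<and>
   (y \<in> wordR \<longrightarrow> y \<odot> gS \<in> wordR \<and> (y \<odot> gR \<in> wordR \<or> y = gR2) \<and> (y \<odot> gR2 \<in> wordR \<or> y = gR))"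
proof (rule wordS_wordR.induct)
  fix \<delta> assume *: "\<delta> \<in> wordR" "\<delta> \<odot> gS \<in> wordR \<and> (\<delta> \<odot> gR \<in> wordR \<or> \<delta> = gR2) \<and> (\<delta> \<odot> gR2 \<in> wordR \<or> \<delta> = gR)"
  then show "(gS \<odot> \<delta> \<odot> gS \<in> wordS \<or> gS \<odot> \<delta> = gS) \<and> gS \<odot> \<delta> \<odot> gR \<in> wordS \<and> gS \<odot> \<delta> \<odot> gR2 \<in> wordS"
    by (auto simp: PSL.m_assoc intro: wordS_wordR.intros)
next
  fix \<delta> assume *: "\<delta> \<in> wordS" "(\<delta> \<odot> gS \<in> wordS \<or> \<delta> = gS) \<and> \<delta> \<odot> gR \<in> wordS \<and> \<delta> \<odot> gR2 \<in> wordS"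
  then show "gR \<odot> \<delta> \<odot> gS \<in> wordR \<and> (gR \<odot> \<delta> \<odot> gR \<in> wordR \<or> gR \<odot> \<delta> = gR2) \<and> (gR \<odot> \<delta> \<odot> gR2 \<in> wordR \<or> gR \<odot> \<delta> = gR)"
    "gR2 \<odot> \<delta> \<odot> gS \<in> wordR \<and> (gR2 \<odot> \<delta> \<odot> gR \<in> wordR \<or> gR2 \<odot> \<delta> = gR2) \<and> (gR2 \<odot> \<delta> \<odot> gR2 \<in> wordR \<or> gR2 \<odot> \<delta> = gR)"
    by (auto simp: PSL.m_assoc intro: wordS_wordR.intros)
qed (auto intro: wordS_wordR.intros)

lemma wordS_right_mult:
  assumes "\<gamma> \<in> wordS"
  shows "\<gamma> \<odot> gS \<in> wordS \<or> \<gamma> = gS" "\<gamma> \<odot> gR \<in> wordS" "\<gamma> \<odot> gR2 \<in> wordS"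
  using assms word_right_mult_aux by auto

lemma wordR_right_mult:
  assumes "\<gamma> \<in> wordR"
  shows "\<gamma> \<odot> gS \<in> wordR" "\<gamma> \<odot> gR \<in> wordR \<or> \<gamma> = gR2" "\<gamma> \<odot> gR2 \<in> wordR \<or> \<gamma> = gR"
  using assms word_right_mult_aux by auto

text \<open>Right multiplication by a letter passes to an edge of the tree sharing a vertex, so this
  is induction along paths in the tree starting at the edge of the identity.\<close>

lemma modular_right_induct [consumes 1, case_names one step]:
  assumes "\<gamma> \<in> PSL" and "P \<e>"
    and step: "\<And>\<gamma> x. \<gamma> \<in> PSL \<Longrightarrow> P \<gamma> \<Longrightarrow> x \<in> {gS, gR, gR2} \<Longrightarrow> P (\<gamma> \<odot> x)"
  shows "P \<gamma>"
proof -
  \<comment> \<open>Words grow on the left while the induction appends on the right; an arbitrary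
    prefix \<delta> reconciles the two.\<close>
  have "(x \<in> wordS \<longrightarrow> (\<forall>\<delta>\<in>PSL. P \<delta> \<longrightarrow> P (\<delta> \<odot> x))) \<and> (y \<in> wordR \<longrightarrow> (\<forall>\<delta>\<in>PSL. P \<delta> \<longrightarrow> P (\<delta> \<odot> y)))" for x y
    by (rule wordS_wordR.induct) (auto simp: step simp flip: PSL.m_assoc)
  from this[of \<gamma> \<gamma>] have *: "\<gamma> \<in> wordS \<or> \<gamma> \<in> wordR \<longrightarrow> P (\<e> \<odot> \<gamma>)"
    using \<open>P \<e>\<close> by blast
  from assms(1) show ?thesis
    by (cases rule: modular_word_cases) (use * \<open>P \<e>\<close> assms(1) in auto)
qed

lemma gen_by_gens: "G0 = {\<e>, gS}" "G1 = {\<e>, gR, gR2}"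
proof -
  have S: "vector [vector [0, -1], vector [1, 0]] = mat22 0 (-1) 1 0"
   and R: "vector [vector [0, 1], vector [-1, 1]] = mat22 0 1 (-1) 1"
    by (simp_all add: mat22_def)
  have "subgroup {\<e>, gS} \<Gamma>"
    by (rule PSL.subgroupI) auto
  then have "G0 \<subseteq> {\<e>, gS}"
    unfolding G0_def S gS_def[symmetric] by (intro PSL.generate_subgroup_incl) auto
  moreover have "{\<e>, gS} \<subseteq> G0"
    unfolding G0_def S gS_def[symmetric] by (auto intro: generate.intros)
  ultimately show "G0 = {\<e>, gS}" by blast
  have "subgroup {\<e>, gR, gR2} \<Gamma>"
    by (rule PSL.subgroupI) auto
  then have "G1 \<subseteq> {\<e>, gR, gR2}"
    unfolding G1_def R gR_def[symmetric] by (intro PSL.generate_subgroup_incl) auto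
  moreover have "{\<e>, gR, gR2} \<subseteq> G1"
    unfolding G1_def R gR_def[symmetric] using generate.eng[of gR \<Gamma> "{gR}" gR]
    by (auto intro: generate.intros)
  ultimately show "G1 = {\<e>, gR, gR2}" by blast
qed


section \<open>The tessellation by copies of the triangle\<close>

lemma act_gS: "act gS z = - 1 / z"
  by (simp add: gS_def moebius_def)

lemma act_gR: "act gR z = 1 / (1 - z)"
  by (simp add: gR_def moebius_def)

lemma act_gR2: "z \<noteq> 0 \<Longrightarrow> act gR2 z = 1 - 1 / z"
  by (simp add: gR2_def moebius_def field_simps)

text \<open>The squared modulus serves as a coordinate next to \<open>Re\<close>: geodesics become
  linear equations in \<open>Re z\<close> and \<open>nsq z\<close>, and the generators act on these
  coordinates by quotients of linear expressions with denominator \<open>nsq z\<close> or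
  \<open>nsq z - 2 * Re z + 1\<close>, the squared modulus of z - 1.\<close>

definition nsq :: "complex \<Rightarrow> real" where "nsq z = (Re z)\<^sup>2 + (Im z)\<^sup>2"

lemma nsq_pos: "z \<in> \<H> \<Longrightarrow> nsq z > 0"
  by (auto simp: nsq_def upper_half_plane_def intro: add_nonneg_pos)

lemma nsq_pos': "z \<in> \<H> \<Longrightarrow> nsq z - 2 * Re z + 1 > 0"
proof -
  assume "z \<in> \<H>"
  then have "(Re z - 1)\<^sup>2 + (Im z)\<^sup>2 > 0"
    by (auto simp: upper_half_plane_def intro: add_nonneg_pos)
  then show ?thesis by (simp add: nsq_def power2_eq_square algebra_simps)
qed

lemma upper_nonzero: "z \<in> \<H> \<Longrightarrow> z \<noteq> 0"
  by (auto simp: upper_half_plane_def)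

lemma gS_coords: "z \<in> \<H> \<Longrightarrow>
    Re (act gS z) = - Re z / nsq z \<and> Im (act gS z) = Im z / nsq z \<and> nsq (act gS z) = 1 / nsq z"
  using nsq_pos[of z]
  by (auto simp: act_gS nsq_def Re_divide Im_divide power_divide power2_eq_square
      simp flip: add_divide_distrib)

lemma gR_coords: "z \<in> \<H> \<Longrightarrow>
    Re (act gR z) = (1 - Re z) / (nsq z - 2 * Re z + 1) \<and>
    Im (act gR z) = Im z / (nsq z - 2 * Re z + 1) \<and>
    nsq (act gR z) = 1 / (nsq z - 2 * Re z + 1)"
proof -
  assume "z \<in> \<H>"
  then have m: "nsq z - 2 * Re z + 1 > 0" by (rule nsq_pos')
  have *: "nsq z - 2 * Re z + 1 = (1 - Re z)\<^sup>2 + (Im z)\<^sup>2"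
    by (simp add: nsq_def power2_eq_square algebra_simps)
  have "Re (act gR z) = (1 - Re z) / (nsq z - 2 * Re z + 1)"
    "Im (act gR z) = Im z / (nsq z - 2 * Re z + 1)"
    by (simp_all add: act_gR Re_divide Im_divide *)
  moreover from this have "nsq (act gR z) = 1 / (nsq z - 2 * Re z + 1)"
    using m unfolding nsq_def[of "act gR z"]
    by (simp add: power_divide * power2_eq_square flip: add_divide_distrib)
  ultimately show ?thesis by simp
qed

lemma gR2_coords: "z \<in> \<H> \<Longrightarrow>
    Re (act gR2 z) = 1 - Re z / nsq z \<and> Im (act gR2 z) = Im z / nsq z \<and>
    nsq (act gR2 z) = (nsq z - 2 * Re z + 1) / nsq z"
proof -
  assume z: "z \<in> \<H>"
  then have n: "nsq z > 0" by (rule nsq_pos)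
  have "Re (act gR2 z) = 1 - Re z / nsq z" "Im (act gR2 z) = Im z / nsq z"
    using upper_nonzero[OF z] by (simp_all add: act_gR2 Re_divide Im_divide nsq_def)
  moreover have "(1 - x / n)\<^sup>2 + (y / n)\<^sup>2 = (n - 2 * x + 1) / n"
    if "n > 0" "n = x\<^sup>2 + y\<^sup>2" for x y n :: real
  proof -
    have "(1 - x / n)\<^sup>2 + (y / n)\<^sup>2 = ((n - x)\<^sup>2 + y\<^sup>2) / n\<^sup>2"
      using that(1) by (simp add: diff_divide_eq_iff power_divide add_divide_distrib)
    also have "(n - x)\<^sup>2 + y\<^sup>2 = n * (n - 2 * x + 1)"
      using that(2) by (simp add: power2_eq_square algebra_simps)
    finally show ?thesis using that(1) by (simp add: power2_eq_square)
  qed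
  from this[OF n] have "(1 - Re z / nsq z)\<^sup>2 + (Im z / nsq z)\<^sup>2 = (nsq z - 2 * Re z + 1) / nsq z"
    by (simp add: nsq_def)
  ultimately have "nsq (act gR2 z) = (nsq z - 2 * Re z + 1) / nsq z"
    by (simp add: nsq_def[of "act gR2 z"])
  then show ?thesis
    using upper_nonzero[OF z] by (simp add: act_gR2 Re_divide Im_divide nsq_def)
qed

lemma gT_coords: "Re (act (gT n) z) = Re z + of_int n" "Im (act (gT n) z) = Im z"
  by (simp_all add: gT_def moebius_def)

lemma cmod_minus_1: "1 \<le> cmod (z - 1) \<longleftrightarrow> 2 * Re z \<le> nsq z" "1 < cmod (z - 1) \<longleftrightarrow> 2 * Re z < nsq z"
proof -
  have "(cmod (z - 1))\<^sup>2 = nsq z - 2 * Re z + 1"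
    unfolding cmod_power2 nsq_def by (simp add: power2_eq_square algebra_simps)
  moreover have "1 \<le> cmod (z - 1) \<longleftrightarrow> 1 \<le> (cmod (z - 1))\<^sup>2"  "1 < cmod (z - 1) \<longleftrightarrow> 1 < (cmod (z - 1))\<^sup>2"
    by (metis abs_norm_cancel abs_square_less_1 not_less)
       (metis abs_norm_cancel abs_square_le_1 not_le)
  ultimately show "1 \<le> cmod (z - 1) \<longleftrightarrow> 2 * Re z \<le> nsq z" "1 < cmod (z - 1) \<longleftrightarrow> 2 * Re z < nsq z" by auto
qed

lemma triangle_iff: "z \<in> \<triangle> \<longleftrightarrow> z \<in> \<H> \<and> 0 \<le> Re z \<and> Re z \<le> 1/2 \<and> 2 * Re z \<le> nsq z"
  by (simp add: triangle_def cmod_minus_1)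

lemma triangle_upper: "\<triangle> \<subseteq> \<H>"
  by (auto simp: triangle_def)

lemma triangle_in_upper [simp]: "z \<in> \<triangle> \<Longrightarrow> z \<in> \<H>"
  by (auto simp: triangle_def)

text \<open>The region cut off by the two rays from \<open>\<rho>\<close> to \<open>0\<close> and \<open>\<infinity>\<close> on the side of \<open>1\<close>.\<close>
definition wedge :: "complex set" where
  "wedge = {z \<in> \<H>. 1/2 \<le> Re z \<or> nsq z \<le> 2 * Re z}"

text \<open>Describes the three tiles adjacent to the triangle, namely its images under
  \<open>gS\<close>, \<open>gR2\<close> and \<open>gR\<close> in this order. All denominators are
  positive, so the inequalities can be multiplied out.\<close>

lemma gens_triangle_iff:
  assumes "z \<in> \<H>"
  shows "act gS z \<in> \<triangle> \<longleftrightarrow> Re z \<le> 0 \<and> - 2 * Re z \<le> nsq z \<and> - 2 * Re z \<le> 1"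
    "act gR z \<in> \<triangle> \<longleftrightarrow> Re z \<le> 1 \<and> 1 \<le> nsq z \<and> 1 \<le> 2 * Re z"
    "act gR2 z \<in> \<triangle> \<longleftrightarrow> Re z \<le> nsq z \<and> nsq z \<le> 2 * Re z \<and> nsq z \<le> 1"
proof -
  note n = nsq_pos[OF assms] nsq_pos'[OF assms]
  have 1: "0 \<le> - x / n \<and> - x / n \<le> 1/2 \<and> 2 * (- x / n) \<le> 1 / n \<longleftrightarrow>
      x \<le> 0 \<and> - 2 * x \<le> n \<and> - 2 * x \<le> 1" if "n > 0" for x n :: real
  proof -
    have "0 \<le> - x / n \<longleftrightarrow> x \<le> 0" "- x / n \<le> 1/2 \<longleftrightarrow> - 2 * x \<le> n" "2 * (- x / n) \<le> 1 / n \<longleftrightarrow> - 2 * x \<le> 1"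
      using that by (auto simp: divide_simps)
    then show ?thesis by simp
  qed
  show "act gS z \<in> \<triangle> \<longleftrightarrow> Re z \<le> 0 \<and> - 2 * Re z \<le> nsq z \<and> - 2 * Re z \<le> 1"
    using 1[OF n(1), of "Re z"] gS_coords[OF assms] assms by (simp add: triangle_iff)
  have 2: "0 \<le> (1 - x) / m \<and> (1 - x) / m \<le> 1/2 \<and> 2 * ((1 - x) / m) \<le> 1 / m \<longleftrightarrow>
      x \<le> 1 \<and> 2 - 2 * x \<le> m \<and> 1 \<le> 2 * x" if "m > 0" for x m :: real
  proof -
    have "0 \<le> (1 - x) / m \<longleftrightarrow> x \<le> 1" "(1 - x) / m \<le> 1/2 \<longleftrightarrow> 2 - 2 * x \<le> m"
      "2 * ((1 - x) / m) \<le> 1 / m \<longleftrightarrow> 1 \<le> 2 * x"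
      using that by (auto simp add: zero_le_divide_iff pos_divide_le_eq divide_le_cancel)
    then show ?thesis by simp
  qed
  show "act gR z \<in> \<triangle> \<longleftrightarrow> Re z \<le> 1 \<and> 1 \<le> nsq z \<and> 1 \<le> 2 * Re z"
    using 2[OF n(2), of "Re z"] gR_coords[OF assms] assms by (auto simp: triangle_iff)
  have 3: "0 \<le> 1 - x / n \<and> 1 - x / n \<le> 1/2 \<and> 2 * (1 - x / n) \<le> (n - 2 * x + 1) / n \<longleftrightarrow>
      x \<le> n \<and> n \<le> 2 * x \<and> n \<le> 1" if "n > 0" for x n :: real
  proof -
    have "0 \<le> 1 - x / n \<longleftrightarrow> x \<le> n" "1 - x / n \<le> 1/2 \<longleftrightarrow> n \<le> 2 * x"
      "2 * (1 - x / n) \<le> (n - 2 * x + 1) / n \<longleftrightarrow> n \<le> 1"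
      using that by (auto simp add: field_simps)
    then show ?thesis by simp
  qed
  show "act gR2 z \<in> \<triangle> \<longleftrightarrow> Re z \<le> nsq z \<and> nsq z \<le> 2 * Re z \<and> nsq z \<le> 1"
    using 3[OF n(1), of "Re z"] gR2_coords[OF assms] assms by (auto simp: triangle_iff)
qed

lemma wedge_Re_pos: "z \<in> wedge \<Longrightarrow> Re z > 0"
  using nsq_pos[of z] by (auto simp: wedge_def)

text \<open>The rays from \<rho> to the cusps 0, 1 and \<infinity> cut the plane into three sectors,
  which the rotation \<open>gR\<close> permutes cyclically. The hypotheses describe the closed
  sector between 0 and \<infinity>; the other two make up the wedge.\<close>

lemma rotate_into_wedge:
  assumes "z \<in> \<H>" "Re z \<le> 1/2" "2 * Re z \<le> nsq z"
  shows "act gR z \<in> wedge" "act gR2 z \<in> wedge"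
proof -
  have n: "nsq z > 0" "nsq z - 2 * Re z + 1 > 0" using assms nsq_pos nsq_pos' by auto
  have "nsq (act gR z) \<le> 2 * Re (act gR z)"
    using gR_coords[OF assms(1)] n assms by (simp add: divide_right_mono)
  then show "act gR z \<in> wedge" using assms by (simp add: wedge_def)
  have "Re z / nsq z \<le> 1/2" using n assms by (simp add: field_simps)
  then have "1/2 \<le> Re (act gR2 z)"
    using gR2_coords[OF assms(1)] by linarith
  then show "act gR2 z \<in> wedge" using assms by (simp add: wedge_def)
qed

lemma act_gS_Re: "z \<in> \<H> \<Longrightarrow> Re (act gS z) \<le> 0 \<longleftrightarrow> Re z \<ge> 0" "z \<in> \<H> \<Longrightarrow> Re (act gS z) < 0 \<longleftrightarrow> Re z > 0"
  "z \<in> \<H> \<Longrightarrow> Re (act gS z) = 0 \<longleftrightarrow> Re z = 0" "z \<in> \<H> \<Longrightarrow> Re (act gS z) \<ge> 0 \<longleftrightarrow> Re z \<le> 0"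
  using conjunct1[OF gS_coords[of z]] nsq_pos[of z]
  by (auto simp: zero_le_divide_iff divide_le_0_iff divide_less_0_iff zero_less_divide_iff)

lemma word_triangle_aux:
  "(x \<in> wordS \<longrightarrow> (\<forall>z\<in>\<triangle>. Re (act x z) \<le> 0)) \<and> (y \<in> wordR \<longrightarrow> (\<forall>z\<in>\<triangle>. act y z \<in> wedge))"
proof (rule wordS_wordR.induct)
  show "\<forall>z\<in>\<triangle>. Re (act gS z) \<le> 0" by (simp add: act_gS_Re triangle_iff)
  show "\<forall>z\<in>\<triangle>. act gR z \<in> wedge" "\<forall>z\<in>\<triangle>. act gR2 z \<in> wedge"
    by (auto simp: triangle_iff intro: rotate_into_wedge)
next
  fix \<delta> assume "\<delta> \<in> wordR" "\<forall>z\<in>\<triangle>. act \<delta> z \<in> wedge"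
  then show "\<forall>z\<in>\<triangle>. Re (act (gS \<odot> \<delta>) z) \<le> 0"
    by (auto simp: act_mult act_gS_Re intro!: less_imp_le wedge_Re_pos)
next
  fix \<delta> assume \<delta>: "\<delta> \<in> wordS" "\<forall>z\<in>\<triangle>. Re (act \<delta> z) \<le> 0"
  have "Re (act \<delta> z) \<le> 1/2 \<and> 2 * Re (act \<delta> z) \<le> nsq (act \<delta> z)" if "z \<in> \<triangle>" for z
    using \<delta> that nsq_pos[of "act \<delta> z"] by force
  then show "\<forall>z\<in>\<triangle>. act (gR \<odot> \<delta>) z \<in> wedge" "\<forall>z\<in>\<triangle>. act (gR2 \<odot> \<delta>) z \<in> wedge"
    using \<delta>(1) by (auto simp: act_mult intro!: rotate_into_wedge)
qed

lemma wordS_triangle: "\<gamma> \<in> wordS \<Longrightarrow> z \<in> \<triangle> \<Longrightarrow> Re (act \<gamma> z) \<le> 0"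
  and wordR_triangle: "\<gamma> \<in> wordR \<Longrightarrow> z \<in> \<triangle> \<Longrightarrow> act \<gamma> z \<in> wedge"
  using word_triangle_aux by blast+

text \<open>The only source of information about how tiles overlap: words beyond single letters are
  excluded by ping-pong, and for a single letter both points lie on the sides along which the two
  tiles meet. For a point of the triangle, lying in the wedge means lying on one of the two sides at
  \<rho>.\<close>

lemma triangle_neighbours:
  assumes z: "z \<in> \<triangle>" and w: "act \<gamma> z \<in> \<triangle>" and \<gamma>: "\<gamma> \<in> PSL"
  shows "\<gamma> = \<e> \<or> (\<gamma> = gS \<and> Re z = 0 \<and> Re (act \<gamma> z) = 0) \<or>
     (\<gamma> \<in> {gR, gR2} \<and> z \<in> wedge \<and> act \<gamma> z \<in> wedge)"
  using \<gamma>
proof (cases rule: modular_word_cases)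
  case 1 then show ?thesis by simp
next
  case 2
  with wordS_triangle z w have w0: "Re (act \<gamma> z) = 0" by (force simp: triangle_iff)
  from 2 show ?thesis
  proof (cases rule: wordS.cases)
    case S
    then show ?thesis using w0 act_gS_Re(3)[of z] z by auto
  next
    case (SR \<delta>)
    then have "Re (act \<gamma> z) < 0"
      using z wedge_Re_pos[OF wordR_triangle[OF SR(2) z]] by (simp add: act_mult act_gS_Re)
    with w0 show ?thesis by simp
  qed
next
  case 3
  have ww: "act \<gamma> z \<in> wedge" by (rule wordR_triangle[OF 3 z])
  have rw: "act gR (act \<gamma> z) \<in> wedge" "act gR2 (act \<gamma> z) \<in> wedge"
    using w by (auto simp: triangle_iff intro!: rotate_into_wedge)
  \<comment> \<open>Undoing the first letter of \<gamma> rotates a point of the triangle, which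
    lands in the wedge with positive real part. But the result is the image of z under a word
    starting with \<open>gS\<close>, of real part at most 0.\<close>
  have False if "\<delta> \<in> wordS" "\<gamma> = gR \<odot> \<delta> \<or> \<gamma> = gR2 \<odot> \<delta>" for \<delta>
  proof -
    have "act gR2 (act \<gamma> z) = act \<delta> z \<or> act gR (act \<gamma> z) = act \<delta> z"
      using that z by (auto simp flip: act_mult)
    then have "Re (act \<delta> z) > 0" using rw wedge_Re_pos by metis
    with wordS_triangle[OF that(1) z] show False by simp
  qed
  with 3 consider "\<gamma> = gR" | "\<gamma> = gR2" by (cases rule: wordR.cases) blast+
  then show ?thesis
  proof cases
    case 1
    then have "act gR2 (act \<gamma> z) = z" using z by (simp flip: act_mult)
    with rw ww 1 show ?thesis by simp
  next
    case 2
    then have "act gR (act \<gamma> z) = z" using z by (simp flip: act_mult)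
    with rw ww 2 show ?thesis by simp
  qed
qed

section \<open>Interior and closure of the triangle\<close>

lemma interior_triangle: "interior \<triangle> = {z \<in> \<H>. 0 < Re z \<and> Re z < 1/2 \<and> 2 * Re z < nsq z}"
proof
  have "{z::complex. 1 \<le> cmod (z - 1)} = - ball 1 1"
    by (auto simp: dist_norm norm_minus_commute[of 1])
  then have "interior {z::complex. 1 \<le> cmod (z - 1)} = {z. 1 < cmod (z - 1)}"
    by (auto simp: interior_complement dist_norm norm_minus_commute[of 1])
  moreover have "interior {z::complex. 0 \<le> Re z} = {z. 0 < Re z}"
    "interior {z::complex. Re z \<le> 1/2} = {z. Re z < 1/2}"
    using interior_halfspace_ge[of "1::complex" 0] interior_halfspace_le[of "1::complex" "1/2"]
    by auto
  moreover have "interior \<triangle> \<subseteq> interior {z. 0 \<le> Re z} \<inter> interior {z. Re z \<le> 1/2} \<inter>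
      interior {z. 1 \<le> cmod (z - 1)}"
    by (intro Int_greatest interior_mono) (auto simp: triangle_def simp del: triangle_in_upper)
  ultimately have "interior \<triangle> \<subseteq> {z. 0 < Re z \<and> Re z < 1/2 \<and> 1 < cmod (z - 1)}" by auto
  moreover have "interior \<triangle> \<subseteq> \<H>" using interior_subset triangle_upper by (rule subset_trans)
  ultimately show "interior \<triangle> \<subseteq> {z \<in> \<H>. 0 < Re z \<and> Re z < 1/2 \<and> 2 * Re z < nsq z}"
    unfolding cmod_minus_1 by blast
  have "open {z \<in> \<H>. 0 < Re z \<and> Re z < 1/2 \<and> 2 * Re z < nsq z}"
    unfolding nsq_def upper_half_plane_def mem_Collect_eq
    by (intro open_Collect_conj open_Collect_less continuous_intros)
  then show "{z \<in> \<H>. 0 < Re z \<and> Re z < 1/2 \<and> 2 * Re z < nsq z} \<subseteq> interior \<triangle>"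
    by (intro interior_maximal) (auto simp: triangle_iff)
qed

lemma interior_triangle_nonempty: "interior \<triangle> \<noteq> {}"
proof -
  have "Complex (1/4) 1 \<in> interior \<triangle>"
    by (simp add: interior_triangle upper_half_plane_def nsq_def power2_eq_square)
  then show ?thesis by blast
qed

lemma interior_triangle_unique:
  assumes "z \<in> interior \<triangle>" "act \<gamma> z \<in> \<triangle>" "\<gamma> \<in> PSL"
  shows "\<gamma> = \<e>"
proof -
  have "z \<in> \<triangle>" using assms interior_subset by blast
  from triangle_neighbours[OF this assms(2,3)] assms(1) show ?thesis
    by (auto simp: interior_triangle wedge_def)
qed

lemma triangle_closure_interior: "\<triangle> \<subseteq> closure (interior \<triangle>)"
proof
  fix z assume z: "z \<in> \<triangle>"
  then have y: "Im z > 0" and x: "0 \<le> Re z" "Re z \<le> 1/2" and n: "2 * Re z \<le> nsq z"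
    by (auto simp: triangle_iff upper_half_plane_def)
  \<comment> \<open>The real part is pulled towards 1/4, the middle of the strip. The height gains
    \<open>t / Im z\<close>, so its square gains at least \<open>2 * t\<close>, whereas x^2 - 2 x
    drops by at most \<open>t\<close>; hence the path is strictly off the circle at once.\<close>
  define g where "g t = Complex (Re z + t * (1/4 - Re z)) (Im z + t / Im z)" for t
  have "g t \<in> interior \<triangle>" if t: "0 < t" "t < 1" for t
  proof -
    define x' where "x' = Re z + t * (1/4 - Re z)"
    have x'1: "x' = (1 - t) * Re z + t * (1/4)" by (simp add: x'_def algebra_simps)
    have pos: "0 < x'" unfolding x'1 using t x by (intro add_nonneg_pos) auto
    have "(1 - t) * Re z \<le> (1 - t) * (1/2)" using t x by (intro mult_left_mono) auto
    then have lt: "x' < 1/2" unfolding x'1 using t by (simp add: algebra_simps)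
    have "(x' - Re z) * (2 - x' - Re z) \<le> t"
    proof (cases "Re z \<le> 1/4")
      case True
      have "0 \<le> 2 - x' - Re z" "2 - x' - Re z \<le> 2" using lt x pos by linarith+
      moreover have "x' - Re z \<le> t * (1/4)" using t x by (simp add: x'_def)
      ultimately have "(x' - Re z) * (2 - x' - Re z) \<le> (t * (1/4)) * 2"
        using t by (intro mult_mono) auto
      also have "\<dots> \<le> t" using t by simp
      finally show ?thesis .
    next
      case False
      then have "x' - Re z \<le> 0" using t by (auto simp: x'_def mult_le_0_iff)
      moreover have "2 - x' - Re z \<ge> 0" using x lt by simp
      ultimately have "(x' - Re z) * (2 - x' - Re z) \<le> 0" by (rule mult_nonpos_nonneg)
      then show ?thesis using t by simp
    qed
    then have a: "(Re z)\<^sup>2 - 2 * Re z - t \<le> x'\<^sup>2 - 2 * x'" by (simp add: power2_eq_square algebra_simps)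
    have "(Im z + t / Im z)\<^sup>2 = (Im z)\<^sup>2 + 2 * t + (t / Im z)\<^sup>2"
      using y by (simp add: power2_sum)
    then have b: "(Im z + t / Im z)\<^sup>2 \<ge> (Im z)\<^sup>2 + 2 * t" by simp
    have "2 * x' < x'\<^sup>2 + (Im z + t / Im z)\<^sup>2"
      using a b n t unfolding nsq_def by linarith
    then show ?thesis
      using pos lt t y by (simp add: interior_triangle g_def nsq_def upper_half_plane_def x'_def add_pos_pos)
  qed
  then have ev: "eventually (\<lambda>t. g t \<in> closure (interior \<triangle>)) (at_right 0)"
    by (intro eventually_at_rightI[of 0 1]) (use closure_subset in auto)
  have "((\<lambda>t. Complex (Re z + t * (1/4 - Re z)) (Im z + t / Im z)) \<longlongrightarrow>
      Complex (Re z + 0 * (1/4 - Re z)) (Im z + 0 / Im z)) (at_right 0)"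
    using y by (intro tendsto_intros) auto
  then have "(g \<longlongrightarrow> z) (at_right 0)" unfolding g_def by simp
  then show "z \<in> closure (interior \<triangle>)"
    by (rule Lim_in_closed_set[rotated 3, OF _ closed_closure ev]) simp
qed

lemma closedin_triangle: "closedin (top_of_set \<H>) \<triangle>"
proof -
  have "\<triangle> = \<H> \<inter> {z. 0 \<le> Re z \<and> Re z \<le> 1/2 \<and> 1 \<le> cmod (z - 1)}"
    by (auto simp: triangle_def simp del: triangle_in_upper)
  moreover have "closed {z. 0 \<le> Re z \<and> Re z \<le> 1/2 \<and> 1 \<le> cmod (z - 1)}"
    by (intro closed_Collect_conj closed_Collect_le continuous_intros)
  ultimately show ?thesis using closedin_closed_Int by (metis (no_types))
qed

text \<open>Gauss reduction: take a point of largest height in the orbit and translate it into the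
  strip of real parts between -1/2 and 1/2. Since \<open>gS\<close> cannot raise it further, its
  modulus is at least 1. The right half of the domain so obtained lies in the triangle, and
  \<open>gS\<close> takes the left half into it.\<close>

lemma triangle_covers:
  assumes z: "z \<in> \<H>"
  shows "\<exists>\<gamma>\<in>PSL. z \<in> act \<gamma> ` \<triangle>"
proof -
  have y: "Im z > 0" using z by (simp add: upper_half_plane_def)
  define q where "q = (\<lambda>(c, d). cmod (of_int c * z + of_int d))"
  \<comment> \<open>The height of an image of z is \<open>Im z\<close> divided by the squared
    modulus of c z + d, so maximal height means a minimal bottom row. Only rows of modulus at most 1
    compete with (0, 1), and there are finitely many: \<open>c\<close> is bounded through imaginary
    parts, then \<open>d\<close> through \<open>c\<close>.\<close>
  define N where "N = {(c, d). (\<exists>a b. a * d - b * c = (1::int)) \<and> q (c, d) \<le> 1}"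
  define M where "M = \<lceil>1 / Im z\<rceil> + \<lceil>1 + cmod z / Im z\<rceil>"
  have "N \<subseteq> {-M..M} \<times> {-M..M}"
  proof
    fix p assume "p \<in> N"
    then obtain c d where p: "p = (c, d)" and q1: "cmod (of_int c * z + of_int d) \<le> 1"
      by (auto simp: N_def q_def)
    have "\<bar>of_int c * Im z\<bar> \<le> 1"
      using abs_Im_le_cmod[of "of_int c * z + of_int d"] q1 by simp
    then have c: "\<bar>real_of_int c\<bar> \<le> 1 / Im z" using y by (simp add: abs_mult field_simps)
    have "\<bar>real_of_int d\<bar> = cmod ((of_int c * z + of_int d) - of_int c * z)" by simp
    also have "\<dots> \<le> 1 + \<bar>real_of_int c\<bar> * cmod z"
      using q1 norm_triangle_ineq4[of "of_int c * z + of_int d" "of_int c * z"] by (simp add: norm_mult)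
    also have "\<dots> \<le> 1 + cmod z / Im z"
      using mult_right_mono[OF c, of "cmod z"] by simp
    finally have d: "\<bar>real_of_int d\<bar> \<le> 1 + cmod z / Im z" .
    have "\<bar>c\<bar> \<le> \<lceil>1 / Im z\<rceil>" "\<bar>d\<bar> \<le> \<lceil>1 + cmod z / Im z\<rceil>"
      using c d by linarith+
    then show "p \<in> {-M..M} \<times> {-M..M}" unfolding p M_def by auto
  qed
  then have fin: "finite N" by (rule finite_subset) simp
  have "(0, 1) \<in> N" by (auto simp: N_def q_def)
  then obtain c d where cd: "(c, d) \<in> N" and min: "\<And>p. p \<in> N \<Longrightarrow> q (c, d) \<le> q p"
    using ex_min_if_finite[of "q ` N"] fin
    by (metis (no_types, lifting) arg_min_if_finite(1) arg_min_least empty_iff surj_pair)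
  then obtain a b where ab: "a * d - b * c = 1" by (auto simp: N_def)
  have im: "Im (moebius (mat22 a b c d) z) = Im z / (q (c, d))\<^sup>2" and q0: "q (c, d) > 0"
    if "a * d - b * c = 1" for a b c d
  proof -
    have "real_of_int a * of_int d - of_int b * of_int c = 1"
      using that by (metis of_int_1 of_int_diff of_int_mult)
    then show "Im (moebius (mat22 a b c d) z) = Im z / (q (c, d))\<^sup>2" "q (c, d) > 0"
      using Im_rmoebius[of "of_int a" "of_int d" "of_int b" "of_int c" z]
        rmoebius_denominator[of "of_int a" "of_int d" "of_int b" "of_int c" z] y
      by (simp_all add: moebius_mat22 q_def)
  qed
  define \<gamma> where "\<gamma> = psl_class (mat22 a b c d)"
  have \<gamma>: "\<gamma> \<in> PSL" using ab by (simp add: \<gamma>_def)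
  have max: "Im (act \<delta> z) \<le> Im (act \<gamma> z)" if \<delta>: "\<delta> \<in> PSL" for \<delta>
  proof -
    obtain a' b' c' d' where d: "\<delta> = psl_class (mat22 a' b' c' d')" "a' * d' - b' * c' = 1"
      using \<delta> by (rule modular_cases)
    have "q (c, d) \<le> q (c', d')"
    proof (cases "q (c', d') \<le> 1")
      case True then show ?thesis using min[of "(c', d')"] d(2) by (auto simp: N_def)
    next
      case False then show ?thesis using cd by (auto simp: N_def)
    qed
    then have "Im z / (q (c', d'))\<^sup>2 \<le> Im z / (q (c, d))\<^sup>2"
      using q0[OF ab] q0[OF d(2)] y by (intro divide_left_mono power_mono mult_pos_pos) auto
    then show ?thesis using im[OF ab] im[OF d(2)] by (simp add: \<gamma>_def d(1))
  qed
  define n where "n = - round (Re (act \<gamma> z))"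
  define w where "w = act (gT n) (act \<gamma> z)"
  have w: "w = act (gT n \<odot> \<gamma>) z" "w \<in> \<H>" using \<gamma> z by (simp_all add: w_def act_mult)
  have Re: "\<bar>Re w\<bar> \<le> 1/2"
    using of_int_round_abs_le[of "Re (act \<gamma> z)"] by (simp add: w_def gT_coords n_def abs_minus_commute)
  have "Im (act gS w) \<le> Im w"
    using max[of "gS \<odot> (gT n \<odot> \<gamma>)"] \<gamma> z by (simp add: w act_mult) (simp add: gT_coords)
  then have "Im w / nsq w \<le> Im w" using gS_coords[OF w(2)] by simp
  then have n1: "nsq w \<ge> 1"
    using w(2) nsq_pos[OF w(2)] by (auto simp: upper_half_plane_def field_simps)
  have "\<exists>\<delta>\<in>PSL. act \<delta> z \<in> \<triangle>"
  proof (cases "Re w \<ge> 0")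
    case True
    then have "w \<in> \<triangle>" using Re n1 w by (auto simp: triangle_iff)
    then show ?thesis using \<gamma> w by auto
  next
    case False
    then have "act gS w \<in> \<triangle>"
      using Re n1 w(2) by (simp add: gens_triangle_iff)
    then have "act (gS \<odot> (gT n \<odot> \<gamma>)) z \<in> \<triangle>" using \<gamma> z by (simp add: w act_mult)
    then show ?thesis using \<gamma> by (meson gens_in(1) gT_in PSL.m_closed)
  qed
  then show ?thesis using act_image_iff[OF _ triangle_upper] z
    by (metis PSL.inv_closed PSL.inv_inv)
qed

text \<open>The interior of the union of the triangle with its three adjacent tiles: an open
  neighbourhood of the whole triangle, whose translates witness local finiteness.\<close>

definition star :: "complex set" where
  "star = {z \<in> \<H>. - 1/2 < Re z \<and> Re z < 1 \<and> nsq z + 2 * Re z > 0 \<and> nsq z > Re z}"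

lemma open_star: "open star"
  unfolding star_def nsq_def upper_half_plane_def mem_Collect_eq
  by (intro open_Collect_conj open_Collect_less continuous_intros)

lemma triangle_star: "\<triangle> \<subseteq> star"
proof
  fix z assume z: "z \<in> \<triangle>"
  then have "nsq z > 0" by (intro nsq_pos) auto
  with z show "z \<in> star" by (auto simp: triangle_iff star_def)
qed

lemma star_subset:
  assumes z: "z \<in> star"
  shows "\<exists>\<gamma>\<in>{\<e>, gS, gR, gR2}. z \<in> act \<gamma> ` \<triangle>"
proof -
  have zH: "z \<in> \<H>" and x: "- 1/2 < Re z" "Re z < 1" and n: "nsq z + 2 * Re z > 0" "nsq z > Re z"
    using z by (auto simp: star_def)
  consider "0 \<le> Re z" "Re z \<le> 1/2" "2 * Re z \<le> nsq z" | "Re z \<le> 0" | "1/2 \<le> Re z" "1 \<le> nsq z"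
    | "0 < Re z" "nsq z \<le> 1" "nsq z \<le> 2 * Re z"
    by linarith
  then show ?thesis
  proof cases
    case 1
    then have "z \<in> \<triangle>" using zH by (simp add: triangle_iff)
    then show ?thesis by (auto intro!: bexI[of _ \<e>] image_eqI[of _ _ z])
  next
    case 2
    then have "act gS z \<in> \<triangle>"
      using x n zH by (simp add: gens_triangle_iff)
    then show ?thesis using zH by (simp add: act_image_iff[OF _ triangle_upper])
  next
    case 3
    then have "act gR z \<in> \<triangle>"
      using x n zH by (simp add: gens_triangle_iff)
    then show ?thesis using zH by (simp add: act_image_iff[OF _ triangle_upper])
  next
    case 4
    then have "act gR2 z \<in> \<triangle>"
      using x n zH by (simp add: gens_triangle_iff)
    then show ?thesis using zH by (simp add: act_image_iff[OF _ triangle_upper])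
  qed
qed

text \<open>A tile meeting \<open>star\<close> shares a point with the triangle or with one of its
  neighbours, hence is at most a neighbour of a neighbour.\<close>

lemma star_meets:
  assumes "\<gamma> \<in> PSL" "act \<gamma> ` \<triangle> \<inter> star \<noteq> {}"
  shows "\<gamma> \<in> (\<lambda>(x, y). x \<odot> y) ` ({\<e>, gS, gR, gR2} \<times> {\<e>, gS, gR, gR2})"
proof -
  obtain z where z: "z \<in> \<triangle>" "act \<gamma> z \<in> star" using assms by blast
  from star_subset[OF z(2)]
  obtain x w where x: "x \<in> {\<e>, gS, gR, gR2}" and w: "w \<in> \<triangle>" "act \<gamma> z = act x w"
    by (elim bexE imageE)
  have xin: "x \<in> PSL" using x by auto
  have "act (\<iota> x \<odot> \<gamma>) z = w"
    using w z xin assms(1) by (simp add: act_mult)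
  with triangle_neighbours[OF z(1), of "\<iota> x \<odot> \<gamma>"] w xin assms(1)
  have "\<iota> x \<odot> \<gamma> \<in> {\<e>, gS, gR, gR2}" by auto
  moreover have "\<gamma> = x \<odot> (\<iota> x \<odot> \<gamma>)"
    using xin assms(1) by (simp flip: PSL.m_assoc)
  ultimately show ?thesis using x by (metis (no_types, lifting) SigmaI case_prod_conv image_eqI)
qed

lemma triangles_locally_finite:
  assumes "z \<in> \<H>"
  obtains U where "open U" "z \<in> U" "U \<subseteq> \<H>" "finite {\<gamma> \<in> PSL. act \<gamma> ` \<triangle> \<inter> U \<noteq> {}}"
proof -
  obtain \<delta> where \<delta>: "\<delta> \<in> PSL" "z \<in> act \<delta> ` \<triangle>" using triangle_covers[OF assms] by blast
  have sH: "star \<subseteq> \<H>" by (auto simp: star_def)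
  let ?F = "(\<lambda>(x, y). x \<odot> y) ` ({\<e>, gS, gR, gR2} \<times> {\<e>, gS, gR, gR2})"
  have "{\<gamma> \<in> PSL. act \<gamma> ` \<triangle> \<inter> act \<delta> ` star \<noteq> {}} \<subseteq> (\<lambda>x. \<delta> \<odot> x) ` ?F"
  proof
    fix \<gamma> assume *: "\<gamma> \<in> {\<gamma> \<in> PSL. act \<gamma> ` \<triangle> \<inter> act \<delta> ` star \<noteq> {}}"
    then obtain u v where u: "u \<in> \<triangle>" "v \<in> star" "act \<gamma> u = act \<delta> v" by blast
    with * \<delta> sH have "act (\<iota> \<delta> \<odot> \<gamma>) u = v" by (auto simp: act_mult)
    then have "\<iota> \<delta> \<odot> \<gamma> \<in> ?F" using star_meets[of "\<iota> \<delta> \<odot> \<gamma>"] u * \<delta> by blast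
    moreover have "\<gamma> = \<delta> \<odot> (\<iota> \<delta> \<odot> \<gamma>)" using * \<delta> by (simp flip: PSL.m_assoc)
    ultimately show "\<gamma> \<in> (\<lambda>x. \<delta> \<odot> x) ` ?F" by blast
  qed
  then have "finite {\<gamma> \<in> PSL. act \<gamma> ` \<triangle> \<inter> act \<delta> ` star \<noteq> {}}"
    by (rule finite_subset) simp
  moreover have "open (act \<delta> ` star)" "act \<delta> ` star \<subseteq> \<H>"
    using open_act_image[OF \<delta>(1) open_star sH] act_image_upper[OF \<delta>(1)] sH by auto
  moreover have "z \<in> act \<delta> ` star" using \<delta> triangle_star by blast
  ultimately show ?thesis using that by blast
qed


section \<open>Hyperbolic distance, segments and half-planes\<close>

lemma upper_iff: "z \<in> \<H> \<longleftrightarrow> Im z > 0"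
  by (simp add: upper_half_plane_def)

lemma hdist_ge_one: "z \<in> \<H> \<Longrightarrow> w \<in> \<H> \<Longrightarrow> 1 \<le> 1 + (cmod (z - w))\<^sup>2 / (2 * Im z * Im w)"
  by (simp add: upper_iff)

lemma cosh_hdist:
  assumes "z \<in> \<H>" "w \<in> \<H>"
  shows "cosh (hdist z w) = 1 + (cmod (z - w))\<^sup>2 / (2 * Im z * Im w)"
  unfolding hdist_def using hdist_ge_one[OF assms] by (rule cosh_arcosh_real)

lemma hdist_nonneg [simp]: "z \<in> \<H> \<Longrightarrow> w \<in> \<H> \<Longrightarrow> hdist z w \<ge> 0"
  unfolding hdist_def using hdist_ge_one[of z w] by (intro arcosh_nonneg_real) auto

lemma hdist_commute: "hdist z w = hdist w z"
  by (simp add: hdist_def norm_minus_commute mult.commute mult.left_commute)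

lemma hdist_le_iff:
  assumes "z \<in> \<H>" "w \<in> \<H>" "z' \<in> \<H>" "w' \<in> \<H>"
  shows "hdist z w \<le> hdist z' w' \<longleftrightarrow>
    (cmod (z - w))\<^sup>2 / (Im z * Im w) \<le> (cmod (z' - w'))\<^sup>2 / (Im z' * Im w')"
proof -
  have "hdist z w \<le> hdist z' w' \<longleftrightarrow> cosh (hdist z w) \<le> cosh (hdist z' w')"
    using assms by (simp add: cosh_real_nonneg_le_iff)
  also have "\<dots> \<longleftrightarrow> ((cmod (z - w))\<^sup>2 / (Im z * Im w)) / 2 \<le> ((cmod (z' - w'))\<^sup>2 / (Im z' * Im w')) / 2"
    using assms by (simp add: cosh_hdist mult_ac)
  also have "\<dots> \<longleftrightarrow> (cmod (z - w))\<^sup>2 / (Im z * Im w) \<le> (cmod (z' - w'))\<^sup>2 / (Im z' * Im w')"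
    by (rule divide_le_cancel[THEN trans]) simp
  finally show ?thesis .
qed

lemma sinh_half_hdist:
  assumes "z \<in> \<H>" "w \<in> \<H>"
  shows "sinh (hdist z w / 2) = cmod (z - w) / (2 * sqrt (Im z * Im w))"
    and "cosh (hdist z w / 2) = cmod (z - cnj w) / (2 * sqrt (Im z * Im w))"
proof -
  have y: "Im z > 0" "Im w > 0" using assms by (auto simp: upper_iff)
  have "cosh (hdist z w) = 1 + 2 * (sinh (hdist z w / 2))\<^sup>2"
    using cosh_double[of "hdist z w / 2"] cosh_square_eq[of "hdist z w / 2"] by simp
  then have s: "(sinh (hdist z w / 2))\<^sup>2 = (cmod (z - w))\<^sup>2 / (4 * (Im z * Im w))"
    using cosh_hdist[OF assms] by simp
  also have "\<dots> = (cmod (z - w) / (2 * sqrt (Im z * Im w)))\<^sup>2"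
    using y by (simp add: power_divide power_mult_distrib)
  finally show "sinh (hdist z w / 2) = cmod (z - w) / (2 * sqrt (Im z * Im w))"
    using assms y by (simp add: power2_eq_iff_nonneg)
  have "(cosh (hdist z w / 2))\<^sup>2 = ((cmod (z - w))\<^sup>2 + 4 * (Im z * Im w)) / (4 * (Im z * Im w))"
    using y s by (simp add: cosh_square_eq add_divide_distrib)
  also have "(cmod (z - w))\<^sup>2 + 4 * (Im z * Im w) = (cmod (z - cnj w))\<^sup>2"
    unfolding cmod_power2 by (simp add: power2_eq_square algebra_simps)
  also have "(cmod (z - cnj w))\<^sup>2 / (4 * (Im z * Im w)) = (cmod (z - cnj w) / (2 * sqrt (Im z * Im w)))\<^sup>2"
    using y by (simp add: power_divide power_mult_distrib)
  finally show "cosh (hdist z w / 2) = cmod (z - cnj w) / (2 * sqrt (Im z * Im w))"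
    using assms y by (simp add: power2_eq_iff_nonneg)
qed

lemma ptolemy: "cmod (a - c) * cmod (b - d) \<le> cmod (a - b) * cmod (c - d) + cmod (a - d) * cmod (b - c)"
proof -
  have "(a - c) * (b - d) = (a - b) * (c - d) + (a - d) * (b - c)" by (simp add: algebra_simps)
  then show ?thesis by (metis norm_mult norm_triangle_ineq)
qed

text \<open>For half distances, sinh and cosh are the Euclidean distances from z to w and from z to
  \<open>cnj w\<close>, divided by the same factor. Ptolemy's inequality for z, u, w and
  \<open>cnj u\<close> is then sinh a \<le> sinh (b + c), expanded by the addition theorem.\<close>

lemma hdist_triangle:
  assumes "z \<in> \<H>" "u \<in> \<H>" "w \<in> \<H>"
  shows "hdist z w \<le> hdist z u + hdist u w"
proof -
  have y: "Im z > 0" "Im u > 0" "Im w > 0" using assms by (auto simp: upper_iff)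
  define s t r where "s = sqrt (Im z)" and "t = sqrt (Im u)" and "r = sqrt (Im w)"
  have pos: "s > 0" "t > 0" "r > 0" and t2: "t * t = Im u" using y by (auto simp: s_def t_def r_def)
  have cu: "cmod (u - cnj u) = 2 * Im u" using y(2) by (simp add: complex_diff_cnj norm_mult)
  have cw: "cmod (u - cnj w) = cmod (cnj u - w)"
    by (metis complex_cnj_cnj complex_cnj_diff complex_mod_cnj)
  have pt: "cmod (z - w) * (2 * Im u) \<le> cmod (z - u) * cmod (u - cnj w) + cmod (z - cnj u) * cmod (u - w)"
    using ptolemy[of z w u "cnj u"] by (simp add: cu cw norm_minus_commute)
  have "sinh (hdist z w / 2) = cmod (z - w) * (2 * Im u) / (4 * s * (t * t) * r)"
    using assms y pos by (simp add: sinh_half_hdist real_sqrt_mult s_def r_def t2)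
  also have "\<dots> \<le> (cmod (z - u) * cmod (u - cnj w) + cmod (z - cnj u) * cmod (u - w)) / (4 * s * (t * t) * r)"
    by (rule divide_right_mono[OF pt]) (use pos in simp)
  also have "\<dots> = sinh (hdist z u / 2 + hdist u w / 2)"
    using assms pos
    by (simp add: sinh_half_hdist real_sqrt_mult sinh_add flip: s_def t_def r_def)
       (simp add: field_simps)
  finally show ?thesis by simp
qed

lemma hdist_rmoebius:
  assumes det: "a*d - b*c > 0" and "z \<in> \<H>" "w \<in> \<H>"
  shows "hdist (rmoebius a b c d z) (rmoebius a b c d w) = hdist z w"
proof -
  have y: "Im z > 0" "Im w > 0" using assms by (auto simp: upper_iff)
  define p q where "p = cmod (of_real c * z + of_real d)" and "q = cmod (of_real c * w + of_real d)"
  have pq: "p > 0" "q > 0"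
    using rmoebius_denominator[OF det y(1)] rmoebius_denominator[OF det y(2)] by (auto simp: p_def q_def)
  have 1: "cmod (rmoebius a b c d z - rmoebius a b c d w) = (a*d - b*c) * cmod (z - w) / (p * q)"
    using det by (simp add: rmoebius_diff[OF det y] norm_divide norm_mult p_def q_def del: of_real_diff of_real_mult)
  define D where "D = a*d - b*c"
  have "((D * x) / (p * q))\<^sup>2 / (2 * (D * u / p\<^sup>2) * (D * v / q\<^sup>2)) = x\<^sup>2 / (2 * u * v)"
    if "u > 0" "v > 0" for x u v
    using pq det that by (simp add: D_def[symmetric] power_divide power_mult_distrib power2_eq_square)
  then show ?thesis
    unfolding hdist_def 1 Im_rmoebius[OF det y(1)] Im_rmoebius[OF det y(2)]
    using y by (simp add: D_def p_def q_def)
qed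

lemma hdist_act [simp]:
  assumes "\<gamma> \<in> PSL" "z \<in> \<H>" "w \<in> \<H>"
  shows "hdist (act \<gamma> z) (act \<gamma> w) = hdist z w"
proof -
  obtain a b c d where \<gamma>: "\<gamma> = psl_class (mat22 a b c d)" "a*d - b*c = 1"
    using assms(1) by (rule modular_cases)
  have "real_of_int a * of_int d - of_int b * of_int c > 0"
    using \<gamma>(2) by (metis of_int_1 of_int_diff of_int_mult zero_less_one)
  then show ?thesis using assms by (simp add: \<gamma> moebius_mat22 hdist_rmoebius)
qed

section \<open>Vertical geodesics and the segment from i to \<rho>\<close>

lemma cosh_ln_diff:
  assumes "a > 0" "b > (0::real)"
  shows "cosh (ln a - ln b) = 1 + (a - b)\<^sup>2 / (2 * a * b)"
proof -
  have "cosh (ln a - ln b) = (a / b + b / a) / 2"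
    using assms cosh_ln_real[of "a / b"] by (simp add: ln_div)
  also have "\<dots> = 1 + (a - b)\<^sup>2 / (2 * a * b)"
    using assms by (simp add: field_simps power2_eq_square)
  finally show ?thesis .
qed

lemma hdist_vertical:
  assumes "z \<in> \<H>" "w \<in> \<H>" "Re z = Re w"
  shows "hdist z w = \<bar>ln (Im z) - ln (Im w)\<bar>"
proof -
  have "cosh (hdist z w) = cosh (ln (Im z) - ln (Im w))"
    using assms by (simp add: cosh_hdist cosh_ln_diff upper_iff cmod_power2)
  then show ?thesis using assms by simp
qed

lemma hdist_gt_vertical:
  assumes "z \<in> \<H>" "w \<in> \<H>" "Re z \<noteq> Re w"
  shows "hdist z w > \<bar>ln (Im z) - ln (Im w)\<bar>"
proof -
  have y: "Im z > 0" "Im w > 0" using assms by (auto simp: upper_iff)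
  have "(Im z - Im w)\<^sup>2 < (cmod (z - w))\<^sup>2" using assms by (simp add: cmod_power2)
  then have "cosh \<bar>ln (Im z) - ln (Im w)\<bar> < cosh (hdist z w)"
    using y assms by (simp add: cosh_hdist cosh_ln_diff divide_strict_right_mono)
  then show ?thesis using assms by (subst (asm) cosh_real_nonneg_less_iff) auto
qed

text \<open>Along a vertical the distance is the difference of logarithms of heights, which is
  additive exactly for intermediate heights. A point off the vertical makes both legs strictly
  longer than these differences.\<close>

lemma hsegment_vertical:
  assumes "z \<in> \<H>" "w \<in> \<H>" "Re z = Re w" "Im w \<le> Im z"
  shows "u \<in> hsegment z w \<longleftrightarrow> u \<in> \<H> \<and> Re u = Re z \<and> Im w \<le> Im u \<and> Im u \<le> Im z"
proof (cases "u \<in> \<H>")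
  case True
  have y: "Im z > 0" "Im w > 0" "Im u > 0" using assms True by (auto simp: upper_iff)
  have l: "ln (Im w) \<le> ln (Im z)" using assms y by simp
  show ?thesis
  proof (cases "Re u = Re z")
    case eq: True
    have "hdist z u + hdist u w = hdist z w \<longleftrightarrow> ln (Im w) \<le> ln (Im u) \<and> ln (Im u) \<le> ln (Im z)"
      using True assms eq l by (auto simp: hdist_vertical)
    then show ?thesis using True eq y by (simp add: hsegment_def)
  next
    case False
    have "hdist z u > \<bar>ln (Im z) - ln (Im u)\<bar>" "hdist u w > \<bar>ln (Im u) - ln (Im w)\<bar>"
      using False assms True by (auto intro: hdist_gt_vertical)
    moreover have "hdist z w = \<bar>ln (Im z) - ln (Im w)\<bar>" using assms by (simp add: hdist_vertical)
    ultimately show ?thesis using False by (auto simp: hsegment_def)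
  qed
qed (auto simp: hsegment_def)

lemma rho_coords: "Re \<rho> = 1/2" "Im \<rho> = sqrt 3 / 2"
  by (simp_all add: \<rho>_def Re_exp Im_exp cos_60 sin_60)

lemma rho_upper [simp]: "\<rho> \<in> \<H>" and i_upper [simp]: "\<i> \<in> \<H>"
  by (simp_all add: upper_iff rho_coords)

lemma nsq_rho [simp]: "nsq \<rho> = 1" and nsq_i [simp]: "nsq \<i> = 1"
  by (simp_all add: nsq_def rho_coords power_divide)

lemma cayley_coords:
  assumes "z \<in> \<H>"
  shows "Re (rmoebius 1 (-1) 1 1 z) = (nsq z - 1) / (nsq z + 2 * Re z + 1)"
    "Im (rmoebius 1 (-1) 1 1 z) = 2 * Im z / (nsq z + 2 * Re z + 1)"
    "nsq z + 2 * Re z + 1 > 0"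
proof -
  have *: "nsq z + 2 * Re z + 1 = (1 + Re z)\<^sup>2 + (Im z)\<^sup>2"
    by (simp add: nsq_def power2_eq_square algebra_simps)
  show "nsq z + 2 * Re z + 1 > 0"
    unfolding * using assms by (intro add_nonneg_pos) (auto simp: upper_iff)
  show "Re (rmoebius 1 (-1) 1 1 z) = (nsq z - 1) / (nsq z + 2 * Re z + 1)"
    "Im (rmoebius 1 (-1) 1 1 z) = 2 * Im z / (nsq z + 2 * Re z + 1)"
    unfolding * by (simp_all add: rmoebius_def Re_divide Im_divide add.commute)
       (simp_all add: nsq_def power2_eq_square algebra_simps)
qed

text \<open>The isometry z \<mapsto> (z - 1)/(z + 1) carries the unit semicircle to the imaginary
  axis, fixes i and sends \<rho> to i times \<open>sqrt 3 / 3\<close>. This reduces the arc to a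
  vertical segment.\<close>

lemma hsegment_i_rho: "hsegment \<i> \<rho> = {z \<in> \<H>. nsq z = 1 \<and> 0 \<le> Re z \<and> Re z \<le> 1/2}"
proof (rule Set.set_eqI)
  fix u
  define \<phi> where "\<phi> = rmoebius 1 (-1) 1 1"
  have \<phi>H: "\<phi> z \<in> \<H>" if "z \<in> \<H>" for z
    using that by (auto simp: \<phi>_def upper_iff intro: rmoebius_upper)
  have hd: "hdist (\<phi> z) (\<phi> w) = hdist z w" if "z \<in> \<H>" "w \<in> \<H>" for z w
    using that by (simp add: \<phi>_def hdist_rmoebius)
  show "u \<in> hsegment \<i> \<rho> \<longleftrightarrow> u \<in> {z \<in> \<H>. nsq z = 1 \<and> 0 \<le> Re z \<and> Re z \<le> 1/2}"
  proof (cases "u \<in> \<H>")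
    case True
    define x where "x = Re u"
    have co: "Re (\<phi> \<i>) = 0" "Im (\<phi> \<i>) = 1" "Re (\<phi> \<rho>) = 0" "Im (\<phi> \<rho>) = sqrt 3 / 3"
      unfolding \<phi>_def by (simp_all add: cayley_coords rho_coords)
    have s3: "sqrt 3 / 3 \<le> (1::real)" by (simp add: real_le_lsqrt)
    have "u \<in> hsegment \<i> \<rho> \<longleftrightarrow> \<phi> u \<in> hsegment (\<phi> \<i>) (\<phi> \<rho>)"
      using True \<phi>H by (simp add: hsegment_def hd)
    also have "\<dots> \<longleftrightarrow> Re (\<phi> u) = 0 \<and> sqrt 3 / 3 \<le> Im (\<phi> u) \<and> Im (\<phi> u) \<le> 1"
      using True \<phi>H s3 by (subst hsegment_vertical) (auto simp: co)
    also have "\<dots> \<longleftrightarrow> nsq u = 1 \<and> 0 \<le> x \<and> x \<le> 1/2"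
    proof (cases "nsq u = 1")
      case n: True
      have y: "Im u > 0" "(Im u)\<^sup>2 = (1 - x) * (1 + x)"
        using True n by (auto simp: upper_iff nsq_def x_def power2_eq_square algebra_simps)
      have px: "1 + x > 0" using cayley_coords(3)[OF True] n by (simp add: x_def)
      have "0 < (1 - x) * (1 + x)" using y by (metis zero_less_power)
      with px have qx: "1 - x > 0" by (simp add: zero_less_mult_iff)
      have "Im (\<phi> u) = Im u / (1 + x)"
      proof -
        have "Im (\<phi> u) = 2 * Im u / (2 * (1 + x))"
          using cayley_coords(2)[OF True] n by (simp add: \<phi>_def x_def)
        also have "\<dots> = Im u / (1 + x)" by (rule mult_divide_mult_cancel_left) simp
        finally show ?thesis .
      qed
      then have I: "Im (\<phi> u) \<ge> 0" "(Im (\<phi> u))\<^sup>2 = (1 - x) / (1 + x)"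
        using y px by (simp_all add: power_divide power2_eq_square)
      have "sqrt 3 / 3 \<le> Im (\<phi> u) \<longleftrightarrow> (sqrt 3 / 3)\<^sup>2 \<le> (Im (\<phi> u))\<^sup>2"
        using I(1) by (auto simp: power2_le_iff_abs_le intro: power_mono)
      also have "\<dots> \<longleftrightarrow> 1/3 \<le> (1 - x) / (1 + x)" by (simp add: I power_divide)
      also have "\<dots> \<longleftrightarrow> x \<le> 1/2" using px by (auto simp: field_simps)
      finally have a: "sqrt 3 / 3 \<le> Im (\<phi> u) \<longleftrightarrow> x \<le> 1/2" .
      have "Im (\<phi> u) \<le> 1 \<longleftrightarrow> (Im (\<phi> u))\<^sup>2 \<le> 1" using I(1) abs_square_le_1[of "Im (\<phi> u)"] by simp
      also have "\<dots> \<longleftrightarrow> 0 \<le> x" using px by (auto simp: I field_simps)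
      finally have b: "Im (\<phi> u) \<le> 1 \<longleftrightarrow> 0 \<le> x" .
      show ?thesis using n a b cayley_coords(1)[OF True] by (auto simp: \<phi>_def)
    next
      case False
      then show ?thesis using cayley_coords(1,3)[OF True] by (auto simp: \<phi>_def)
    qed
    finally show ?thesis using True by (simp add: x_def)
  qed (auto simp: hsegment_def)
qed

section \<open>Half-planes and convexity\<close>

lemma hsegment_act:
  assumes "\<gamma> \<in> PSL" "z \<in> \<H>" "w \<in> \<H>"
  shows "hsegment (act \<gamma> z) (act \<gamma> w) = act \<gamma> ` hsegment z w"
proof (rule Set.set_eqI)
  fix u
  have "hsegment z w \<subseteq> \<H>" by (auto simp: hsegment_def)
  moreover have "hdist (act \<gamma> z) u = hdist z (act (\<iota> \<gamma>) u)" "hdist u (act \<gamma> w) = hdist (act (\<iota> \<gamma>) u) w"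
    if "u \<in> \<H>"
    using assms that hdist_act[of \<gamma> z "act (\<iota> \<gamma>) u"] hdist_act[of \<gamma> "act (\<iota> \<gamma>) u" w] by auto
  ultimately show "u \<in> hsegment (act \<gamma> z) (act \<gamma> w) \<longleftrightarrow> u \<in> act \<gamma> ` hsegment z w"
    using assms by (auto simp: act_image_iff) (auto simp: hsegment_def)
qed

lemma hconvex_act:
  assumes "\<gamma> \<in> PSL" "hconvex D" shows "hconvex (act \<gamma> ` D)"
proof -
  have D: "D \<subseteq> \<H>" using assms by (simp add: hconvex_def)
  have "hsegment (act \<gamma> z) (act \<gamma> w) \<subseteq> act \<gamma> ` D" if "z \<in> D" "w \<in> D" for z w
    using that assms D by (subst hsegment_act) (auto simp: hconvex_def)
  then show ?thesis using assms D by (auto simp: hconvex_def)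
qed

lemma closed_half_plane_act:
  assumes "\<gamma> \<in> PSL" "closed_half_plane D" shows "closed_half_plane (act \<gamma> ` D)"
proof -
  obtain u w where uw: "u \<in> \<H>" "w \<in> \<H>" "u \<noteq> w" and D: "D = {z \<in> \<H>. hdist z u \<le> hdist z w}"
    using assms by (auto simp: closed_half_plane_def)
  have *: "hdist z (act \<gamma> v) = hdist (act (\<iota> \<gamma>) z) v" if "z \<in> \<H>" "v \<in> \<H>" for z v
    using hdist_act[OF assms(1), of "act (\<iota> \<gamma>) z" v] that assms by simp
  have "z \<in> act \<gamma> ` D \<longleftrightarrow> z \<in> {z \<in> \<H>. hdist z (act \<gamma> u) \<le> hdist z (act \<gamma> w)}" for z
  proof (cases "z \<in> \<H>")
    case True
    have "z \<in> act \<gamma> ` D \<longleftrightarrow> act (\<iota> \<gamma>) z \<in> D"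
      using act_image_iff[OF assms(1), of D z] True D by blast
    then show ?thesis
      using True act_in[of "\<iota> \<gamma>" z] assms(1) by (simp only: D *[OF _ uw(1)] *[OF _ uw(2)] mem_Collect_eq) simp
  next
    case False
    then show ?thesis using act_image_iff[OF assms(1), of D z] D by blast
  qed
  then have "act \<gamma> ` D = {z \<in> \<H>. hdist z (act \<gamma> u) \<le> hdist z (act \<gamma> w)}" by blast
  moreover have "act \<gamma> u \<noteq> act \<gamma> w" using uw inj_on_act[OF assms(1)] by (auto dest: inj_onD)
  moreover have "act \<gamma> u \<in> \<H>" "act \<gamma> w \<in> \<H>" using uw assms(1) by simp_all
  ultimately show ?thesis unfolding closed_half_plane_def by (metis (no_types))
qed

text \<open>For \<open>\<sigma> = 1\<close> the part of the plane to the left, for \<open>\<sigma> = - 1\<close> to the right of a vertical line.\<close>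
definition vertical_half_plane :: "real \<Rightarrow> real \<Rightarrow> complex set" where
  "vertical_half_plane \<sigma> c = {z \<in> \<H>. \<sigma> * Re z \<le> c}"

lemma closed_half_plane_vertical:
  assumes "\<sigma> = 1 \<or> \<sigma> = -1"
  shows "closed_half_plane (vertical_half_plane \<sigma> c)"
proof -
  define u w where "u = Complex (\<sigma> * (c - 1)) 1" and "w = Complex (\<sigma> * (c + 1)) 1"
  have uw: "u \<in> \<H>" "w \<in> \<H>" "u \<noteq> w" using assms by (auto simp: u_def w_def upper_iff)
  have "hdist z u \<le> hdist z w \<longleftrightarrow> \<sigma> * Re z \<le> c" if "z \<in> \<H>" for z
  proof -
    have y: "Im z > 0" using that by (simp add: upper_iff)
    have "hdist z u \<le> hdist z w \<longleftrightarrow> (cmod (z - u))\<^sup>2 \<le> (cmod (z - w))\<^sup>2"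
      using uw that y by (simp add: hdist_le_iff divide_le_cancel) (simp add: u_def w_def divide_le_cancel)
    also have "\<dots> \<longleftrightarrow> \<sigma> * Re z \<le> c"
      using assms unfolding cmod_power2 by (auto simp: u_def w_def power2_eq_square algebra_simps)
    finally show ?thesis .
  qed
  then show ?thesis unfolding closed_half_plane_def vertical_half_plane_def using uw by blast
qed

text \<open>If a segment left the half-plane, reflecting its outer point would not increase its length.\<close>
lemma hconvex_vertical:
  assumes \<sigma>: "\<sigma> = 1 \<or> \<sigma> = -1"
  shows "hconvex (vertical_half_plane \<sigma> c)"
  unfolding hconvex_def
proof (intro conjI ballI subsetI)
  fix z w u assume z: "z \<in> vertical_half_plane \<sigma> c" and w: "w \<in> vertical_half_plane \<sigma> c"
    and u: "u \<in> hsegment z w"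
  have H: "z \<in> \<H>" "w \<in> \<H>" "u \<in> \<H>" and d: "hdist z u + hdist u w = hdist z w"
    using z w u by (auto simp: vertical_half_plane_def hsegment_def)
  have y: "Im z > 0" "Im w > 0" "Im u > 0" using H by (auto simp: upper_iff)
  show "u \<in> vertical_half_plane \<sigma> c"
  proof (rule ccontr)
    assume "u \<notin> vertical_half_plane \<sigma> c"
    then have out: "c < \<sigma> * Re u" using H by (auto simp: vertical_half_plane_def)
    define v where "v = Complex (2 * \<sigma> * c - Re u) (Im u)"
    have v: "v \<in> \<H>" using y by (simp add: v_def upper_iff)
    have refl: "hdist p v \<le> hdist p u" "hdist p u \<le> hdist p v \<Longrightarrow> \<sigma> * Re p = c"
      if "p \<in> vertical_half_plane \<sigma> c" for p
    proof -
      have p: "p \<in> \<H>" "\<sigma> * Re p \<le> c" using that by (auto simp: vertical_half_plane_def)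
      then have py: "Im p > 0" by (simp add: upper_iff)
      have "(cmod (p - u))\<^sup>2 - (cmod (p - v))\<^sup>2 = 4 * ((c - \<sigma> * Re p) * (\<sigma> * Re u - c))"
        using \<sigma> unfolding cmod_power2 by (auto simp: v_def power2_eq_square algebra_simps)
      then have eq: "(cmod (p - u))\<^sup>2 = (cmod (p - v))\<^sup>2 + 4 * ((c - \<sigma> * Re p) * (\<sigma> * Re u - c))" by simp
      have "hdist p v \<le> hdist p u \<longleftrightarrow> (cmod (p - v))\<^sup>2 \<le> (cmod (p - u))\<^sup>2"
        "hdist p u \<le> hdist p v \<longleftrightarrow> (cmod (p - u))\<^sup>2 \<le> (cmod (p - v))\<^sup>2"
        using p v H mult_pos_pos[OF py y(3)]
        by (simp_all add: hdist_le_iff) (simp_all add: v_def divide_le_cancel)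
      then show "hdist p v \<le> hdist p u" "hdist p u \<le> hdist p v \<Longrightarrow> \<sigma> * Re p = c"
        unfolding eq using p out by (auto simp: mult_le_0_iff)
    qed
    have "hdist z w \<le> hdist z v + hdist v w" using H v by (intro hdist_triangle)
    moreover have "hdist z v \<le> hdist z u" "hdist w v \<le> hdist w u" using refl z w by auto
    ultimately have "hdist z u \<le> hdist z v" "hdist w u \<le> hdist w v"
      using d by (simp_all add: hdist_commute[of w])
    \<comment> \<open>Equality on both legs puts z and w on the boundary line itself; between two
      points of a vertical, a detour through u off that vertical is strictly longer.\<close>
    then have c: "\<sigma> * Re z = c" "\<sigma> * Re w = c" using refl z w by auto
    then have ne: "Re z \<noteq> Re u" "Re u \<noteq> Re w" and eq: "Re z = Re w" using out \<sigma> by auto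
    from hdist_gt_vertical[OF H(1,3) ne(1)] hdist_gt_vertical[OF H(3,2) ne(2)]
      hdist_vertical[OF H(1,2) eq] d
    show False by linarith
  qed
qed (auto simp: vertical_half_plane_def)


section \<open>Gluing over the tessellation\<close>

text \<open>A coordinate on the triangle running from 0 on the side through i to 1 on the two sides
  at \<rho>: the minimum in the denominator measures the distance from these two sides and vanishes
  on them. On the edge from i to \<rho> it equals \<open>2 * Re z\<close>, the parameter of
  \<open>edge_pt\<close>.\<close>

definition tau :: "complex \<Rightarrow> real" where
  "tau z = Re z / (Re z + min (1/2 - Re z) (nsq z - 2 * Re z))"

definition edge_pt :: "real \<Rightarrow> complex" where
  "edge_pt t = Complex (t / 2) (sqrt (1 - (t / 2)\<^sup>2))"

lemma edge_pt_props:
  assumes "t \<in> {0..1}"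
  shows "edge_pt t \<in> \<H>" "Re (edge_pt t) = t / 2" "nsq (edge_pt t) = 1" "edge_pt t \<in> \<triangle>" "tau (edge_pt t) = t"
proof -
  have "(t / 2)\<^sup>2 \<le> (1/2)\<^sup>2" using assms by (intro power_mono) auto
  then have lt: "(t / 2)\<^sup>2 < 1" by (simp add: power2_eq_square)
  show H: "edge_pt t \<in> \<H>" using lt by (simp add: upper_iff edge_pt_def)
  show re: "Re (edge_pt t) = t / 2" by (simp add: edge_pt_def)
  show n: "nsq (edge_pt t) = 1" using lt by (simp add: nsq_def edge_pt_def)
  show "edge_pt t \<in> \<triangle>" using assms by (simp add: triangle_iff H re n)
  have "min (1/2 - t / 2) (1 - t) = 1/2 - t / 2" using assms by (auto simp: min_def)
  then show "tau (edge_pt t) = t" by (simp add: tau_def re n)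
qed

lemma edge_pt_image: "edge_pt ` {0..1} = hsegment \<i> \<rho>"
proof -
  have "z \<in> edge_pt ` {0..1}" if z: "z \<in> hsegment \<i> \<rho>" for z
  proof -
    have *: "z \<in> \<H>" "nsq z = 1" "0 \<le> Re z" "Re z \<le> 1/2" using z by (auto simp: hsegment_i_rho)
    then have "Im z = sqrt (1 - (Re z)\<^sup>2)"
      by (intro real_sqrt_unique[symmetric]) (auto simp: nsq_def upper_iff)
    then have "z = edge_pt (2 * Re z)" by (simp add: edge_pt_def complex_eq_iff)
    then show ?thesis using * by (intro image_eqI) auto
  qed
  then show ?thesis by (auto simp: hsegment_i_rho edge_pt_props)
qed

lemma edge_pt_ends: "edge_pt 0 = \<i>" "edge_pt 1 = \<rho>"
proof -
  have "sqrt (1 - (1 / 2)\<^sup>2) = sqrt 3 / (2::real)"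
    by (rule real_sqrt_unique) (auto simp: power_divide)
  then show "edge_pt 0 = \<i>" "edge_pt 1 = \<rho>"
    by (simp_all add: edge_pt_def complex_eq_iff rho_coords)
qed

lemma continuous_edge_pt [continuous_intros]: "continuous_on S edge_pt"
  unfolding edge_pt_def by (intro continuous_intros) auto

lemma tau_denominator:
  assumes "z \<in> \<triangle>"
  shows "Re z + min (1/2 - Re z) (nsq z - 2 * Re z) > 0"
  using assms nsq_pos[of z] by (auto simp: triangle_iff min_def)

lemma tau_range: "z \<in> \<triangle> \<Longrightarrow> tau z \<in> {0..1}"
  using tau_denominator[of z] by (auto simp: tau_def triangle_iff min_def)

lemma tau_0: "Re z = 0 \<Longrightarrow> tau z = 0"
  by (simp add: tau_def)

lemma tau_1: "z \<in> \<triangle> \<Longrightarrow> z \<in> wedge \<Longrightarrow> tau z = 1"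
  using tau_denominator[of z] by (auto simp: tau_def triangle_iff wedge_def min_def)

lemma continuous_on_tau: "continuous_on \<triangle> tau"
  unfolding tau_def nsq_def
  by (intro continuous_intros) (use tau_denominator in \<open>force simp: nsq_def\<close>)

text \<open>The edge \<open>\<gamma>\<close> shares its end at \<open>0\<close> with the edge \<open>\<gamma> S\<close> and its end at \<open>1\<close> with
  \<open>\<gamma> R\<close> and \<open>\<gamma> R\<^sup>2\<close>.\<close>
definition compatible_paths :: "((int^2^2) set \<Rightarrow> real \<Rightarrow> 'b) \<Rightarrow> bool" where
  "compatible_paths F \<longleftrightarrow> (\<forall>\<gamma>\<in>PSL. F (\<gamma> \<odot> gS) 0 = F \<gamma> 0 \<and> F (\<gamma> \<odot> gR) 1 = F \<gamma> 1)"

definition cell :: "complex \<Rightarrow> (int^2^2) set" where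
  "cell z = (SOME \<gamma>. \<gamma> \<in> PSL \<and> z \<in> act \<gamma> ` \<triangle>)"

text \<open>The tile is an arbitrary choice among those containing z; for compatible paths,
  \<open>glue_triangle\<close> frees the value from that choice.\<close>

definition glue :: "((int^2^2) set \<Rightarrow> real \<Rightarrow> 'b) \<Rightarrow> complex \<Rightarrow> 'b" where
  "glue F z = F (cell z) (tau (act (\<iota> (cell z)) z))"

lemma cell: "z \<in> \<H> \<Longrightarrow> cell z \<in> PSL" "z \<in> \<H> \<Longrightarrow> z \<in> act (cell z) ` \<triangle>"
  using someI_ex[of "\<lambda>\<gamma>. \<gamma> \<in> PSL \<and> z \<in> act \<gamma> ` \<triangle>"] triangle_covers[of z]
  unfolding cell_def by blast+

text \<open>Two distinct tiles through a point differ by a single letter, and the point lies on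
  their common side, where \<open>tau\<close> is 0 or 1. These are the parameters at which
  compatible paths agree.\<close>

lemma compatible_triangles:
  assumes F: "compatible_paths F" and \<gamma>: "\<gamma> \<in> PSL" and \<delta>: "\<delta> \<in> PSL"
    and z: "z \<in> \<triangle>" and w: "w \<in> \<triangle>" and eq: "act \<gamma> z = act \<delta> w"
  shows "F \<gamma> (tau z) = F \<delta> (tau w)"
proof -
  define x where "x = \<iota> \<delta> \<odot> \<gamma>"
  have x: "x \<in> PSL" "\<gamma> = \<delta> \<odot> x"
    using \<gamma> \<delta> by (simp_all add: x_def flip: PSL.m_assoc)
  have xz: "act x z = w"
    using \<gamma> \<delta> z w eq by (simp add: x_def act_mult)
  have F2: "F (\<delta> \<odot> gR2) 1 = F \<delta> 1"
    using F \<delta> unfolding compatible_paths_def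
    by (metis gens_in(2) gens_mult_assoc(7) PSL.m_closed)
  have "x = \<e> \<or> (x = gS \<and> Re z = 0 \<and> Re w = 0) \<or> (x \<in> {gR, gR2} \<and> z \<in> wedge \<and> w \<in> wedge)"
    using triangle_neighbours[of z x] x z w xz by simp
  then show ?thesis
    using F F2 \<delta> z w xz x(2) by (auto simp: compatible_paths_def tau_0 tau_1)
qed

lemma glue_triangle:
  assumes F: "compatible_paths F" and \<gamma>: "\<gamma> \<in> PSL" and z: "z \<in> \<triangle>"
  shows "glue F (act \<gamma> z) = F \<gamma> (tau z)"
proof -
  have H: "act \<gamma> z \<in> \<H>" using \<gamma> z by simp
  obtain w where w: "w \<in> \<triangle>" "act (cell (act \<gamma> z)) w = act \<gamma> z"
    using cell(2)[OF H] by (metis imageE)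
  have "act (\<iota> (cell (act \<gamma> z))) (act \<gamma> z) = w"
    using act_inv_act[OF cell(1)[OF H], of w] w by simp
  then show ?thesis
    unfolding glue_def using compatible_triangles[OF F cell(1)[OF H] \<gamma> w(1) z w(2)] by simp
qed

lemma upper_triangle_cases:
  assumes "z \<in> \<H>"
  obtains \<gamma> w where "\<gamma> \<in> PSL" "w \<in> \<triangle>" "z = act \<gamma> w"
  using triangle_covers[OF assms] by blast

text \<open>Pasting over the locally finite closed cover by tiles. The target is an arbitrary
  topology because the same gluing yields both the retraction of the half-plane and the map to the
  realised graph.\<close>

lemma continuous_glue:
  assumes F: "compatible_paths F"
    and cont: "\<And>\<gamma>. \<gamma> \<in> PSL \<Longrightarrow> continuous_map (top_of_set {0..1}) X (F \<gamma>)"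
  shows "continuous_map (top_of_set \<H>) X (glue F)"
proof (rule pasting_lemma_locally_finite[where I = "PSL" and T = "\<lambda>\<gamma>. act \<gamma> ` \<triangle>"
      and f = "\<lambda>\<gamma> z. F \<gamma> (tau (act (\<iota> \<gamma>) z))"])
  fix z assume z: "z \<in> topspace (top_of_set \<H>)"
  then have zH: "z \<in> \<H>" by simp
  obtain U where U: "open U" "z \<in> U" "U \<subseteq> \<H>" "finite {\<gamma> \<in> PSL. act \<gamma> ` \<triangle> \<inter> U \<noteq> {}}"
    by (rule triangles_locally_finite[OF zH])
  show "\<exists>V. openin (top_of_set \<H>) V \<and> z \<in> V \<and> finite {\<gamma> \<in> PSL. act \<gamma> ` \<triangle> \<inter> V \<noteq> {}}"
    by (intro exI[of _ U] conjI open_subset U)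
next
  fix \<gamma> assume \<gamma>: "\<gamma> \<in> PSL"
  then show "closedin (top_of_set \<H>) (act \<gamma> ` \<triangle>)"
    by (rule closedin_act_image) (rule closedin_triangle)
  have sub: "act \<gamma> ` \<triangle> \<subseteq> \<H>" using \<gamma> by auto
  have inv: "act (\<iota> \<gamma>) ` act \<gamma> ` \<triangle> \<subseteq> \<triangle>" using \<gamma> by auto
  have "continuous_on (act \<gamma> ` \<triangle>) (act (\<iota> \<gamma>))"
    by (rule continuous_on_subset[OF continuous_on_act sub]) (use \<gamma> in simp)
  then have "continuous_on (act \<gamma> ` \<triangle>) (\<lambda>z. tau (act (\<iota> \<gamma>) z))"
    by (rule continuous_on_compose2[OF continuous_on_tau]) (rule inv)
  moreover have "(\<lambda>z. tau (act (\<iota> \<gamma>) z)) ` act \<gamma> ` \<triangle> \<subseteq> {0..1}"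
    using inv tau_range by blast
  ultimately have "continuous_map (top_of_set (act \<gamma> ` \<triangle>)) (top_of_set {0..1}) (\<lambda>z. tau (act (\<iota> \<gamma>) z))"
    by auto
  from continuous_map_compose[OF this cont[OF \<gamma>]]
  show "continuous_map (subtopology (top_of_set \<H>) (act \<gamma> ` \<triangle>)) X (\<lambda>z. F \<gamma> (tau (act (\<iota> \<gamma>) z)))"
    using sub by (simp add: subtopology_subtopology o_def Int_absorb1)
next
  fix \<gamma> \<delta> z assume \<gamma>: "\<gamma> \<in> PSL" and \<delta>: "\<delta> \<in> PSL"
    and "z \<in> topspace (top_of_set \<H>) \<inter> act \<gamma> ` \<triangle> \<inter> act \<delta> ` \<triangle>"
  then obtain u v where uv: "u \<in> \<triangle>" "v \<in> \<triangle>" and eq: "z = act \<gamma> u" "z = act \<delta> v" by blast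
  have "F \<gamma> (tau u) = F \<delta> (tau v)"
    using compatible_triangles[OF F \<gamma> \<delta> uv] eq by metis
  moreover have "act (\<iota> \<gamma>) z = u" "act (\<iota> \<delta>) z = v"
    using eq act_inv_act[OF \<gamma>, of u] act_inv_act[OF \<delta>, of v] uv by simp_all
  ultimately show "F \<gamma> (tau (act (\<iota> \<gamma>) z)) = F \<delta> (tau (act (\<iota> \<delta>) z))" by simp
next
  fix z assume z: "z \<in> topspace (top_of_set \<H>)"
  then have zH: "z \<in> \<H>" by simp
  obtain \<gamma> w where *: "\<gamma> \<in> PSL" "w \<in> \<triangle>" "z = act \<gamma> w" by (rule upper_triangle_cases[OF zH])
  then have "act (\<iota> \<gamma>) z = w" by simp
  then have "glue F z = F \<gamma> (tau (act (\<iota> \<gamma>) z))" using glue_triangle[OF F *(1,2)] *(3) by simp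
  then show "\<exists>\<gamma>. \<gamma> \<in> PSL \<and> z \<in> act \<gamma> ` \<triangle> \<and> glue F z = F \<gamma> (tau (act (\<iota> \<gamma>) z))"
    using * by blast
qed

text \<open>One concrete equivariant retraction, used for the homotopy equivalence; the retraction
  \<open>p\<close> in the statement about the polygon is arbitrary apart from being adapted.\<close>

definition tree_retr :: "complex \<Rightarrow> complex" where
  "tree_retr = glue (\<lambda>\<gamma> t. act \<gamma> (edge_pt t))"

lemma compatible_act_edge: "compatible_paths (\<lambda>\<gamma> t. act \<gamma> (edge_pt t))"
proof -
  have "act gS \<i> = \<i>" by (simp add: act_gS)
  moreover have "act gR \<rho> = \<rho>"
    using gR_coords[of \<rho>] by (simp add: complex_eq_iff rho_coords)
  ultimately show ?thesis by (simp add: compatible_paths_def edge_pt_ends act_mult)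
qed

lemma tree_retr_triangle:
  "\<gamma> \<in> PSL \<Longrightarrow> z \<in> \<triangle> \<Longrightarrow> tree_retr (act \<gamma> z) = act \<gamma> (edge_pt (tau z))"
  unfolding tree_retr_def by (rule glue_triangle[OF compatible_act_edge])

lemma tree_retr_in: "z \<in> \<H> \<Longrightarrow> tree_retr z \<in> \<H>"
  by (erule upper_triangle_cases) (simp add: tree_retr_triangle edge_pt_props(1)[OF tau_range])

lemma tree_retr_equivariant:
  assumes "\<gamma> \<in> PSL" "z \<in> \<H>" shows "tree_retr (act \<gamma> z) = act \<gamma> (tree_retr z)"
proof -
  obtain \<delta> w where *: "\<delta> \<in> PSL" "w \<in> \<triangle>" "z = act \<delta> w" using assms(2) by (rule upper_triangle_cases)
  then have "act \<gamma> z = act (\<gamma> \<odot> \<delta>) w" using assms by (simp add: act_mult)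
  also have "tree_retr \<dots> = act (\<gamma> \<odot> \<delta>) (edge_pt (tau w))"
    using * assms by (intro tree_retr_triangle) auto
  also have "\<dots> = act \<gamma> (tree_retr z)"
    using * assms edge_pt_props(1)[OF tau_range[OF *(2)]] by (simp add: tree_retr_triangle act_mult)
  finally show ?thesis .
qed

lemma continuous_tree_retr: "continuous_on \<H> tree_retr"
proof -
  have "continuous_map (top_of_set {0..1}) (top_of_set \<H>) (\<lambda>t. act \<gamma> (edge_pt t))" if "\<gamma> \<in> PSL" for \<gamma>
  proof -
    have "continuous_on {0..1} (\<lambda>t. act \<gamma> (edge_pt t))"
      by (rule continuous_on_compose2[OF continuous_on_act[OF that] continuous_edge_pt])
         (use edge_pt_props(1) in auto)
    then show ?thesis using that edge_pt_props(1) by auto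
  qed
  from continuous_glue[OF compatible_act_edge this] show ?thesis
    unfolding tree_retr_def by simp
qed


section \<open>Equivariant interpolation\<close>

text \<open>A point \<open>x + i y\<close> corresponds to the positive definite quadratic form
  \<open>\<bar>m z + n\<bar>\<^sup>2 / y\<close> with coefficients \<open>1 / y\<close>, \<open>x / y\<close>, \<open>(x\<^sup>2 + y\<^sup>2) / y\<close>, and the action
  of the modular group is linear on forms.\<close>

definition form1 :: "real \<Rightarrow> complex \<Rightarrow> complex \<Rightarrow> real" where
  "form1 s z w = (1 - s) / Im z + s / Im w"
definition form2 :: "real \<Rightarrow> complex \<Rightarrow> complex \<Rightarrow> real" where
  "form2 s z w = (1 - s) * Re z / Im z + s * Re w / Im w"
definition form3 :: "real \<Rightarrow> complex \<Rightarrow> complex \<Rightarrow> real" where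
  "form3 s z w = (1 - s) * nsq z / Im z + s * nsq w / Im w"
definition form_det :: "real \<Rightarrow> complex \<Rightarrow> complex \<Rightarrow> real" where
  "form_det s z w = form1 s z w * form3 s z w - (form2 s z w)\<^sup>2"

text \<open>The point belonging to the interpolated form. A convex combination of forms of
  determinant 1 need not have determinant 1; the square root rescales it.\<close>

definition interp :: "real \<Rightarrow> complex \<Rightarrow> complex \<Rightarrow> complex" where
  "interp s z w = Complex (form2 s z w / form1 s z w) (sqrt (form_det s z w) / form1 s z w)"

lemma form_pos:
  assumes "z \<in> \<H>" "w \<in> \<H>" "s \<in> {0..1}"
  shows "form1 s z w > 0" "form3 s z w > 0" "form_det s z w > 0"
proof -
  have y: "Im z > 0" "Im w > 0" "nsq z > 0" "nsq w > 0" using assms nsq_pos by (auto simp: upper_iff)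
  have conv: "(1 - s) * p + s * q > 0" if "p > 0" "q > 0" for p q
    using assms(3) that by (cases "s = 0") (auto intro: add_nonneg_pos)
  show f1: "form1 s z w > 0" using conv[of "1 / Im z" "1 / Im w"] y by (simp add: form1_def)
  show "form3 s z w > 0" using conv[of "nsq z / Im z" "nsq w / Im w"] y by (simp add: form3_def)
  define a b where "a = (1 - s) / Im z" and "b = s / Im w"
  have ab: "a \<ge> 0" "b \<ge> 0" "a + b > 0" using assms(3) y f1 by (auto simp: a_def b_def form1_def)
  have "a * (Im z)\<^sup>2 + b * (Im w)\<^sup>2 = (1 - s) * Im z + s * Im w"
    using y by (simp add: a_def b_def power2_eq_square)
  then have pos: "a * (Im z)\<^sup>2 + b * (Im w)\<^sup>2 > 0" using conv y by simp
  \<comment> \<open>Lagrange's identity: the product of the two weighted sums minus the square of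
    the mixed one is \<open>a * b\<close> times the squared difference of the real parts, and the
    imaginary parts only add a positive term.\<close>
  have "form_det s z w = a * b * (Re z - Re w)\<^sup>2 + (a + b) * (a * (Im z)\<^sup>2 + b * (Im w)\<^sup>2)"
  proof -
    have "form1 s z w = a + b" "form2 s z w = a * Re z + b * Re w" "form3 s z w = a * nsq z + b * nsq w"
      by (simp_all add: form1_def form2_def form3_def a_def b_def)
    then show ?thesis by (simp add: form_det_def nsq_def power2_eq_square algebra_simps)
  qed
  also have "\<dots> > 0" using ab by (intro add_nonneg_pos mult_pos_pos[OF ab(3) pos]) auto
  finally show "form_det s z w > 0" .
qed

lemma interp_in: "z \<in> \<H> \<Longrightarrow> w \<in> \<H> \<Longrightarrow> s \<in> {0..1} \<Longrightarrow> interp s z w \<in> \<H>"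
  using form_pos[of z w s] by (simp add: interp_def upper_iff)

lemma interp_ends:
  assumes "z \<in> \<H>" "w \<in> \<H>"
  shows "interp 0 z w = z" "interp 1 z w = w"
proof -
  have y: "Im z > 0" "Im w > 0" using assms by (auto simp: upper_iff)
  have "form_det 0 z w = 1" "form_det 1 z w = 1"
    using y by (simp_all add: form_det_def form1_def form2_def form3_def nsq_def field_simps power2_eq_square)
  then show "interp 0 z w = z" "interp 1 z w = w"
    using y by (simp_all add: interp_def form1_def form2_def complex_eq_iff)
qed

text \<open>The substitution swaps the outer coefficients of the form and negates the middle one, so
  the determinant is preserved.\<close>

lemma interp_gS:
  assumes "z \<in> \<H>" "w \<in> \<H>" "s \<in> {0..1}"
  shows "interp s (act gS z) (act gS w) = act gS (interp s z w)"
proof -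
  have y: "Im z > 0" "Im w > 0" "nsq z > 0" "nsq w > 0" using assms nsq_pos by (auto simp: upper_iff)
  have f: "form1 s (act gS z) (act gS w) = form3 s z w" "form2 s (act gS z) (act gS w) = - form2 s z w"
    "form3 s (act gS z) (act gS w) = form1 s z w"
    using y gS_coords[OF assms(1)] gS_coords[OF assms(2)]
    by (simp_all add: form1_def form2_def form3_def)
  then have d: "form_det s (act gS z) (act gS w) = form_det s z w" by (simp add: form_det_def)
  note pos = form_pos[OF assms]
  have "nsq (interp s z w) = ((form2 s z w)\<^sup>2 + form_det s z w) / (form1 s z w)\<^sup>2"
    using pos by (simp add: nsq_def interp_def power_divide add_divide_distrib)
  also have "\<dots> = form3 s z w / form1 s z w"
    using pos by (simp add: form_det_def power2_eq_square)
  finally have n: "nsq (interp s z w) = form3 s z w / form1 s z w" .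
  have "Re (act gS (interp s z w)) = - form2 s z w / form3 s z w"
    "Im (act gS (interp s z w)) = sqrt (form_det s z w) / form3 s z w"
    using gS_coords[OF interp_in[OF assms]] n pos by (simp_all add: interp_def)
  then show ?thesis by (simp add: interp_def[of s "act gS z"] f d complex_eq_iff)
qed

lemma interp_gT:
  assumes "z \<in> \<H>" "w \<in> \<H>" "s \<in> {0..1}"
  shows "interp s (act (gT k) z) (act (gT k) w) = act (gT k) (interp s z w)"
proof -
  have y: "Im z > 0" "Im w > 0" using assms by (auto simp: upper_iff)
  define c where "c = real_of_int k"
  have n: "nsq (act (gT k) u) = nsq u + 2 * c * Re u + c\<^sup>2" for u
    by (simp add: nsq_def gT_coords power2_eq_square algebra_simps c_def)
  have f: "form1 s (act (gT k) z) (act (gT k) w) = form1 s z w"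
    "form2 s (act (gT k) z) (act (gT k) w) = form2 s z w + c * form1 s z w"
    "form3 s (act (gT k) z) (act (gT k) w) = form3 s z w + 2 * c * form2 s z w + c\<^sup>2 * form1 s z w"
    unfolding form1_def form2_def form3_def n gT_coords
    by (simp_all add: c_def add_divide_distrib diff_divide_distrib algebra_simps)
  have d: "form_det s (act (gT k) z) (act (gT k) w) = form_det s z w"
    unfolding form_det_def f by (simp add: power2_eq_square algebra_simps)
  show ?thesis
    using form_pos(1)[OF assms]
    by (simp add: complex_eq_iff gT_coords interp_def f d add_divide_distrib c_def)
qed

lemma interp_equivariant:
  assumes "\<gamma> \<in> PSL" "z \<in> \<H>" "w \<in> \<H>" "s \<in> {0..1}"
  shows "interp s (act \<gamma> z) (act \<gamma> w) = act \<gamma> (interp s z w)"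
proof -
  have gR: "gR = gS \<odot> gT (-1)" "gR2 = gR \<odot> gR" by (simp_all add: gT_1)
  have R: "interp s (act gR z) (act gR w) = act gR (interp s z w)" if "z \<in> \<H>" "w \<in> \<H>" for z w
    using that assms(4) interp_in unfolding gR(1) by (simp add: act_mult interp_gS interp_gT)
  have R2: "interp s (act gR2 z) (act gR2 w) = act gR2 (interp s z w)" if "z \<in> \<H>" "w \<in> \<H>" for z w
    using that assms(4) interp_in unfolding gR(2) by (simp add: act_mult R del: gens_mult)
  have "\<forall>z\<in>\<H>. \<forall>w\<in>\<H>. interp s (act \<gamma> z) (act \<gamma> w) = act \<gamma> (interp s z w)"
    using assms(1)
  proof (induction rule: modular_right_induct)
    case one then show ?case by simp
  next
    case (step \<gamma> x)
    have "interp s (act x z) (act x w) = act x (interp s z w)" if "z \<in> \<H>" "w \<in> \<H>" for z w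
      using step that assms(4) by (auto simp: R R2 interp_gS)
    moreover have "x \<in> PSL" using step by auto
    ultimately show ?case using step assms(4) interp_in by (simp add: act_mult)
  qed
  then show ?thesis using assms by blast
qed

lemma continuous_interp:
  "continuous_on ({0..1} \<times> \<H>) (\<lambda>(s, z). interp s z (tree_retr z))"
proof -
  have t: "continuous_on ({0..1} \<times> \<H>) (\<lambda>p. tree_retr (snd p))"
    by (rule continuous_on_compose2[OF continuous_tree_retr]) (auto intro: continuous_intros)
  have ne: "Im (snd p) \<noteq> 0 \<and> Im (tree_retr (snd p)) \<noteq> 0 \<and> form1 (fst p) (snd p) (tree_retr (snd p)) \<noteq> 0"
    if "p \<in> {0..1} \<times> \<H>" for p :: "real \<times> complex"
    using that tree_retr_in[of "snd p"] form_pos(1)[of "snd p" "tree_retr (snd p)" "fst p"]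
    by (auto simp: upper_iff)
  have f1: "continuous_on ({0..1} \<times> \<H>) (\<lambda>p. form1 (fst p) (snd p) (tree_retr (snd p)))"
    unfolding form1_def using ne by (intro continuous_intros t) auto
  have f2: "continuous_on ({0..1} \<times> \<H>) (\<lambda>p. form2 (fst p) (snd p) (tree_retr (snd p)))"
    unfolding form2_def using ne by (intro continuous_intros t) auto
  have f3: "continuous_on ({0..1} \<times> \<H>) (\<lambda>p. form3 (fst p) (snd p) (tree_retr (snd p)))"
    unfolding form3_def nsq_def using ne by (intro continuous_intros t) auto
  have "continuous_on ({0..1} \<times> \<H>) (\<lambda>p. interp (fst p) (snd p) (tree_retr (snd p)))"
    unfolding interp_def form_det_def using ne by (intro continuous_intros f1 f2 f3) auto
  then show ?thesis by (simp add: case_prod_unfold)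
qed


section \<open>The quotient surface and the graph\<close>

lemma edge_point_simps [simp]:
  "edge_point X e 0 = Inl (tail X e)" "edge_point X e 1 = Inl (head X e)"
  by (simp_all add: edge_point_def)

lemma edge_point_in:
  assumes "wf_digraph X" "e \<in> arcs X" "t \<in> {0..1}"
  shows "edge_point X e t \<in> points X"
  using assms wf_digraph.tail_in_verts[OF assms(1,2)] wf_digraph.head_in_verts[OF assms(1,2)]
  by (auto simp: edge_point_def points_def)

lemma topspace_realisation:
  assumes "wf_digraph X"
  shows "topspace (realisation X) = points X"
proof
  show "topspace (realisation X) \<subseteq> points X"
    using openin_realisation openin_topspace by blast
  have "{t \<in> {0..1::real}. edge_point X e t \<in> points X} = {0..1}" if "e \<in> arcs X" for e
    using edge_point_in[OF assms that] by blast
  then have "openin (realisation X) (points X)" by (simp add: openin_realisation)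
  then show "points X \<subseteq> topspace (realisation X)" by (rule openin_subset)
qed

lemma continuous_map_edge_point:
  assumes "wf_digraph X" "e \<in> arcs X"
  shows "continuous_map (top_of_set {0..1}) (realisation X) (edge_point X e)"
  unfolding continuous_map_def
  using edge_point_in[OF assms] assms by (auto simp: topspace_realisation openin_realisation)

lemma continuous_map_realisation:
  assumes X: "wf_digraph X" and "f ` points X \<subseteq> topspace Z"
    and f: "\<And>e. e \<in> arcs X \<Longrightarrow> continuous_map (top_of_set {0..1}) Z (f \<circ> edge_point X e)"
  shows "continuous_map (realisation X) Z f"
proof -
  have "openin (realisation X) {x \<in> points X. f x \<in> U}" if U: "openin Z U" for U
  proof -
    have "openin (top_of_set {0..1}) {t \<in> {0..1}. edge_point X e t \<in> {x \<in> points X. f x \<in> U}}"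
      if e: "e \<in> arcs X" for e
    proof -
      have "openin (top_of_set {0..1}) {t \<in> topspace (top_of_set {0..1}). (f \<circ> edge_point X e) t \<in> U}"
        using f[OF e] U by (rule openin_continuous_map_preimage)
      moreover have "{t \<in> topspace (top_of_set {0..1}). (f \<circ> edge_point X e) t \<in> U} =
          {t \<in> {0..1}. edge_point X e t \<in> {x \<in> points X. f x \<in> U}}"
        using edge_point_in[OF X e] by auto
      ultimately show ?thesis by simp
    qed
    then show ?thesis by (simp add: openin_realisation)
  qed
  then show ?thesis using assms(2) by (auto simp: continuous_map_def topspace_realisation[OF X])
qed

lemma quotient_map_quotient_topology: "quotient_map X (quotient_topology X q) q"
proof -
  have "topspace (quotient_topology X q) = q ` topspace X"
  proof
    have "openin (quotient_topology X q) (topspace (quotient_topology X q))" by (rule openin_topspace)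
    then show "topspace (quotient_topology X q) \<subseteq> q ` topspace X"
      unfolding openin_quotient_topology by (rule conjunct1)
    have "{x \<in> topspace X. q x \<in> q ` topspace X} = topspace X" by blast
    then have "openin (quotient_topology X q) (q ` topspace X)"
      by (simp add: openin_quotient_topology)
    then show "q ` topspace X \<subseteq> topspace (quotient_topology X q)" by (rule openin_subset)
  qed
  then show ?thesis by (auto simp: quotient_map_def openin_quotient_topology)
qed

section \<open>Cosets as edges, orbits as vertices\<close>

lemma Ycomb_simps [simp]:
  "arcs (Ycomb G) = rcosets\<^bsub>\<Gamma>\<^esub> G" "tail (Ycomb G) x = Inl (right_orbit G0 x)"
  "head (Ycomb G) x = Inr (right_orbit G1 x)"
  "verts (Ycomb G) = Inl ` right_orbit G0 ` (rcosets\<^bsub>\<Gamma>\<^esub> G) \<union> Inr ` right_orbit G1 ` (rcosets\<^bsub>\<Gamma>\<^esub> G)"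
  by (simp_all add: Ycomb_def)

lemma wf_Ycomb: "wf_digraph (Ycomb G)"
  by unfold_locales auto

abbreviation coset :: "(int^2^2) set set \<Rightarrow> (int^2^2) set \<Rightarrow> edge" where
  "coset G \<gamma> \<equiv> G #>\<^bsub>\<Gamma>\<^esub> \<gamma>"

lemma right_orbits:
  assumes "G \<subseteq> PSL" "\<gamma> \<in> PSL"
  shows "right_orbit G0 (coset G \<gamma>) = {coset G \<gamma>, coset G (\<gamma> \<odot> gS)}"
    "right_orbit G1 (coset G \<gamma>) = {coset G \<gamma>, coset G (\<gamma> \<odot> gR), coset G (\<gamma> \<odot> gR2)}"
  using assms by (simp_all add: right_orbit_def gen_by_gens PSL.coset_mult_assoc)

lemma coset_eq_iff:
  assumes G: "subgroup G \<Gamma>" and "\<gamma> \<in> PSL" "\<delta> \<in> PSL"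
  shows "coset G \<gamma> = coset G \<delta> \<longleftrightarrow> (\<exists>g\<in>G. \<delta> = g \<odot> \<gamma>)"
proof
  assume "coset G \<gamma> = coset G \<delta>"
  then have "\<delta> \<in> coset G \<gamma>" using PSL.rcos_self[OF assms(3) G] by simp
  then show "\<exists>g\<in>G. \<delta> = g \<odot> \<gamma>" by (auto simp: r_coset_def)
next
  assume "\<exists>g\<in>G. \<delta> = g \<odot> \<gamma>"
  then have "\<delta> \<in> coset G \<gamma>" by (auto simp: r_coset_def)
  then show "coset G \<gamma> = coset G \<delta>" by (rule PSL.repr_independence[OF _ assms(2) G])
qed

lemma rcosets_cases:
  assumes "e \<in> rcosets\<^bsub>\<Gamma>\<^esub> G" obtains \<gamma> where "\<gamma> \<in> PSL" "e = coset G \<gamma>"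
  using assms by (auto simp: RCOSETS_def)

lemma points_cases:
  assumes "x \<in> points (Ycomb G)"
  obtains \<gamma> t where "\<gamma> \<in> PSL" "t \<in> {0..1}" "x = edge_point (Ycomb G) (coset G \<gamma>) t"
proof -
  from assms consider e where "e \<in> rcosets\<^bsub>\<Gamma>\<^esub> G" "x = edge_point (Ycomb G) e 0"
    | e where "e \<in> rcosets\<^bsub>\<Gamma>\<^esub> G" "x = edge_point (Ycomb G) e 1"
    | e t where "e \<in> rcosets\<^bsub>\<Gamma>\<^esub> G" "t \<in> {0<..<1}" "x = edge_point (Ycomb G) e t"
    by (fastforce simp: points_def edge_point_def)
  then show ?thesis
  proof cases
    case 1 then show ?thesis using that[of _ 0] by (auto elim: rcosets_cases)
  next
    case 2 then show ?thesis using that[of _ 1] by (auto elim: rcosets_cases)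
  next
    case 3 then show ?thesis using that[of _ t] by (auto elim!: rcosets_cases)
  qed
qed

context
  fixes G assumes G: "subgroup G \<Gamma>"
begin

lemma G_sub: "G \<subseteq> PSL" and G_in [simp]: "g \<in> G \<Longrightarrow> g \<in> PSL"
  using subgroup.subset[OF G] by auto

definition proj :: "complex \<Rightarrow> complex set" where
  "proj = orbit (\<Gamma>\<lparr>carrier := G\<rparr>) act"

lemma proj_act: "g \<in> G \<Longrightarrow> z \<in> \<H> \<Longrightarrow> proj (act g z) = proj z"
proof -
  assume g: "g \<in> G" and z: "z \<in> \<H>"
  have "\<exists>h'\<in>G. act h (act g z) = act h' z" if "h \<in> G" for h
    using that g z subgroup.m_closed[OF G that g] by (metis G_in act_mult)
  moreover have "\<exists>h'\<in>G. act h z = act h' (act g z)" if "h \<in> G" for h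
  proof
    show "h \<odot> \<iota> g \<in> G" using that g by (simp add: subgroup.m_closed[OF G] subgroup.m_inv_closed[OF G])
    show "act h z = act (h \<odot> \<iota> g) (act g z)"
      using that g z by (simp add: PSL.m_assoc flip: act_mult)
  qed
  ultimately show ?thesis unfolding proj_def orbit_def by auto
qed

lemma proj_eqD: "proj z = proj w \<Longrightarrow> \<exists>g\<in>G. z = act g w"
proof -
  assume eq: "proj z = proj w"
  have "act \<e> z \<in> proj z" using subgroup.one_closed[OF G] unfolding proj_def orbit_def by force
  then show ?thesis using eq by (auto simp: proj_def orbit_def)
qed

lemma quotient_map_proj: "quotient_map (top_of_set \<H>) (Y G) proj"
  unfolding Y_def proj_def by (rule quotient_map_quotient_topology)

lemma topspace_Y: "topspace (Y G) = proj ` \<H>"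
  using quotient_map_proj by (simp add: quotient_map_def)

text \<open>The edges of \<gamma> and \<gamma>\<open>gS\<close> in the graph start at one vertex,
  those of \<gamma> and \<gamma>\<open>gR\<close> end at one vertex. So the identifications in the
  graph are those under which \<open>glue\<close> produces a map from the half-plane.\<close>

lemma compatible_graph: "compatible_paths (\<lambda>\<gamma>. edge_point (Ycomb G) (coset G \<gamma>))"
  by (auto simp: compatible_paths_def right_orbits[OF G_sub])

definition surface_to_graph :: "complex set \<Rightarrow> vertex + edge \<times> real" where
  "surface_to_graph u = glue (\<lambda>\<gamma>. edge_point (Ycomb G) (coset G \<gamma>)) (SOME z. z \<in> \<H> \<and> proj z = u)"

text \<open>A vertex lies on several edges and an edge has several representatives; the description
  chooses among all of them, and \<open>graph_to_surface_edge\<close> shows that the image is the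
  same for each.\<close>

definition graph_to_surface :: "vertex + edge \<times> real \<Rightarrow> complex set" where
  "graph_to_surface x = (SOME u. \<exists>\<gamma> t. \<gamma> \<in> PSL \<and> t \<in> {0..1} \<and>
     x = edge_point (Ycomb G) (coset G \<gamma>) t \<and> u = proj (act \<gamma> (edge_pt t)))"

lemma coset_left_mult: "g \<in> G \<Longrightarrow> \<gamma> \<in> PSL \<Longrightarrow> coset G (g \<odot> \<gamma>) = coset G \<gamma>"
  using coset_eq_iff[OF G, of \<gamma> "g \<odot> \<gamma>"] by auto

lemma surface_to_graph_proj:
  assumes "\<gamma> \<in> PSL" "z \<in> \<triangle>"
  shows "surface_to_graph (proj (act \<gamma> z)) = edge_point (Ycomb G) (coset G \<gamma>) (tau z)"
proof -
  define w where "w = (SOME w. w \<in> \<H> \<and> proj w = proj (act \<gamma> z))"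
  have "w \<in> \<H> \<and> proj w = proj (act \<gamma> z)"
    unfolding w_def by (rule someI[where x = "act \<gamma> z"]) (use assms in simp)
  then obtain g where g: "g \<in> G" "w = act (g \<odot> \<gamma>) z" using proj_eqD assms by (metis G_in act_mult triangle_in_upper)
  have "surface_to_graph (proj (act \<gamma> z)) = edge_point (Ycomb G) (coset G (g \<odot> \<gamma>)) (tau z)"
    unfolding surface_to_graph_def w_def[symmetric] g(2)
    by (rule glue_triangle[OF compatible_graph]) (use assms g in auto)
  then show ?thesis using coset_left_mult[OF g(1) assms(1)] by simp
qed

text \<open>Interior points of an edge determine its coset; at an end one may also turn about the
  vertex by a letter. With trivial \<open>G\<close> the same statement describes coincidences in the
  tree.\<close>

lemma coset_edge_cases:
  assumes "\<gamma> \<in> PSL" "\<delta> \<in> PSL" "t \<in> {0..1}" "t' \<in> {0..1}"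
    and "edge_point (Ycomb G) (coset G \<gamma>) t = edge_point (Ycomb G) (coset G \<delta>) t'"
  shows "t = t' \<and> (\<exists>g\<in>G. \<delta> = g \<odot> \<gamma> \<or> t = 0 \<and> \<delta> = g \<odot> (\<gamma> \<odot> gS) \<or> t = 1 \<and> (\<delta> = g \<odot> (\<gamma> \<odot> gR) \<or> \<delta> = g \<odot> (\<gamma> \<odot> gR2)))"
proof -
  have t: "t = t'" using assms by (auto simp: edge_point_def split: if_splits)
  consider "t = 0" | "t = 1" | "t \<noteq> 0" "t \<noteq> 1" by blast
  then show ?thesis
  proof cases
    case 1
    with assms t have "coset G \<delta> \<in> {coset G \<gamma>, coset G (\<gamma> \<odot> gS)}"
      by (simp add: right_orbits[OF G_sub])
    then have "coset G \<gamma> = coset G \<delta> \<or> coset G (\<gamma> \<odot> gS) = coset G \<delta>" by auto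
    then show ?thesis using assms t 1
      by (simp only: coset_eq_iff[OF G] PSL.m_closed gens_in) blast
  next
    case 2
    with assms t have "coset G \<delta> \<in> {coset G \<gamma>, coset G (\<gamma> \<odot> gR), coset G (\<gamma> \<odot> gR2)}"
      by (simp add: right_orbits[OF G_sub])
    then have "coset G \<gamma> = coset G \<delta> \<or> coset G (\<gamma> \<odot> gR) = coset G \<delta> \<or> coset G (\<gamma> \<odot> gR2) = coset G \<delta>" by auto
    then show ?thesis using assms t 2
      by (simp only: coset_eq_iff[OF G] PSL.m_closed gens_in) blast
  next
    case 3
    with assms t have "coset G \<gamma> = coset G \<delta>" by (simp add: edge_point_def)
    then show ?thesis using assms t by (simp only: coset_eq_iff[OF G]) blast
  qed
qed

text \<open>Turning about a vertex does not change the point of the surface, because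
  \<open>gS\<close> fixes i and \<open>gR\<close> fixes \<rho>.\<close>

lemma graph_to_surface_edge:
  assumes "\<gamma> \<in> PSL" "t \<in> {0..1}"
  shows "graph_to_surface (edge_point (Ycomb G) (coset G \<gamma>) t) = proj (act \<gamma> (edge_pt t))"
  unfolding graph_to_surface_def
proof (rule someI2[where a = "proj (act \<gamma> (edge_pt t))"])
  show "\<exists>\<gamma>' t'. \<gamma>' \<in> PSL \<and> t' \<in> {0..1} \<and> edge_point (Ycomb G) (coset G \<gamma>) t = edge_point (Ycomb G) (coset G \<gamma>') t' \<and>
     proj (act \<gamma> (edge_pt t)) = proj (act \<gamma>' (edge_pt t'))"
    using assms by blast
next
  fix u assume "\<exists>\<gamma>' t'. \<gamma>' \<in> PSL \<and> t' \<in> {0..1} \<and>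
      edge_point (Ycomb G) (coset G \<gamma>) t = edge_point (Ycomb G) (coset G \<gamma>') t' \<and> u = proj (act \<gamma>' (edge_pt t'))"
  then obtain \<delta> t' where \<delta>: "\<delta> \<in> PSL" "t' \<in> {0..1}" and u: "u = proj (act \<delta> (edge_pt t'))"
    and eq: "edge_point (Ycomb G) (coset G \<gamma>) t = edge_point (Ycomb G) (coset G \<delta>) t'" by blast
  have c0: "act (\<gamma> \<odot> gS) (edge_pt 0) = act \<gamma> (edge_pt 0)" and
    c1: "act (\<gamma> \<odot> gR) (edge_pt 1) = act \<gamma> (edge_pt 1)"
    "act (\<gamma> \<odot> gR2) (edge_pt 1) = act \<gamma> (edge_pt 1)"
    using compatible_act_edge assms(1) unfolding compatible_paths_def
    by (blast, blast, metis gens_in(2) gens_mult_assoc(7) PSL.m_closed)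
  from coset_edge_cases[OF assms(1) \<delta>(1) assms(2) \<delta>(2) eq]
  obtain g where t: "t = t'" and g: "g \<in> G" "\<delta> = g \<odot> \<gamma> \<or> t = 0 \<and> \<delta> = g \<odot> (\<gamma> \<odot> gS) \<or>
      t = 1 \<and> (\<delta> = g \<odot> (\<gamma> \<odot> gR) \<or> \<delta> = g \<odot> (\<gamma> \<odot> gR2))" by blast
  have "act \<delta> (edge_pt t) = act g (act \<gamma> (edge_pt t))"
    using g assms edge_pt_props(1)[OF assms(2)] c0 c1 by (auto simp: act_mult)
  then show "u = proj (act \<gamma> (edge_pt t))"
    using u t g proj_act assms edge_pt_props(1)[OF assms(2)] by simp
qed

lemma coset_arc: "\<gamma> \<in> PSL \<Longrightarrow> coset G \<gamma> \<in> arcs (Ycomb G)"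
  using G_sub by (auto simp: RCOSETS_def)

lemma continuous_surface_to_graph: "continuous_map (Y G) (realisation (Ycomb G)) surface_to_graph"
proof (rule continuous_compose_quotient_map[OF quotient_map_proj])
  have cont: "continuous_map (top_of_set \<H>) (realisation (Ycomb G)) (glue (\<lambda>\<gamma>. edge_point (Ycomb G) (coset G \<gamma>)))"
    by (intro continuous_glue compatible_graph continuous_map_edge_point wf_Ycomb coset_arc)
  have eq: "(surface_to_graph \<circ> proj) z = glue (\<lambda>\<gamma>. edge_point (Ycomb G) (coset G \<gamma>)) z" if z: "z \<in> \<H>" for z
  proof -
    obtain \<gamma> w where *: "\<gamma> \<in> PSL" "w \<in> \<triangle>" "z = act \<gamma> w" by (rule upper_triangle_cases[OF z])
    then show ?thesis using surface_to_graph_proj[OF *(1,2)] glue_triangle[OF compatible_graph *(1,2)] by simp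
  qed
  show "continuous_map (top_of_set \<H>) (realisation (Ycomb G)) (surface_to_graph \<circ> proj)"
    by (rule continuous_map_eq[OF cont]) (simp add: eq del: o_apply)
qed

lemma continuous_proj_path:
  assumes "\<gamma> \<in> PSL"
  shows "continuous_map (top_of_set {0..1}) (Y G) (\<lambda>t. proj (act \<gamma> (edge_pt t)))"
proof -
  have "continuous_on {0..1} (\<lambda>t. act \<gamma> (edge_pt t))"
    by (rule continuous_on_compose2[OF continuous_on_act[OF assms] continuous_edge_pt])
       (use edge_pt_props(1) in auto)
  then have "continuous_map (top_of_set {0..1}) (top_of_set \<H>) (\<lambda>t. act \<gamma> (edge_pt t))"
    using assms edge_pt_props(1) by auto
  from continuous_map_compose[OF this quotient_imp_continuous_map[OF quotient_map_proj]]
  show ?thesis by (simp add: o_def)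
qed

lemma continuous_graph_to_surface: "continuous_map (realisation (Ycomb G)) (Y G) graph_to_surface"
proof (rule continuous_map_realisation[OF wf_Ycomb])
  have "graph_to_surface x \<in> topspace (Y G)" if "x \<in> points (Ycomb G)" for x
    using that
  proof (rule points_cases)
    fix \<gamma> t assume *: "\<gamma> \<in> PSL" "t \<in> {0..1::real}" "x = edge_point (Ycomb G) (coset G \<gamma>) t"
    then show ?thesis
      using graph_to_surface_edge[OF *(1,2)] edge_pt_props(1)[OF *(2)] by (simp add: topspace_Y)
  qed
  then show "graph_to_surface ` points (Ycomb G) \<subseteq> topspace (Y G)" by blast
next
  fix e assume "e \<in> arcs (Ycomb G)"
  then obtain \<gamma> where \<gamma>: "\<gamma> \<in> PSL" "e = coset G \<gamma>" by (auto elim: rcosets_cases)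
  show "continuous_map (top_of_set {0..1}) (Y G) (graph_to_surface \<circ> edge_point (Ycomb G) e)"
    by (rule continuous_map_eq[OF continuous_proj_path[OF \<gamma>(1)]])
       (simp add: \<gamma>(2) graph_to_surface_edge[OF \<gamma>(1)])
qed

text \<open>Interpolation between a point and its image under \<open>tree_retr\<close> commutes with
  the action, so the homotopy descends to orbits.\<close>

lemma proj_homotopy:
  "homotopic_with (\<lambda>_. True) (Y G) (Y G) id (graph_to_surface \<circ> surface_to_graph)"
proof -
  define h where "h = (\<lambda>s z. interp s z (tree_retr z))"
  define k where "k = (\<lambda>(s, u). proj (h s (SOME z. z \<in> \<H> \<and> proj z = u)))"
  have hH: "h s z \<in> \<H>" if "s \<in> {0..1}" "z \<in> \<H>" for s z
    using that tree_retr_in interp_in by (simp add: h_def)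
  have kproj: "k (s, proj z) = proj (h s z)" if s: "s \<in> {0..1}" and z: "z \<in> \<H>" for s z
  proof -
    define w where "w = (SOME w. w \<in> \<H> \<and> proj w = proj z)"
    have "w \<in> \<H> \<and> proj w = proj z" unfolding w_def by (rule someI[where x = z]) (use z in simp)
    then obtain g where g: "g \<in> G" "w = act g z" using proj_eqD by blast
    have "h s w = act g (h s z)"
      using g z s tree_retr_in[OF z] by (simp add: h_def tree_retr_equivariant interp_equivariant)
    then have "proj (h s w) = proj (h s z)" using proj_act[OF g(1) hH[OF s z]] by simp
    then show ?thesis by (simp add: k_def w_def)
  qed
  \<comment> \<open>A product with a quotient map need not be a quotient map; it is here because the
    unit interval is locally compact Hausdorff. This is what makes the descended homotopy continuous
    jointly in both variables.\<close>
  have "quotient_map (prod_topology (top_of_set {0..1::real}) (top_of_set \<H>))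
          (prod_topology (top_of_set {0..1}) (Y G)) (\<lambda>(s, z). (s, proj z))"
    by (intro quotient_map_prod_right quotient_map_proj compact_imp_locally_compact_space disjI1
        Hausdorff_space_subtopology Hausdorff_space_euclidean compact_space_subtopology) simp
  moreover have "continuous_map (prod_topology (top_of_set {0..1::real}) (top_of_set \<H>)) (Y G)
      (k \<circ> (\<lambda>(s, z). (s, proj z)))"
  proof -
    have "continuous_map (top_of_set ({0..1} \<times> \<H>)) (top_of_set \<H>) (\<lambda>(s, z). h s z)"
      using continuous_interp hH by (auto simp: h_def)
    from continuous_map_compose[OF this quotient_imp_continuous_map[OF quotient_map_proj]]
    have "continuous_map (prod_topology (top_of_set {0..1}) (top_of_set \<H>)) (Y G) (proj \<circ> (\<lambda>(s, z). h s z))"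
      by (simp add: prod_topology_subtopology_eu)
    then show ?thesis
      by (rule continuous_map_eq) (auto simp: kproj)
  qed
  ultimately have "continuous_map (prod_topology (top_of_set {0..1}) (Y G)) (Y G) k"
    by (rule continuous_compose_quotient_map)
  moreover have "k (0, u) = id u \<and> k (1, u) = (graph_to_surface \<circ> surface_to_graph) u"
    if u: "u \<in> topspace (Y G)" for u
  proof -
    obtain z where z: "z \<in> \<H>" "u = proj z" using u by (auto simp: topspace_Y)
    obtain \<gamma> w where *: "\<gamma> \<in> PSL" "w \<in> \<triangle>" "z = act \<gamma> w" by (rule upper_triangle_cases[OF z(1)])
    have "graph_to_surface (surface_to_graph u) = proj (tree_retr z)"
      using * tau_range[OF *(2)] z
      by (simp add: surface_to_graph_proj graph_to_surface_edge tree_retr_triangle)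
    then show ?thesis
      using z kproj[of 0 z] kproj[of 1 z] tree_retr_in[OF z(1)] by (simp add: h_def interp_ends)
  qed
  ultimately show ?thesis
    by (subst homotopic_with) auto
qed

text \<open>On the graph side the composite is the identity exactly, since \<open>tau\<close>
  inverts \<open>edge_pt\<close>; only the surface side needs a homotopy.\<close>

theorem graph_homotopy_equivalent_surface: "realisation (Ycomb G) homotopy_equivalent_space Y G"
  unfolding homotopy_equivalent_space_def
proof (intro exI conjI)
  show "continuous_map (realisation (Ycomb G)) (Y G) graph_to_surface"
    by (rule continuous_graph_to_surface)
  show "continuous_map (Y G) (realisation (Ycomb G)) surface_to_graph"
    by (rule continuous_surface_to_graph)
  show "homotopic_with (\<lambda>x. True) (Y G) (Y G) (graph_to_surface \<circ> surface_to_graph) id"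
    using proj_homotopy by (simp add: homotopic_with_sym)
  have "(surface_to_graph \<circ> graph_to_surface) x = id x" if "x \<in> topspace (realisation (Ycomb G))" for x
  proof -
    have "x \<in> points (Ycomb G)" using that by (simp add: topspace_realisation[OF wf_Ycomb])
    then show ?thesis
    proof (rule points_cases)
      fix \<gamma> t assume *: "\<gamma> \<in> PSL" "t \<in> {0..1::real}" "x = edge_point (Ycomb G) (coset G \<gamma>) t"
      then show ?thesis
        using surface_to_graph_proj[OF *(1) edge_pt_props(4)[OF *(2)]] edge_pt_props(5)[OF *(2)]
        by (simp add: graph_to_surface_edge)
    qed
  qed
  then show "homotopic_with (\<lambda>x. True) (realisation (Ycomb G)) (realisation (Ycomb G)) (surface_to_graph \<circ> graph_to_surface) id"
    using continuous_map_compose[OF continuous_graph_to_surface continuous_surface_to_graph]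
    by (intro homotopic_with_equal) auto
qed

end


section \<open>The tree in the upper half-plane and its retractions\<close>

lemma hseg_triangle: "hsegment \<i> \<rho> \<subseteq> \<triangle>"
  by (auto simp: hsegment_i_rho triangle_iff)

lemma hseg_ends [simp]: "\<i> \<in> hsegment \<i> \<rho>" "\<rho> \<in> hsegment \<i> \<rho>"
  by (auto simp: hsegment_i_rho rho_coords)

lemma upper_eqI: "z \<in> \<H> \<Longrightarrow> w \<in> \<H> \<Longrightarrow> nsq z = nsq w \<Longrightarrow> Re z = Re w \<Longrightarrow> z = w"
  by (auto simp: complex_eq_iff nsq_def upper_iff power2_eq_iff_nonneg)

lemma hseg_i: "z \<in> hsegment \<i> \<rho> \<Longrightarrow> Re z = 0 \<Longrightarrow> z = \<i>"
  by (rule upper_eqI) (auto simp: hsegment_i_rho)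

lemma hseg_rho: "z \<in> hsegment \<i> \<rho> \<Longrightarrow> z \<in> wedge \<Longrightarrow> z = \<rho>"
  by (rule upper_eqI) (auto simp: hsegment_i_rho wedge_def rho_coords)

lemma hyp_tree_upper: "\<T> \<subseteq> \<H>"
proof -
  have "hsegment \<i> \<rho> \<subseteq> \<H>" by (auto simp: hsegment_def)
  then show ?thesis unfolding hyp_tree_def by (auto intro!: act_in)
qed

text \<open>A curve from the cusp \<open>0\<close> to the cusp \<open>\<infinity>\<close> inside the open triangle meets the tree only once
  and separates \<open>\<i>\<close> from \<open>\<rho>\<close>.\<close>
lemma connected_contains_hseg:
  assumes S: "Topological_Spaces.connected S" "S \<subseteq> \<T>" "\<i> \<in> S" "\<rho> \<in> S"
  shows "hsegment \<i> \<rho> \<subseteq> S"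
proof
  fix m assume m: "m \<in> hsegment \<i> \<rho>"
  then have mH: "m \<in> \<H>" and m1: "nsq m = 1" "0 \<le> Re m" "Re m \<le> 1/2" by (auto simp: hsegment_i_rho)
  consider "m = \<i>" | "m = \<rho>" | "0 < Re m" "Re m < 1/2"
    using m1 hseg_i[OF m] hseg_rho[OF m] mH by (fastforce simp: wedge_def)
  then show "m \<in> S"
  proof cases
    case 3
    \<comment> \<open>The slope is chosen so that \<open>h\<close>, defined next, vanishes at m.
      Within the triangle its zero set is the level curve of \<open>tau\<close> through m, and it
      has different signs at i and \<rho>.\<close>
    define l where "l = (1/2 - Re m) / Re m"
    have l: "l > 0" using 3 by (simp add: l_def)
    define h where "h z = l * Re z - min (1/2 - Re z) (nsq z - 2 * Re z)" for z
    have "continuous_on S h" unfolding h_def nsq_def by (intro continuous_intros)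
    then have "Topological_Spaces.connected (h ` S)" using S(1) by (rule connected_continuous_image)
    moreover have "h \<i> \<le> 0" "0 \<le> h \<rho>" using l by (simp_all add: h_def rho_coords)
    moreover have "h \<i> \<in> h ` S" "h \<rho> \<in> h ` S" using S by auto
    ultimately have "0 \<in> h ` S" by (meson connectedD_interval)
    then obtain z where z: "z \<in> S" "h z = 0" by auto
    then have zH: "z \<in> \<H>" using S hyp_tree_upper by auto
    have np: "nsq z > 0" using nsq_pos[OF zH] .
    have x: "Re z > 0"
    proof (rule ccontr)
      assume neg: "\<not> Re z > 0"
      then have "l * Re z \<le> 0" using l by (simp add: mult_le_0_iff)
      moreover have "min (1/2 - Re z) (nsq z - 2 * Re z) > 0" using neg np by auto
      ultimately show False using z(2) unfolding h_def by linarith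
    qed
    have "min (1/2 - Re z) (nsq z - 2 * Re z) > 0"
      using z(2) mult_pos_pos[OF l x] unfolding h_def by linarith
    then have zi: "z \<in> interior \<triangle>" using x zH by (simp add: interior_triangle)
    obtain \<gamma> w where w: "\<gamma> \<in> PSL" "w \<in> hsegment \<i> \<rho>" "z = act \<gamma> w"
      using z S unfolding hyp_tree_def by blast
    then have wt: "w \<in> \<triangle>" using hseg_triangle by blast
    have "act (\<iota> \<gamma>) z = w" using w wt by simp
    \<comment> \<open>Inside the open triangle the tree consists of points of the one edge from i to
      \<rho>, and on this edge the equation \<open>h z = 0\<close> determines the real part.\<close>
    with interior_triangle_unique[OF zi, of "\<iota> \<gamma>"] wt w have "\<iota> \<gamma> = \<e>" by simp
    then have "z = w" using \<open>act (\<iota> \<gamma>) z = w\<close> by simp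
    then have z1: "nsq z = 1" "Re z \<le> 1/2" using w by (auto simp: hsegment_i_rho)
    then have "min (1/2 - Re z) (nsq z - 2 * Re z) = 1/2 - Re z" by (simp add: min_def)
    then have "l * Re z = 1/2 - Re z" using z(2) by (simp add: h_def)
    then have "Re z * (1/2 - Re m) = (1/2 - Re z) * Re m" using 3 by (simp add: l_def field_simps)
    then have "Re z = Re m" by (simp add: algebra_simps)
    then have "z = m" using zH mH m1 z1 by (intro upper_eqI) auto
    then show ?thesis using z by simp
  qed (use S in auto)
qed

section \<open>The combinatorial tree and its image\<close>

lemma coset_one: "\<gamma> \<in> PSL \<Longrightarrow> coset {\<e>} \<gamma> = {\<gamma>}"
  by (simp add: r_coset_def)

lemma one_subgroup: "subgroup {\<e>} \<Gamma>"
  by (rule PSL.triv_subgroup)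

lemma T_arcs: "e \<in> arcs T \<longleftrightarrow> (\<exists>\<gamma>\<in>PSL. e = {\<gamma>})"
  by (auto simp: T_def RCOSETS_def coset_one)

lemma T_orbits:
  assumes "\<gamma> \<in> PSL"
  shows "right_orbit G0 {\<gamma>} = {{\<gamma>}, {\<gamma> \<odot> gS}}"
    "right_orbit G1 {\<gamma>} = {{\<gamma>}, {\<gamma> \<odot> gR}, {\<gamma> \<odot> gR2}}"
  using right_orbits[of "{\<e>}" \<gamma>] assms by (simp_all add: coset_one)

lemma T_tail_head: "tail T x = Inl (right_orbit G0 x)" "head T x = Inr (right_orbit G1 x)"
  by (simp_all add: T_def)

lemma T_act_edge_point:
  assumes "\<gamma> \<in> PSL" "\<delta> \<in> PSL"
  shows "T_act \<gamma> (edge_point T {\<delta>} t) = edge_point T {\<gamma> \<odot> \<delta>} t"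
proof -
  have l: "\<gamma> <#\<^bsub>\<Gamma>\<^esub> {x} = {\<gamma> \<odot> x}" for x by (simp add: l_coset_def)
  show ?thesis
    using assms by (simp add: edge_point_def T_act_def realise_map_def on_vertex_def T_tail_head T_orbits l
        PSL.m_assoc)
qed

lemma wf_T: "wf_digraph T"
  unfolding T_def by (rule wf_Ycomb)

text \<open>An equivariant homeomorphism is not given edge by edge, so its effect on edges has to be
  derived. The image of the base edge is connected and contains i and \<rho>, hence contains the
  whole segment; injectivity leaves no room for more.\<close>

lemma tree_isomorphism_edge:
  assumes f: "tree_isomorphism f" and \<gamma>: "\<gamma> \<in> PSL"
  shows "f ` edge_point T {\<gamma>} ` {0..1} = act \<gamma> ` hsegment \<i> \<rho>"
    and "f (edge_point T {\<gamma>} 1) = act \<gamma> \<rho>"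
proof -
  have hom: "homeomorphic_map (realisation T) (top_of_set \<T>) f"
    and eqv: "\<And>\<gamma> x. \<gamma> \<in> PSL \<Longrightarrow> x \<in> points T \<Longrightarrow> f (T_act \<gamma> x) = act \<gamma> (f x)"
    and i: "f (edge_point T {\<e>} 0) = \<i>" and rho: "f (edge_point T {\<e>} 1) = \<rho>"
    using f by (auto simp: tree_isomorphism_def T_tail_head)
  define E where "E \<gamma> = edge_point T {\<gamma>} ` {0..1}" for \<gamma>
  have ep: "edge_point T {\<gamma>} t \<in> points T" if "\<gamma> \<in> PSL" "t \<in> {0..1}" for \<gamma> t
    using that T_arcs by (intro edge_point_in wf_T) auto
  have ft: "f (edge_point T {\<gamma>} t) = act \<gamma> (f (edge_point T {\<e>} t))" if "\<gamma> \<in> PSL" "t \<in> {0..1}" for \<gamma> t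
    using eqv[OF that(1) ep[OF _ that(2)], of \<e>] that by (simp add: T_act_edge_point)
  have fE: "f ` E \<gamma> = act \<gamma> ` f ` E \<e>" if "\<gamma> \<in> PSL" for \<gamma>
    unfolding E_def image_image using ft[OF that] by (intro image_cong) auto
  have inj: "inj_on f (points T)"
    using hom by (simp add: homeomorphic_map_def topspace_realisation[OF wf_T] injective_quotient_map
        homeomorphic_eq_everything_map)
  have cont: "continuous_map (top_of_set {0..1}) (top_of_set \<T>) (f \<circ> edge_point T {\<e>})"
    using T_arcs by (intro continuous_map_compose[OF continuous_map_edge_point[OF wf_T]]
        homeomorphic_imp_continuous_map[OF hom]) auto
  have "f ` E \<e> = (f \<circ> edge_point T {\<e>}) ` {0..1}" by (simp add: E_def image_comp)
  moreover have "Topological_Spaces.connected ((f \<circ> edge_point T {\<e>}) ` {0..1})"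
    by (rule connected_continuous_image) (use cont in auto)
  moreover have "(f \<circ> edge_point T {\<e>}) ` {0..1} \<subseteq> \<T>" using cont by auto
  moreover have "\<i> \<in> (f \<circ> edge_point T {\<e>}) ` {0..1}" "\<rho> \<in> (f \<circ> edge_point T {\<e>}) ` {0..1}"
    using i rho by (auto simp: image_iff intro: bexI[of _ 0] bexI[of _ 1])
  ultimately have sup: "hsegment \<i> \<rho> \<subseteq> f ` E \<e>" and fT: "f ` E \<e> \<subseteq> \<T>"
    using connected_contains_hseg by auto
  have "f ` E \<e> \<subseteq> hsegment \<i> \<rho>"
  proof
    fix x assume "x \<in> f ` E \<e>"
    then obtain t where t: "t \<in> {0..1}" "x = f (edge_point T {\<e>} t)" by (auto simp: E_def)
    obtain \<delta> where \<delta>: "\<delta> \<in> PSL" "x \<in> act \<delta> ` hsegment \<i> \<rho>"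
      using \<open>x \<in> f ` E \<e>\<close> fT unfolding hyp_tree_def by blast
    \<comment> \<open>The inclusion already shown, transported by \<delta>, presents x as an image
      from the edge of \<delta> too. Injectivity then makes two points of the combinatorial tree
      equal: either the edges agree or x is the image of an end.\<close>
    then have "x \<in> f ` E \<delta>" using sup fE[OF \<delta>(1)] by blast
    then obtain t' where t': "t' \<in> {0..1}" "x = f (edge_point T {\<delta>} t')" by (auto simp: E_def)
    have "edge_point T {\<e>} t = edge_point T {\<delta>} t'"
      using inj_onD[OF inj, of "edge_point T {\<e>} t" "edge_point T {\<delta>} t'"] t t' ep \<delta> by auto
    then have "edge_point (Ycomb {\<e>}) (coset {\<e>} \<e>) t = edge_point (Ycomb {\<e>}) (coset {\<e>} \<delta>) t'"
      using \<delta> by (simp add: coset_one T_def)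
    from coset_edge_cases[OF one_subgroup _ \<delta>(1) t(1) t'(1) this]
    consider "\<delta> = \<e>" | "t = 0" | "t = 1" by auto
    then show "x \<in> hsegment \<i> \<rho>"
    proof cases
      case 1
      then show ?thesis using \<delta> by simp
    qed (use t i rho in auto)
  qed
  with sup have "f ` E \<e> = hsegment \<i> \<rho>" by blast
  then show "f ` edge_point T {\<gamma>} ` {0..1} = act \<gamma> ` hsegment \<i> \<rho>"
    using fE[OF \<gamma>] by (simp add: E_def)
  show "f (edge_point T {\<gamma>} 1) = act \<gamma> \<rho>" using ft[OF \<gamma>, of 1] rho by simp
qed

section \<open>Fibres of an adapted retraction\<close>

context
  fixes p assumes retr: "equivariant_retraction p" and adapted: "adapted p"
begin

lemma retr_continuous: "continuous_on \<H> p"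
  using retr homotopic_with_imp_continuous_maps unfolding equivariant_retraction_def
  by fastforce

lemma retr_act: "\<gamma> \<in> PSL \<Longrightarrow> z \<in> \<H> \<Longrightarrow> p (act \<gamma> z) = act \<gamma> (p z)"
  using retr unfolding equivariant_retraction_def
  by (auto dest!: homotopic_with_imp_property)

text \<open>The open triangle goes into the edge, the edge is compact, and the triangle lies in the
  closure of its interior.\<close>

lemma retr_triangle:
  assumes "z \<in> \<triangle>" shows "p z \<in> hsegment \<i> \<rho>"
proof -
  have "closed (hsegment \<i> \<rho>)"
    unfolding edge_pt_image[symmetric]
    by (intro compact_imp_closed compact_continuous_image continuous_edge_pt) simp
  then have "closedin (top_of_set \<H>) (\<H> \<inter> p -` hsegment \<i> \<rho>)"
    by (rule continuous_closedin_preimage[OF retr_continuous])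
  then obtain K where K: "closed K" "\<H> \<inter> p -` hsegment \<i> \<rho> = \<H> \<inter> K"
    by (auto simp: closedin_closed)
  have "interior \<triangle> \<subseteq> \<H> \<inter> p -` hsegment \<i> \<rho>"
    using adapted interior_subset triangle_upper unfolding adapted_def by blast
  then have "interior \<triangle> \<subseteq> K" using K by blast
  then have "closure (interior \<triangle>) \<subseteq> K" using K closure_minimal by blast
  then have "z \<in> K" using triangle_closure_interior assms by blast
  moreover have "z \<in> \<H>" using assms by simp
  ultimately show ?thesis using K by blast
qed

text \<open>Such a point lies on a side shared with a rotated tile. Its image lies on the edges of
  both tiles, and these meet only at \<rho>.\<close>

lemma retr_wedge:
  assumes z: "z \<in> \<triangle>" "z \<in> wedge" shows "p z = \<rho>"
proof -
  have zH: "z \<in> \<H>" using z by simp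
  have "act gR z \<in> \<triangle> \<or> act gR2 z \<in> \<triangle>"
    using z(1)[unfolded triangle_iff] z(2) unfolding gens_triangle_iff[OF zH] wedge_def by auto
  then obtain x where x: "x \<in> {gR, gR2}" "act x z \<in> \<triangle>" by blast
  then have "p (act x z) \<in> hsegment \<i> \<rho>" by (intro retr_triangle)
  then have "act x (p z) \<in> \<triangle>" using hseg_triangle retr_act[of x z] x zH by auto
  moreover have pz: "p z \<in> hsegment \<i> \<rho>" using z by (intro retr_triangle)
  ultimately have "p z \<in> wedge" using triangle_neighbours[of "p z" x] hseg_triangle x by auto
  then show ?thesis by (rule hseg_rho[OF pz])
qed

lemma triangle_cases:
  assumes "z \<in> \<triangle>" obtains "Re z = 0" | "z \<in> wedge" | "z \<in> interior \<triangle>"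
  using assms by (fastforce simp: triangle_iff wedge_def interior_triangle)

lemma retr_eq_i:
  assumes "z \<in> \<triangle>" "p z = \<i>" shows "Re z = 0"
  using assms(1)
proof (cases rule: triangle_cases)
  case 2
  then have "Re \<i> = Re \<rho>" using retr_wedge assms by metis
  then show ?thesis by (simp add: rho_coords)
next
  case 3
  then show ?thesis using adapted assms unfolding adapted_def by blast
qed

text \<open>The two ends behave differently. Points over \<gamma>i that come from the adjacent tile
  lie on the common side and so already in the tile of \<gamma>, whereas the fibre over
  \<gamma>\<rho> contains the side at \<gamma>\<rho> opposite this tile.\<close>

lemma retr_in_edge_iff:
  assumes \<gamma>: "\<gamma> \<in> PSL" and z: "z \<in> \<H>"
  shows "p z \<in> act \<gamma> ` hsegment \<i> \<rho> \<longleftrightarrow> z \<in> act \<gamma> ` \<triangle> \<or> p z = act \<gamma> \<rho>"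
proof
  assume "p z \<in> act \<gamma> ` hsegment \<i> \<rho>"
  then obtain v where v: "v \<in> hsegment \<i> \<rho>" "p z = act \<gamma> v" by blast
  obtain \<delta> w where w: "\<delta> \<in> PSL" "w \<in> \<triangle>" "z = act \<delta> w" by (rule upper_triangle_cases[OF z])
  have vt: "v \<in> \<triangle>" and pw: "p w \<in> hsegment \<i> \<rho>" "p w \<in> \<triangle>"
    using v w retr_triangle hseg_triangle by auto
  define x where "x = \<iota> \<gamma> \<odot> \<delta>"
  have x: "x \<in> PSL" "\<delta> = \<gamma> \<odot> x" using \<gamma> w by (simp_all add: x_def flip: PSL.m_assoc)
  have "act \<delta> (p w) = act \<gamma> v" using v w retr_act[of \<delta> w] by simp
  then have "act x (p w) = v" using \<gamma> w pw vt by (simp add: x_def act_mult)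
  with triangle_neighbours[OF pw(2), of x] vt x
  consider "x = \<e>" | "x = gS" "Re (p w) = 0" | "v \<in> wedge" by auto
  then show "z \<in> act \<gamma> ` \<triangle> \<or> p z = act \<gamma> \<rho>"
  proof cases
    case 1 then show ?thesis using x w \<gamma> by auto
  next
    case 2
    then have "Re w = 0" using hseg_i[OF pw(1)] retr_eq_i[OF w(2)] by simp
    then have "act gS w \<in> \<triangle>" using w nsq_pos[of w] by (simp add: gens_triangle_iff)
    moreover have "z = act \<gamma> (act gS w)" using 2 x w \<gamma> by (simp add: act_mult)
    ultimately show ?thesis by blast
  next
    case 3 then show ?thesis using hseg_rho[OF v(1)] v by simp
  qed
next
  assume "z \<in> act \<gamma> ` \<triangle> \<or> p z = act \<gamma> \<rho>"
  then show "p z \<in> act \<gamma> ` hsegment \<i> \<rho>"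
  proof
    assume "z \<in> act \<gamma> ` \<triangle>"
    then obtain w where "w \<in> \<triangle>" "z = act \<gamma> w" by blast
    then show ?thesis using retr_triangle retr_act \<gamma> by simp
  qed simp
qed

text \<open>Bounds the fibre by the three tiles around \<gamma>\<rho>: when all three belong to the
  polygon, the fibre adds nothing to it.\<close>

lemma retr_eq_rho:
  assumes \<gamma>: "\<gamma> \<in> PSL" and z: "z \<in> \<H>" and p: "p z = act \<gamma> \<rho>"
  shows "\<exists>x\<in>{\<e>, gR, gR2}. z \<in> act (\<gamma> \<odot> x) ` \<triangle>"
proof -
  obtain \<delta> w where w: "\<delta> \<in> PSL" "w \<in> \<triangle>" "z = act \<delta> w" by (rule upper_triangle_cases[OF z])
  have pw: "p w \<in> \<triangle>" using w retr_triangle hseg_triangle by auto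
  define x where "x = \<iota> \<gamma> \<odot> \<delta>"
  have x: "x \<in> PSL" "\<delta> = \<gamma> \<odot> x" using \<gamma> w by (simp_all add: x_def flip: PSL.m_assoc)
  have "act \<delta> (p w) = act \<gamma> \<rho>" using p w retr_act[of \<delta> w] by simp
  then have xw: "act x (p w) = \<rho>" using \<gamma> w pw by (simp add: x_def act_mult)
  moreover have "\<rho> \<in> \<triangle>" using hseg_triangle by auto
  ultimately have "x \<in> {\<e>, gR, gR2}"
    using triangle_neighbours[OF pw, of x] x rho_coords by auto
  then show ?thesis using w x by blast
qed

lemma retr_interior:
  assumes "\<gamma> \<in> PSL" "\<delta> \<in> PSL" "z \<in> interior \<triangle>" "p (act \<delta> z) \<in> act \<gamma> ` hsegment \<i> \<rho>"
  shows "\<gamma> = \<delta>"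
proof -
  have zt: "z \<in> \<triangle>" using assms interior_subset by blast
  have pz: "p z \<in> hsegment \<i> \<rho>" "p z \<noteq> \<i>" "p z \<noteq> \<rho>" using assms adapted unfolding adapted_def by auto
  obtain v where v: "v \<in> hsegment \<i> \<rho>" "act \<delta> (p z) = act \<gamma> v" using assms retr_act zt by auto
  have "p z \<in> \<H>" "v \<in> \<H>" using pz(1) v(1) by (simp_all add: hsegment_def)
  then have "act (\<iota> \<gamma> \<odot> \<delta>) (p z) = v"
    using assms(1,2) v(2) by (simp add: act_mult)
  with triangle_neighbours[of "p z" "\<iota> \<gamma> \<odot> \<delta>"] v pz assms hseg_i[OF pz(1)] hseg_rho[OF pz(1)] hseg_triangle
  have "\<iota> \<gamma> \<odot> \<delta> = \<e>" by auto
  then show ?thesis using assms by (metis PSL.inv_equality PSL.inv_inv PSL.inv_closed)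
qed

end


section \<open>Lifts of the cut graph\<close>

text \<open>Connectedness is a statement about reachability of vertices; the auxiliary
  \<open>Q v\<close>, that all edges at v have the property, turns it into a propagation between
  edges sharing a vertex.\<close>

lemma connected_arc_induct:
  assumes conn: "Digraph_Component.connected X" and wf: "wf_digraph X"
    and e0: "e0 \<in> arcs X" and e: "e \<in> arcs X" and "P e0"
    and step: "\<And>a b. a \<in> arcs X \<Longrightarrow> b \<in> arcs X \<Longrightarrow> P a \<Longrightarrow>
      {tail X a, head X a} \<inter> {tail X b, head X b} \<noteq> {} \<Longrightarrow> P b"
  shows "P e"
proof -
  define Q where "Q v \<longleftrightarrow> (\<forall>b\<in>arcs X. v \<in> {tail X b, head X b} \<longrightarrow> P b)" for v
  have in_verts: "tail X e0 \<in> verts X" "tail X e \<in> verts X"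
    using wf_digraph.tail_in_verts[OF wf] e0 e by auto
  have "tail X e0 \<rightarrow>\<^sup>*\<^bsub>with_proj (mk_symmetric X)\<^esub> tail X e"
    using conn in_verts by (auto simp: Digraph_Component.connected_def strongly_connected_def mk_symmetric_def)
  then have "(tail X e0, tail X e) \<in> rtrancl_on (verts X)
      (\<Union>e\<in>arcs X. {(tail X e, head X e), (head X e, tail X e)})"
    by (simp add: reachable_def mk_symmetric_def)
  then have "Q (tail X e)"
  proof (induction rule: rtrancl_on_induct)
    case base
    show ?case unfolding Q_def
    proof (intro ballI impI)
      fix b assume b: "b \<in> arcs X" "tail X e0 \<in> {tail X b, head X b}"
      then show "P b" by (intro step[OF e0 b(1) \<open>P e0\<close>]) auto
    qed
  next
    case (step y z)
    then obtain a where a: "a \<in> arcs X" "y \<in> {tail X a, head X a}" "z \<in> {tail X a, head X a}" by auto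
    then have Pa: "P a" using step by (auto simp: Q_def)
    show ?case unfolding Q_def
    proof (intro ballI impI)
      fix b assume b: "b \<in> arcs X" "z \<in> {tail X b, head X b}"
      then show "P b" using a by (intro assms(6)[OF a(1) b(1) Pa]) auto
    qed
  qed
  then show ?thesis using e by (auto simp: Q_def)
qed

lemma wf_cut_graph:
  assumes "wf_digraph X" shows "wf_digraph (cut_graph X C)"
  by unfold_locales
     (auto simp: cut_graph_def wf_digraph.tail_in_verts[OF assms] wf_digraph.head_in_verts[OF assms])

lemma T_tail_eq:
  assumes "\<gamma> \<in> PSL" "\<delta> \<in> PSL" "tail T {\<gamma>} = tail T {\<delta>}"
  shows "\<delta> = \<gamma> \<or> \<delta> = \<gamma> \<odot> gS"
proof -
  have "{\<delta>} \<in> {{\<gamma>}, {\<gamma> \<odot> gS}}" using assms by (simp add: T_tail_head T_orbits)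
  then show ?thesis by auto
qed

lemma T_head_eq:
  assumes "\<gamma> \<in> PSL" "\<delta> \<in> PSL" "head T {\<gamma>} = head T {\<delta>}"
  shows "\<delta> = \<gamma> \<or> \<delta> = \<gamma> \<odot> gR \<or> \<delta> = \<gamma> \<odot> gR2"
proof -
  have "{\<delta>} \<in> {{\<gamma>}, {\<gamma> \<odot> gR}, {\<gamma> \<odot> gR2}}" using assms by (simp add: T_tail_head T_orbits)
  then show ?thesis by auto
qed

lemma cut_graph_simps [simp]:
  "arcs (cut_graph X C) = arcs X"
  "tail (cut_graph X C) e = (if tail X e \<in> C then Inr (tail X e, e) else Inl (tail X e))"
  "head (cut_graph X C) e = (if head X e \<in> C then Inr (head X e, e) else Inl (head X e))"
  by (simp_all add: cut_graph_def)

lemma coset_mult_cong: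
  assumes "G \<subseteq> PSL" "\<gamma> \<in> PSL" "\<delta> \<in> PSL" "x \<in> PSL" "coset G \<gamma> = coset G \<delta>"
  shows "coset G (\<gamma> \<odot> x) = coset G (\<delta> \<odot> x)"
  using assms by (metis PSL.coset_mult_assoc)

text \<open>Right multiplication by \<open>gR\<close> permutes cosets with period 3, so as soon as
  two of the three coincide all do. This is why the valency at type (1) is 1 or 3.\<close>

lemma rotated_cosets:
  assumes "G \<subseteq> PSL" "\<gamma> \<in> PSL"
  shows "coset G (\<gamma> \<odot> gR2) = coset G \<gamma> \<longleftrightarrow> coset G (\<gamma> \<odot> gR) = coset G \<gamma>"
    "coset G (\<gamma> \<odot> gR) = coset G (\<gamma> \<odot> gR2) \<longleftrightarrow> coset G (\<gamma> \<odot> gR) = coset G \<gamma>"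
proof -
  have *: "coset G (\<gamma> \<odot> gR2) = coset G \<gamma> \<Longrightarrow> coset G \<gamma> = coset G (\<gamma> \<odot> gR)"
    "coset G (\<gamma> \<odot> gR) = coset G \<gamma> \<Longrightarrow> coset G (\<gamma> \<odot> gR2) = coset G (\<gamma> \<odot> gR)"
    "coset G (\<gamma> \<odot> gR) = coset G (\<gamma> \<odot> gR2) \<Longrightarrow> coset G (\<gamma> \<odot> gR2) = coset G \<gamma>"
    using coset_mult_cong[OF assms(1), of "\<gamma> \<odot> gR2" \<gamma> gR] coset_mult_cong[OF assms(1), of "\<gamma> \<odot> gR" \<gamma> gR]
      coset_mult_cong[OF assms(1), of "\<gamma> \<odot> gR" "\<gamma> \<odot> gR2" gR] assms(2) by simp_all
  then show "coset G (\<gamma> \<odot> gR2) = coset G \<gamma> \<longleftrightarrow> coset G (\<gamma> \<odot> gR) = coset G \<gamma>"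
    "coset G (\<gamma> \<odot> gR) = coset G (\<gamma> \<odot> gR2) \<longleftrightarrow> coset G (\<gamma> \<odot> gR) = coset G \<gamma>" by metis+
qed

lemma card_orbit:
  assumes "G \<subseteq> PSL" "\<gamma> \<in> PSL"
  shows "card (right_orbit G1 (coset G \<gamma>)) = (if coset G (\<gamma> \<odot> gR) = coset G \<gamma> then 1 else 3)"
proof (cases "coset G (\<gamma> \<odot> gR) = coset G \<gamma>")
  case True
  moreover from this have "coset G (\<gamma> \<odot> gR2) = coset G \<gamma>" using rotated_cosets(1)[OF assms] by simp
  ultimately show ?thesis by (simp add: right_orbits(2)[OF assms])
next
  case False
  with rotated_cosets[OF assms] have "coset G (\<gamma> \<odot> gR2) \<noteq> coset G \<gamma>"
    "coset G (\<gamma> \<odot> gR) \<noteq> coset G (\<gamma> \<odot> gR2)" by blast+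
  with False show ?thesis
    by (simp add: right_orbits(2)[OF assms] card_insert_if not_sym[OF False] not_sym)
qed

lemma orbit_arcs:
  assumes "G \<subseteq> PSL" "\<gamma> \<in> PSL"
  shows "{e \<in> rcosets\<^bsub>\<Gamma>\<^esub> G. right_orbit G1 e = right_orbit G1 (coset G \<gamma>)} = right_orbit G1 (coset G \<gamma>)"
proof
  have self: "e \<in> right_orbit G1 e" if "e \<in> rcosets\<^bsub>\<Gamma>\<^esub> G" for e
    using that assms(1) by (auto elim!: rcosets_cases simp: right_orbits)
  then show "{e \<in> rcosets\<^bsub>\<Gamma>\<^esub> G. right_orbit G1 e = right_orbit G1 (coset G \<gamma>)} \<subseteq> right_orbit G1 (coset G \<gamma>)"
    by blast
  have "right_orbit G1 (coset G (\<gamma> \<odot> gR)) = right_orbit G1 (coset G \<gamma>)"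
    "right_orbit G1 (coset G (\<gamma> \<odot> gR2)) = right_orbit G1 (coset G \<gamma>)"
    using assms by (auto simp: right_orbits)
  then show "right_orbit G1 (coset G \<gamma>) \<subseteq> {e \<in> rcosets\<^bsub>\<Gamma>\<^esub> G. right_orbit G1 e = right_orbit G1 (coset G \<gamma>)}"
    using assms by (auto simp: right_orbits[OF assms] RCOSETS_def)
qed

text \<open>The edges of the lifted tree as group elements. The lift has one edge over each edge of
  the graph, so this set is a transversal of the cosets.\<close>

definition lifted :: "(int^2^2) set set \<Rightarrow> (edge \<Rightarrow> edge) \<Rightarrow> (int^2^2) set set" where
  "lifted G jE = {\<gamma> \<in> PSL. jE (coset G \<gamma>) = {\<gamma>}}"

section \<open>The edges of the lifted tree\<close>

context
  fixes G C jV jE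
  assumes G: "subgroup G \<Gamma>"
    and C: "C \<subseteq> {v \<in> verts (Ycomb G). valency (Ycomb G) v = 2}"
    and conn: "Digraph_Component.connected (cut_graph (Ycomb G) C)"
    and lift: "is_lift G C jV jE"
begin

abbreviation "Ycut \<equiv> cut_graph (Ycomb G) C"

lemma G_subset: "G \<subseteq> PSL"
  by (rule subgroup.subset[OF G])

lemma lifted_in [simp]: "\<gamma> \<in> lifted G jE \<Longrightarrow> \<gamma> \<in> PSL"
  by (simp add: lifted_def)

lemma lifted_unique: "\<gamma> \<in> lifted G jE \<Longrightarrow> \<delta> \<in> lifted G jE \<Longrightarrow> coset G \<gamma> = coset G \<delta> \<Longrightarrow> \<gamma> = \<delta>"
  unfolding lifted_def by (metis (mono_tags, lifting) mem_Collect_eq singleton_inject)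

lemma lift_edge:
  assumes "e \<in> rcosets\<^bsub>\<Gamma>\<^esub> G"
  obtains \<gamma> where "\<gamma> \<in> lifted G jE" "jE e = {\<gamma>}" "coset G \<gamma> = e"
proof -
  have "jE e \<in> arcs T" "G <#>\<^bsub>\<Gamma>\<^esub> jE e = e"
    using lift assms by (auto simp: is_lift_def graph_morphism_def)
  then obtain \<gamma> where \<gamma>: "\<gamma> \<in> PSL" "jE e = {\<gamma>}" "G <#>\<^bsub>\<Gamma>\<^esub> {\<gamma>} = e" using T_arcs by metis
  then have "coset G \<gamma> = e" by (simp add: r_coset_def set_mult_def)
  moreover from this \<gamma> have "\<gamma> \<in> lifted G jE" unfolding lifted_def by blast
  ultimately show ?thesis using that \<gamma>(2) by blast
qed

lemma lifted_arc: "\<gamma> \<in> lifted G jE \<Longrightarrow> coset G \<gamma> \<in> rcosets\<^bsub>\<Gamma>\<^esub> G"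
  by (auto simp: RCOSETS_def)

lemma lifted_ends:
  assumes "\<gamma> \<in> lifted G jE"
  shows "tail T {\<gamma>} = jV (tail Ycut (coset G \<gamma>))" "head T {\<gamma>} = jV (head Ycut (coset G \<gamma>))"
proof -
  have "jE (coset G \<gamma>) = {\<gamma>}" using assms unfolding lifted_def by blast
  moreover have "coset G \<gamma> \<in> arcs Ycut" using lifted_arc[OF assms] by simp
  ultimately show "tail T {\<gamma>} = jV (tail Ycut (coset G \<gamma>))" "head T {\<gamma>} = jV (head Ycut (coset G \<gamma>))"
    using lift unfolding is_lift_def graph_morphism_def by metis+
qed

lemma valency_type1:
  assumes "\<gamma> \<in> PSL"
  shows "valency (Ycomb G) (Inr (right_orbit G1 (coset G \<gamma>))) = (if coset G (\<gamma> \<odot> gR) = coset G \<gamma> then 1 else 3)"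
  using orbit_arcs[OF G_subset assms] card_orbit[OF G_subset assms]
  by (simp add: valency_def in_degree_def out_degree_def in_arcs_def out_arcs_def)

text \<open>Cuts occur at valency 2, and valency 2 occurs only at type (0).\<close>

lemma head_not_cut: "\<gamma> \<in> PSL \<Longrightarrow> Inr (right_orbit G1 (coset G \<gamma>)) \<notin> C"
  using C valency_type1[of \<gamma>] by (auto split: if_splits)

lemma valency_cut_type1:
  assumes "\<gamma> \<in> PSL"
  shows "valency Ycut (Inl (Inr (right_orbit G1 (coset G \<gamma>)))) = (if coset G (\<gamma> \<odot> gR) = coset G \<gamma> then 1 else 3)"
proof -
  have "in_arcs Ycut (Inl (Inr (right_orbit G1 (coset G \<gamma>)))) =
      {e \<in> rcosets\<^bsub>\<Gamma>\<^esub> G. right_orbit G1 e = right_orbit G1 (coset G \<gamma>)}"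
    using head_not_cut[OF assms] by (auto simp: in_arcs_def split: if_splits)
  moreover have "out_arcs Ycut (Inl (Inr (right_orbit G1 (coset G \<gamma>)))) = {}"
    by (auto simp: out_arcs_def split: if_splits)
  ultimately show ?thesis
    using orbit_arcs[OF G_subset assms] card_orbit[OF G_subset assms]
    by (simp add: valency_def in_degree_def out_degree_def)
qed

text \<open>The vertex of type (1) is not cut, so three distinct edges at it are lifted to three
  edges with a common vertex. If \<open>gR\<close> fixes the coset, a rotated lift would be a second
  lift of the same edge.\<close>

lemma lifted_rotate:
  assumes \<gamma>: "\<gamma> \<in> lifted G jE"
  shows "\<gamma> \<odot> gR \<in> lifted G jE \<longleftrightarrow> coset G (\<gamma> \<odot> gR) \<noteq> coset G \<gamma>"
    and "\<gamma> \<odot> gR2 \<in> lifted G jE \<longleftrightarrow> coset G (\<gamma> \<odot> gR) \<noteq> coset G \<gamma>"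
proof -
  have \<gamma>\<Gamma>: "\<gamma> \<in> PSL" using \<gamma> by simp
  note rc = rotated_cosets[OF G_subset \<gamma>\<Gamma>]
  have no: "coset G (\<gamma> \<odot> x) \<noteq> coset G \<gamma>" if "\<gamma> \<odot> x \<in> lifted G jE" "x \<in> PSL" "x \<noteq> \<e>" for x
  proof
    assume "coset G (\<gamma> \<odot> x) = coset G \<gamma>"
    then have "\<gamma> \<odot> x = \<gamma>" using lifted_unique that \<gamma> by blast
    then show False using that \<gamma>\<Gamma> by (simp add: PSL.r_cancel_one')
  qed
  have yes: "\<gamma> \<odot> x \<in> lifted G jE" if ne: "coset G (\<gamma> \<odot> gR) \<noteq> coset G \<gamma>" and x: "x \<in> {gR, gR2}" for x
  proof -
    have "coset G (\<gamma> \<odot> x) \<in> rcosets\<^bsub>\<Gamma>\<^esub> G" using \<gamma>\<Gamma> x by (auto simp: RCOSETS_def)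
    then obtain \<delta> where \<delta>: "\<delta> \<in> lifted G jE" "coset G \<delta> = coset G (\<gamma> \<odot> x)" using lift_edge by metis
    have "right_orbit G1 (coset G (\<gamma> \<odot> x)) = right_orbit G1 (coset G \<gamma>)"
      using x \<gamma>\<Gamma> by (auto simp: right_orbits[OF G_subset])
    then have "head Ycut (coset G \<delta>) = head Ycut (coset G \<gamma>)"
      using head_not_cut[OF \<gamma>\<Gamma>] \<delta>(2) by simp
    then have "head T {\<gamma>} = head T {\<delta>}" using lifted_ends(2)[OF \<gamma>] lifted_ends(2)[OF \<delta>(1)] by metis
    with T_head_eq[OF \<gamma>\<Gamma>, of \<delta>] \<delta> have "\<delta> = \<gamma> \<or> \<delta> = \<gamma> \<odot> gR \<or> \<delta> = \<gamma> \<odot> gR2" by simp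
    with \<delta> ne rc x have "\<delta> = \<gamma> \<odot> x" by auto
    with \<delta> show ?thesis by simp
  qed
  show "\<gamma> \<odot> gR \<in> lifted G jE \<longleftrightarrow> coset G (\<gamma> \<odot> gR) \<noteq> coset G \<gamma>" using yes[of gR] no[of gR] by auto
  show "\<gamma> \<odot> gR2 \<in> lifted G jE \<longleftrightarrow> coset G (\<gamma> \<odot> gR) \<noteq> coset G \<gamma>" using yes[of gR2] no[of gR2] rc by auto
qed

lemma lifted_nonempty: "lifted G jE \<noteq> {}"
proof -
  have "coset G \<e> \<in> rcosets\<^bsub>\<Gamma>\<^esub> G" by (auto simp: RCOSETS_def)
  then show ?thesis using lift_edge by (metis empty_iff)
qed

text \<open>Connectedness of the cut graph seen upstairs: two edges sharing a vertex have lifts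
  sharing a vertex of the tree, and these differ by one letter on the right.\<close>

lemma lifted_induct:
  assumes \<gamma>0: "\<gamma>0 \<in> lifted G jE" and \<gamma>: "\<gamma> \<in> lifted G jE" and "P \<gamma>0"
    and step: "\<And>\<delta> x. \<delta> \<in> lifted G jE \<Longrightarrow> P \<delta> \<Longrightarrow> x \<in> {gS, gR, gR2} \<Longrightarrow> \<delta> \<odot> x \<in> lifted G jE \<Longrightarrow> P (\<delta> \<odot> x)"
  shows "P \<gamma>"
proof -
  define Q where "Q e \<longleftrightarrow> (\<forall>\<delta>\<in>lifted G jE. coset G \<delta> = e \<longrightarrow> P \<delta>)" for e
  have "Q (coset G \<gamma>)"
  proof (rule connected_arc_induct[OF conn wf_cut_graph[OF wf_Ycomb]])
    show "coset G \<gamma>0 \<in> arcs Ycut" "coset G \<gamma> \<in> arcs Ycut" using lifted_arc \<gamma>0 \<gamma> by auto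
    show "Q (coset G \<gamma>0)" using lifted_unique \<gamma>0 \<open>P \<gamma>0\<close> by (metis Q_def)
  next
    fix a b assume a: "a \<in> arcs Ycut" and b: "b \<in> arcs Ycut" and Qa: "Q a"
      and meet: "{tail Ycut a, head Ycut a} \<inter> {tail Ycut b, head Ycut b} \<noteq> {}"
    obtain \<delta> where \<delta>: "\<delta> \<in> lifted G jE" "coset G \<delta> = a" using lift_edge a by (metis cut_graph_simps(1) Ycomb_simps(1))
    have P\<delta>: "P \<delta>" using Qa \<delta> by (simp add: Q_def)
    show "Q b" unfolding Q_def
    proof (intro ballI impI)
      fix \<epsilon> assume \<epsilon>: "\<epsilon> \<in> lifted G jE" "coset G \<epsilon> = b"
      have "jV ` {tail Ycut a, head Ycut a} \<inter> jV ` {tail Ycut b, head Ycut b} \<noteq> {}" using meet by blast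
      then have "{tail T {\<delta>}, head T {\<delta>}} \<inter> {tail T {\<epsilon>}, head T {\<epsilon>}} \<noteq> {}"
        using lifted_ends[OF \<delta>(1)] lifted_ends[OF \<epsilon>(1)] \<delta>(2) \<epsilon>(2) by simp
      then have "tail T {\<delta>} = tail T {\<epsilon>} \<or> head T {\<delta>} = head T {\<epsilon>}" by (auto simp: T_tail_head)
      then have "\<epsilon> = \<delta> \<or> (\<exists>x\<in>{gS, gR, gR2}. \<epsilon> = \<delta> \<odot> x)"
        using T_tail_eq T_head_eq \<delta>(1) \<epsilon>(1) by (metis insertCI lifted_in)
      then show "P \<epsilon>" using P\<delta> step[OF \<delta>(1) P\<delta>] \<epsilon>(1) by auto
    qed
  qed
  then show ?thesis using \<gamma> by (simp add: Q_def)
qed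

lemma realise_edge:
  assumes "\<gamma> \<in> lifted G jE"
  shows "realise_map jV jE (edge_point Ycut (coset G \<gamma>) t) = edge_point T {\<gamma>} t"
proof -
  have "jE (coset G \<gamma>) = {\<gamma>}" using assms unfolding lifted_def by blast
  then show ?thesis
    unfolding edge_point_def lifted_ends[OF assms] by (auto simp: realise_map_def)
qed

lemma cut_vertex_cases:
  assumes "v \<in> verts Ycut"
  shows "\<exists>\<gamma>\<in>lifted G jE. v = tail Ycut (coset G \<gamma>) \<or> v = head Ycut (coset G \<gamma>)"
proof -
  have "\<exists>e\<in>rcosets\<^bsub>\<Gamma>\<^esub> G. v = tail Ycut e \<or> v = head Ycut e"
    using assms C unfolding cut_graph_def by auto
  then show ?thesis using lift_edge by metis
qed

lemma points_cut: "points Ycut = (\<Union>\<gamma>\<in>lifted G jE. edge_point Ycut (coset G \<gamma>) ` {0..1})"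
proof
  show "(\<Union>\<gamma>\<in>lifted G jE. edge_point Ycut (coset G \<gamma>) ` {0..1}) \<subseteq> points Ycut"
    using edge_point_in[OF wf_cut_graph[OF wf_Ycomb]] lifted_arc by auto
  show "points Ycut \<subseteq> (\<Union>\<gamma>\<in>lifted G jE. edge_point Ycut (coset G \<gamma>) ` {0..1})"
  proof
    fix x assume "x \<in> points Ycut"
    then consider v where "v \<in> verts Ycut" "x = Inl v"
      | e t where "e \<in> rcosets\<^bsub>\<Gamma>\<^esub> G" "t \<in> {0<..<1}" "x = Inr (e, t)"
      by (auto simp: points_def)
    then show "x \<in> (\<Union>\<gamma>\<in>lifted G jE. edge_point Ycut (coset G \<gamma>) ` {0..1})"
    proof cases
      case 1
      from cut_vertex_cases[OF 1(1)] obtain \<gamma> where \<gamma>: "\<gamma> \<in> lifted G jE"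
        "v = tail Ycut (coset G \<gamma>) \<or> v = head Ycut (coset G \<gamma>)" by blast
      then have "x = edge_point Ycut (coset G \<gamma>) 0 \<or> x = edge_point Ycut (coset G \<gamma>) 1"
        using 1(2) by (simp only: edge_point_simps) blast
      moreover have "edge_point Ycut (coset G \<gamma>) t \<in> edge_point Ycut (coset G \<gamma>) ` {0..1}"
        if "t \<in> {0..1}" for t using that by (rule imageI)
      from this[of 0] this[of 1]
      have "edge_point Ycut (coset G \<gamma>) 0 \<in> edge_point Ycut (coset G \<gamma>) ` {0..1}"
        "edge_point Ycut (coset G \<gamma>) 1 \<in> edge_point Ycut (coset G \<gamma>) ` {0..1}"
        by (simp_all del: edge_point_simps)
      ultimately have "x \<in> edge_point Ycut (coset G \<gamma>) ` {0..1}" by (elim disjE) (simp_all only:)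
      then show ?thesis using \<gamma> by blast
    next
      case 2
      then obtain \<gamma> where \<gamma>: "\<gamma> \<in> lifted G jE" "coset G \<gamma> = e" using lift_edge by metis
      then have "x = edge_point Ycut (coset G \<gamma>) t" using 2 by (simp add: edge_point_def)
      then have "x \<in> edge_point Ycut (coset G \<gamma>) ` {0..1}" using 2 by auto
      then show ?thesis using \<gamma> by blast
    qed
  qed
qed

lemma image_points_cut:
  assumes f: "tree_isomorphism f"
  shows "f ` realise_map jV jE ` points Ycut = (\<Union>\<gamma>\<in>lifted G jE. act \<gamma> ` hsegment \<i> \<rho>)"
proof -
  have "f ` realise_map jV jE ` edge_point Ycut (coset G \<gamma>) ` {0..1} = act \<gamma> ` hsegment \<i> \<rho>"
    if "\<gamma> \<in> lifted G jE" for \<gamma>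
    using that tree_isomorphism_edge(1)[OF f, of \<gamma>] by (simp add: image_image realise_edge)
  then show ?thesis unfolding points_cut image_UN by (rule SUP_cong[OF refl])
qed

text \<open>A leaf of type (1) is the end of an edge whose coset is fixed by \<open>gR\<close>, and
  by \<open>lifted_rotate\<close> this means that the rotated edge is not lifted. In this form the
  leaves can be compared with the sides of the polygon.\<close>

lemma image_leaves:
  assumes f: "tree_isomorphism f"
  shows "f ` realise_map jV jE ` Inl ` {v \<in> verts Ycut. uncut v \<in> range Inr \<and> valency Ycut v = 1} =
    {act \<gamma> \<rho> |\<gamma>. \<gamma> \<in> lifted G jE \<and> \<gamma> \<odot> gR \<notin> lifted G jE}" (is "?L = ?R")
proof -
  let ?V = "{v \<in> verts Ycut. uncut v \<in> range Inr \<and> valency Ycut v = 1}"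
  have hd: "head Ycut (coset G \<gamma>) = Inl (Inr (right_orbit G1 (coset G \<gamma>)))" if "\<gamma> \<in> PSL" for \<gamma>
    using head_not_cut[OF that] by simp
  have V: "?V = {head Ycut (coset G \<gamma>) |\<gamma>. \<gamma> \<in> lifted G jE \<and> \<gamma> \<odot> gR \<notin> lifted G jE}" (is "_ = ?V'")
  proof
    show "?V \<subseteq> ?V'"
    proof
      fix v assume v: "v \<in> ?V"
      then obtain \<gamma> where \<gamma>: "\<gamma> \<in> lifted G jE" "v = tail Ycut (coset G \<gamma>) \<or> v = head Ycut (coset G \<gamma>)"
        using cut_vertex_cases by blast
      have "v \<noteq> tail Ycut (coset G \<gamma>)" using v by (auto simp: uncut_def split: if_splits)
      then have vh: "v = head Ycut (coset G \<gamma>)" using \<gamma> by blast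
      then have "valency Ycut (Inl (Inr (right_orbit G1 (coset G \<gamma>)))) = 1" using v hd \<gamma> by simp
      then have "(if coset G (\<gamma> \<odot> gR) = coset G \<gamma> then 1 else 3) = (1::nat)"
        using valency_cut_type1[OF lifted_in[OF \<gamma>(1)]] by metis
      then have "coset G (\<gamma> \<odot> gR) = coset G \<gamma>" by (rule contrapos_pp) simp
      then show "v \<in> ?V'" using vh \<gamma> lifted_rotate(1)[OF \<gamma>(1)] by blast
    qed
    show "?V' \<subseteq> ?V"
    proof
      fix v assume "v \<in> ?V'"
      then obtain \<gamma> where \<gamma>: "\<gamma> \<in> lifted G jE" "\<gamma> \<odot> gR \<notin> lifted G jE" "v = head Ycut (coset G \<gamma>)" by blast
      have "v \<in> verts Ycut" using \<gamma> wf_digraph.head_in_verts[OF wf_cut_graph[OF wf_Ycomb]] lifted_arc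
        by (metis cut_graph_simps(1) Ycomb_simps(1))
      moreover have "valency Ycut v = 1" "uncut v \<in> range Inr"
        using \<gamma> hd[of \<gamma>] valency_cut_type1[of \<gamma>] lifted_rotate(1)[OF \<gamma>(1)] by (simp_all add: uncut_def)
      ultimately show "v \<in> ?V" by blast
    qed
  qed
  have "f (realise_map jV jE (Inl (head Ycut (coset G \<gamma>)))) = act \<gamma> \<rho>" if "\<gamma> \<in> lifted G jE" for \<gamma>
    using realise_edge[OF that, of 1] tree_isomorphism_edge(2)[OF f, of \<gamma>] that
    by (simp only: edge_point_simps lifted_in)
  then have "f ` realise_map jV jE ` Inl ` ?V = (\<lambda>\<gamma>. act \<gamma> \<rho>) ` {\<gamma> \<in> lifted G jE. \<gamma> \<odot> gR \<notin> lifted G jE}"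
    unfolding V setcompr_eq_image image_image by (intro image_cong) auto
  then show ?thesis by (simp only: setcompr_eq_image)
qed

end


section \<open>The polygon\<close>

definition tiles :: "(int^2^2) set set \<Rightarrow> complex set" where
  "tiles A = (\<Union>\<gamma>\<in>A. act \<gamma> ` \<triangle>)"

lemma closure_act:
  assumes \<gamma>: "\<gamma> \<in> PSL" and S: "S \<subseteq> \<H>" and z: "z \<in> \<H>" "z \<in> closure S"
  shows "act \<gamma> z \<in> closure (act \<gamma> ` S)"
proof (rule ccontr)
  assume not: "act \<gamma> z \<notin> closure (act \<gamma> ` S)"
  define U where "U = \<H> - closure (act \<gamma> ` S)"
  have U: "open U" "U \<subseteq> \<H>" by (auto simp: U_def)
  have zU: "act \<gamma> z \<in> U" using not \<gamma> z by (simp add: U_def)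
  have "open (act (\<iota> \<gamma>) ` U)" using \<gamma> U by (intro open_act_image) auto
  moreover have "z \<in> act (\<iota> \<gamma>) ` U" using imageI[OF zU, of "act (\<iota> \<gamma>)"] \<gamma> z(1) by simp
  ultimately obtain s where s: "s \<in> S" "s \<in> act (\<iota> \<gamma>) ` U"
    using z(2) open_Int_closure_eq_empty[of "act (\<iota> \<gamma>) ` U" S] by blast
  then obtain u where u: "u \<in> U" "s = act (\<iota> \<gamma>) u" by blast
  then have "act \<gamma> s = u" using \<gamma> U by auto
  then have "u \<in> act \<gamma> ` S" using s(1) by blast
  then have "u \<in> closure (act \<gamma> ` S)" by (rule subsetD[OF closure_subset])
  then show False using u by (simp add: U_def)
qed

lemma tile_closure_interior:
  assumes "\<gamma> \<in> PSL" "z \<in> act \<gamma> ` \<triangle>" shows "z \<in> closure (act \<gamma> ` interior \<triangle>)"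
proof -
  obtain w where w: "w \<in> \<triangle>" "z = act \<gamma> w" using assms by blast
  have "interior \<triangle> \<subseteq> \<H>" using interior_subset triangle_upper by (rule subset_trans)
  from closure_act[OF assms(1) this, of w] show ?thesis
    using w triangle_closure_interior by auto
qed

lemma open_tile_interior: "\<gamma> \<in> PSL \<Longrightarrow> open (act \<gamma> ` interior \<triangle>)"
  by (rule open_act_image) (use interior_subset triangle_upper in \<open>auto intro: subsetD\<close>)

lemma open_meets_tile_interior:
  assumes "open U" "z \<in> U" "z \<in> \<H>"
  obtains \<delta> v where "\<delta> \<in> PSL" "v \<in> interior \<triangle>" "act \<delta> v \<in> U"
proof -
  obtain \<delta> where \<delta>: "\<delta> \<in> PSL" "z \<in> act \<delta> ` \<triangle>" using triangle_covers[OF assms(3)] by blast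
  then have "z \<in> closure (act \<delta> ` interior \<triangle>)" by (rule tile_closure_interior)
  then have "U \<inter> act \<delta> ` interior \<triangle> \<noteq> {}"
    using open_Int_closure_eq_empty[OF assms(1)] assms(2) by blast
  then show ?thesis using that \<delta> by blast
qed

lemma tile_interior_unique:
  assumes "\<gamma> \<in> PSL" "\<delta> \<in> PSL" "v \<in> interior \<triangle>" "act \<delta> v \<in> act \<gamma> ` \<triangle>"
  shows "\<gamma> = \<delta>"
proof -
  obtain w where w: "w \<in> \<triangle>" "act \<delta> v = act \<gamma> w" using assms by blast
  have v: "v \<in> \<triangle>" using assms interior_subset by blast
  have "act (\<iota> \<gamma> \<odot> \<delta>) v = w" using assms(1,2) v w by (simp add: act_mult)
  then have "\<iota> \<gamma> \<odot> \<delta> = \<e>" using interior_triangle_unique[OF assms(3)] assms(1,2) w(1) by simp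
  then show ?thesis using assms
    by (metis PSL.inv_equality PSL.inv_inv PSL.inv_closed)
qed

text \<open>A point of the open triangle lies neither in the half-plane nor in the wedge.\<close>

lemma one_not_word: "\<e> \<notin> wordS" "\<e> \<notin> wordR"
proof -
  obtain z where z: "z \<in> interior \<triangle>" using interior_triangle_nonempty by blast
  then have t: "z \<in> \<triangle>" using interior_subset by blast
  show "\<e> \<notin> wordS" using wordS_triangle[of \<e> z] t z by (auto simp: interior_triangle)
  show "\<e> \<notin> wordR" using wordR_triangle[of \<e> z] t z by (auto simp: interior_triangle wedge_def)
qed

text \<open>The half-planes whose intersection is the triangle. The third is the exterior of the
  circle about 1 of radius 1; writing it as a rotated copy of \<open>Re z\<close> \<ge> 1/2 lets all
  facts about vertical lines carry over.\<close>

abbreviation "side0 \<equiv> vertical_half_plane (-1) 0"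
abbreviation "side1 \<equiv> vertical_half_plane 1 (1/2)"
abbreviation "side2 \<equiv> act gR ` vertical_half_plane (-1) (-1/2)"

lemma vertical_upper: "vertical_half_plane \<sigma> c \<subseteq> \<H>"
  by (auto simp: vertical_half_plane_def)

lemma side_iff:
  "z \<in> side0 \<longleftrightarrow> z \<in> \<H> \<and> Re z \<ge> 0" "z \<in> side1 \<longleftrightarrow> z \<in> \<H> \<and> Re z \<le> 1/2"
  "z \<in> side2 \<longleftrightarrow> z \<in> \<H> \<and> 2 * Re z \<le> nsq z"
proof -
  have "- Re (act gR2 z) \<le> - (1/2) \<longleftrightarrow> 2 * Re z \<le> nsq z" if "z \<in> \<H>"
  proof -
    have "Re z / nsq z \<le> 1/2 \<longleftrightarrow> 2 * Re z \<le> nsq z" using nsq_pos[OF that] by (simp add: field_simps)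
    moreover have "- Re (act gR2 z) \<le> - (1/2) \<longleftrightarrow> Re z / nsq z \<le> 1/2"
      using conjunct1[OF gR2_coords[OF that]] by (intro iffI) linarith+
    ultimately show ?thesis by (rule trans[rotated])
  qed
  then show "z \<in> side2 \<longleftrightarrow> z \<in> \<H> \<and> 2 * Re z \<le> nsq z"
    using act_image_iff[OF gens_in(2) vertical_upper, of z "-1" "-1/2"]
    by (auto simp: vertical_half_plane_def)
qed (auto simp: vertical_half_plane_def)

text \<open>A half-plane is imposed only where \<open>A\<close> stops: at \<gamma>i the one side
  through that vertex, at \<gamma>\<rho> both sides of the tile meeting there.\<close>

definition sides :: "(int^2^2) set set \<Rightarrow> complex set set" where
  "sides A = {act \<gamma> ` D |\<gamma> D. \<gamma> \<in> A \<and> (D = side0 \<and> \<gamma> \<odot> gS \<notin> A \<or> D \<in> {side1, side2} \<and> \<gamma> \<odot> gR \<notin> A)}"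

lemma not_wordS_triangle:
  assumes "\<delta> \<in> PSL" "\<delta> \<notin> wordS" "z \<in> \<triangle>" shows "Re (act \<delta> z) \<ge> 0"
  using assms(1)
proof (cases rule: modular_word_cases)
  case 3
  then show ?thesis using wedge_Re_pos[OF wordR_triangle[OF 3 assms(3)]] by simp
qed (use assms triangle_iff in auto)

lemma not_wordR_triangle:
  assumes "\<delta> \<in> PSL" "\<delta> \<notin> wordR" "z \<in> \<triangle>"
  shows "Re (act \<delta> z) \<le> 1/2 \<and> 2 * Re (act \<delta> z) \<le> nsq (act \<delta> z)"
  using assms(1)
proof (cases rule: modular_word_cases)
  case 1 then show ?thesis using assms(3)[unfolded triangle_iff] by simp
next
  case 2
  have "nsq (act \<delta> z) > 0" using assms by (intro nsq_pos) simp
  then show ?thesis using wordS_triangle[OF 2 assms(3)] by simp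
next
  case 3 with assms show ?thesis by simp
qed

section \<open>Frontiers of half-planes and local finiteness\<close>

lemma frontier_act:
  assumes \<gamma>: "\<gamma> \<in> PSL" and D: "D \<subseteq> \<H>"
  shows "\<H> \<inter> frontier (act \<gamma> ` D) \<subseteq> act \<gamma> ` (\<H> \<inter> frontier D)"
proof
  fix z assume z: "z \<in> \<H> \<inter> frontier (act \<gamma> ` D)"
  define w where "w = act (\<iota> \<gamma>) z"
  have w: "w \<in> \<H>" "z = act \<gamma> w" using \<gamma> z by (auto simp: w_def)
  have "w \<in> frontier D"
  proof (rule ccontr)
    assume "w \<notin> frontier D"
    then consider "w \<in> interior D" | "w \<in> \<H> - closure D" using w by (auto simp: frontier_def)
    then show False
    proof cases
      case 1
      have "interior D \<subseteq> \<H>" using D interior_subset by blast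
      then have "open (act \<gamma> ` interior D)" by (intro open_act_image \<gamma>) auto
      moreover have "act \<gamma> ` interior D \<subseteq> act \<gamma> ` D" by (intro image_mono interior_subset)
      ultimately have "act \<gamma> ` interior D \<subseteq> interior (act \<gamma> ` D)" by (rule interior_maximal[rotated])
      then show False using z w(2) 1 by (auto simp: frontier_def)
    next
      case 2
      have o: "open (act \<gamma> ` (\<H> - closure D))" by (intro open_act_image \<gamma>) auto
      have "act \<gamma> ` (\<H> - closure D) \<inter> act \<gamma> ` D = act \<gamma> ` ((\<H> - closure D) \<inter> D)"
        by (rule inj_on_image_Int[OF inj_on_act[OF \<gamma>], symmetric]) (use D in auto)
      also have "(\<H> - closure D) \<inter> D = {}" using closure_subset by blast
      finally have "act \<gamma> ` (\<H> - closure D) \<inter> closure (act \<gamma> ` D) = {}"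
        using open_Int_closure_eq_empty[OF o] by simp
      then show False using z w(2) 2 by (auto simp: frontier_def)
    qed
  qed
  then show "z \<in> act \<gamma> ` (\<H> \<inter> frontier D)" using w by blast
qed

lemma frontier_vertical: "\<H> \<inter> frontier (vertical_half_plane \<sigma> c) \<subseteq> {z \<in> \<H>. \<sigma> * Re z = c}"
proof
  fix z assume z: "z \<in> \<H> \<inter> frontier (vertical_half_plane \<sigma> c)"
  have o: "open {z \<in> \<H>. \<sigma> * Re z < c}" "open {z. c < \<sigma> * Re z}"
    unfolding upper_half_plane_def mem_Collect_eq
    by (intro open_Collect_conj open_Collect_less continuous_intros)+
  have "{z \<in> \<H>. \<sigma> * Re z < c} \<subseteq> interior (vertical_half_plane \<sigma> c)"
    by (rule interior_maximal[OF _ o(1)]) (auto simp: vertical_half_plane_def)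
  moreover have "{z. c < \<sigma> * Re z} \<inter> vertical_half_plane \<sigma> c = {}"
    by (auto simp: vertical_half_plane_def)
  then have "{z. c < \<sigma> * Re z} \<inter> closure (vertical_half_plane \<sigma> c) = {}"
    using open_Int_closure_eq_empty[OF o(2)] by simp
  ultimately show "z \<in> {z \<in> \<H>. \<sigma> * Re z = c}"
    using z by (cases "\<sigma> * Re z" c rule: linorder_cases) (auto simp: frontier_def)
qed

text \<open>This line runs from \<infinity> along a side to \<rho>, on to its midpoint (1 + i)/2,
  the image of i under \<open>gR\<close>, and then symmetrically through another vertex to the cusp
  1/2. Each of the four pieces lies in one tile.\<close>

lemma half_line_tiles:
  assumes z: "z \<in> \<H>" "Re z = 1/2"
  shows "\<exists>\<gamma>\<in>{\<e>, gR, gR \<odot> gS, gR \<odot> gS \<odot> gR2}. z \<in> act \<gamma> ` \<triangle>"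
proof -
  have np: "nsq z > 0" using nsq_pos[OF z(1)] .
  consider "nsq z \<ge> 1" | "1/2 \<le> nsq z" "nsq z \<le> 1" | "nsq z < 1/2" by linarith
  then show ?thesis
  proof cases
    case 1
    then have "z \<in> \<triangle>" using z by (simp add: triangle_iff)
    then show ?thesis by (auto intro!: bexI[of _ \<e>] image_eqI[of _ _ z])
  next
    case 2
    then have "act gR2 z \<in> \<triangle>" using z by (simp add: gens_triangle_iff)
    then have "z \<in> act gR ` \<triangle>" using z by (simp add: act_image_iff[OF _ triangle_upper])
    then show ?thesis by blast
  next
    case 3
    \<comment> \<open>\<open>gR2\<close> carries the line to the unit circle and the midpoint to i,
      and \<open>gS\<close> turns the circle around i. The lower half of the line thus becomes the
      arc with \<open>Re w\<close> \<ge> 0, which passes through \<rho>.\<close>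
    define w where "w = act gS (act gR2 z)"
    have w: "w \<in> \<H>" "act gR (act gS w) = z" using z by (simp_all add: w_def flip: act_mult)
    note c = gR2_coords[OF z(1)]
    have nz: "nsq (act gR2 z) = 1" using c z(2) np by simp
    have nw: "nsq w = 1" "Re w = 1 / (2 * nsq z) - 1"
      using gS_coords[of "act gR2 z"] z nz c unfolding w_def by simp_all
    have w0: "Re w \<ge> 0" using 3 np unfolding nw(2) by (simp add: field_simps)
    show ?thesis
    proof (cases "Re w \<le> 1/2")
      case True
      then have "w \<in> \<triangle>" using w nw(1) w0 by (simp add: triangle_iff)
      moreover have "act (gR \<odot> gS) w = z" using w by (simp add: act_mult)
      ultimately show ?thesis by blast
    next
      case False
      define u where "u = act gR w"
      have x1: "Re w < 1" using nsq_pos'[OF w(1)] nw(1) by simp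
      have "Re u = (1 - Re w) / (2 * (1 - Re w))" and nu: "nsq u = 1 / (2 - 2 * Re w)"
        using gR_coords[OF w(1)] nw(1) unfolding u_def by (simp_all add: algebra_simps)
      then have "Re u = 1/2" using x1 by simp
      moreover have "1 \<le> nsq u" unfolding nu using x1 False by (simp add: le_divide_eq_1_pos)
      ultimately have "u \<in> \<triangle>" using w(1) by (simp add: triangle_iff u_def)
      moreover have "act gR2 u = w" using w(1) by (simp add: u_def flip: act_mult)
      then have "act (gR \<odot> gS \<odot> gR2) u = z" using w by (simp add: u_def act_mult)
      ultimately show ?thesis by blast
    qed
  qed
qed

text \<open>A geodesic in general meets infinitely many tiles, but the three bounding the triangle
  join cusps. Finitely many tiles covering them let local finiteness pass from tiles to
  sides.\<close>

lemma side_frontier_tiles: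
  "\<exists>F. finite F \<and> F \<subseteq> PSL \<and> (\<forall>D\<in>{side0, side1, side2}. \<H> \<inter> frontier D \<subseteq> tiles F)"
proof -
  define F where "F = {\<e>, gR, gR \<odot> gS, gR \<odot> gS \<odot> gR2}"
  define F' where "F' = F \<union> (\<lambda>x. gR \<odot> x) ` F"
  have F: "finite F'" "F' \<subseteq> PSL" "F \<subseteq> PSL" by (auto simp: F'_def F_def)
  have line: "{z \<in> \<H>. Re z = 1/2} \<subseteq> tiles F"
  proof
    fix z assume "z \<in> {z \<in> \<H>. Re z = 1/2}"
    then have "\<exists>\<gamma>\<in>F. z \<in> act \<gamma> ` \<triangle>" unfolding F_def by (intro half_line_tiles) auto
    then show "z \<in> tiles F" by (simp add: tiles_def)
  qed
  have "\<H> \<inter> frontier side0 \<subseteq> {z \<in> \<H>. Re z = 0}" using frontier_vertical[of "-1" 0] by auto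
  also have "\<dots> \<subseteq> \<triangle>"
  proof
    fix z assume "z \<in> {z \<in> \<H>. Re z = 0}"
    then show "z \<in> \<triangle>" using nsq_pos[of z] by (simp add: triangle_iff)
  qed
  also have "\<dots> \<subseteq> tiles F'"
    unfolding tiles_def F'_def F_def by (auto intro!: image_eqI[of _ _ _ \<triangle>])
  finally have 0: "\<H> \<inter> frontier side0 \<subseteq> tiles F'" .
  have "\<H> \<inter> frontier side1 \<subseteq> {z \<in> \<H>. Re z = 1/2}" using frontier_vertical[of 1 "1/2"] by auto
  also have "\<dots> \<subseteq> tiles F'" using line unfolding tiles_def F'_def by blast
  finally have 1: "\<H> \<inter> frontier side1 \<subseteq> tiles F'" .
  have "\<H> \<inter> frontier side2 \<subseteq> act gR ` (\<H> \<inter> frontier (vertical_half_plane (-1) (-1/2)))"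
    by (intro frontier_act vertical_upper) simp
  also have "\<dots> \<subseteq> act gR ` {z \<in> \<H>. Re z = 1/2}"
    using frontier_vertical[of "-1" "-1/2"] by (intro image_mono) auto
  also have "\<dots> \<subseteq> act gR ` tiles F" using line by (rule image_mono)
  also have "\<dots> \<subseteq> tiles F'"
  proof -
    have "act gR ` act x ` \<triangle> = act (gR \<odot> x) ` \<triangle>" if "x \<in> F" for x
      using act_image_mult[of gR x \<triangle>] that F(3) triangle_upper by auto
    then show ?thesis unfolding tiles_def F'_def image_UN by auto
  qed
  finally have 2: "\<H> \<inter> frontier side2 \<subseteq> tiles F'" .
  show ?thesis using 0 1 2 F by blast
qed

lemma side_upper: "D \<in> {side0, side1, side2} \<Longrightarrow> D \<subseteq> \<H>"
  using side_iff by blast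

lemma sides_cases:
  assumes "D \<in> sides A"
  obtains \<gamma> D0 where "\<gamma> \<in> A" "D0 \<in> {side0, side1, side2}" "D = act \<gamma> ` D0"
  using assms unfolding sides_def by blast

text \<open>If the boundary of the copy of a side under \<gamma> comes near z, then so does a tile
  \<gamma>x with x from a fixed finite set. Such products are finite in number, and \<gamma> is
  recovered from the product and x.\<close>

lemma sides_locally_finite:
  assumes A: "A \<subseteq> PSL"
  shows "locally_finite_in (top_of_set \<H>) ((\<lambda>D. \<H> \<inter> frontier D) ` sides A)"
  unfolding locally_finite_in_def
proof (intro conjI ballI)
  show "\<Union> ((\<lambda>D. \<H> \<inter> frontier D) ` sides A) \<subseteq> topspace (top_of_set \<H>)" by auto
  fix z assume "z \<in> topspace (top_of_set \<H>)"
  then have zH: "z \<in> \<H>" by simp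
  obtain U where U: "open U" "z \<in> U" "U \<subseteq> \<H>" and fin: "finite {\<gamma> \<in> PSL. act \<gamma> ` \<triangle> \<inter> U \<noteq> {}}" (is "finite ?N")
    by (rule triangles_locally_finite[OF zH])
  obtain F where F: "finite F" "F \<subseteq> PSL" "\<And>D. D \<in> {side0, side1, side2} \<Longrightarrow> \<H> \<inter> frontier D \<subseteq> tiles F"
    using side_frontier_tiles by blast
  let ?M = "(\<lambda>(n, x, D). \<H> \<inter> frontier (act (n \<odot> \<iota> x) ` D)) ` (?N \<times> F \<times> {side0, side1, side2})"
  have "{V \<in> (\<lambda>D. \<H> \<inter> frontier D) ` sides A. V \<inter> U \<noteq> {}} \<subseteq> ?M"
  proof
    fix V assume "V \<in> {V \<in> (\<lambda>D. \<H> \<inter> frontier D) ` sides A. V \<inter> U \<noteq> {}}"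
    then obtain D u where D: "D \<in> sides A" "V = \<H> \<inter> frontier D" and u: "u \<in> \<H> \<inter> frontier D" "u \<in> U" by blast
    obtain \<gamma> D0 where \<gamma>: "\<gamma> \<in> A" and D0: "D0 \<in> {side0, side1, side2}" "D = act \<gamma> ` D0"
      using D(1) by (rule sides_cases)
    have \<gamma>\<Gamma>: "\<gamma> \<in> PSL" using \<gamma> A by blast
    have "u \<in> act \<gamma> ` (\<H> \<inter> frontier D0)"
      using frontier_act[OF \<gamma>\<Gamma> side_upper[OF D0(1)]] u(1) unfolding D0(2) by blast
    then have "u \<in> act \<gamma> ` tiles F" using F(3)[OF D0(1)] by blast
    then obtain x w where x: "x \<in> F" "w \<in> \<triangle>" "u = act \<gamma> (act x w)" unfolding tiles_def by blast
    have x\<Gamma>: "x \<in> PSL" using x F by blast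
    have "u = act (\<gamma> \<odot> x) w" using x \<gamma>\<Gamma> x\<Gamma> by (simp add: act_mult)
    then have "\<gamma> \<odot> x \<in> ?N" using x u \<gamma>\<Gamma> x\<Gamma> by auto
    moreover have "\<gamma> = (\<gamma> \<odot> x) \<odot> \<iota> x" using \<gamma>\<Gamma> x\<Gamma> by (simp add: PSL.m_assoc)
    then have "V = (\<lambda>(n, x, D). \<H> \<inter> frontier (act (n \<odot> \<iota> x) ` D)) (\<gamma> \<odot> x, x, D0)" using D(2) D0(2) by simp
    ultimately show "V \<in> ?M" using x(1) D0(1) by blast
  qed
  moreover have "finite ?M" using fin F(1) by blast
  ultimately have "finite {V \<in> (\<lambda>D. \<H> \<inter> frontier D) ` sides A. V \<inter> U \<noteq> {}}" by (rule finite_subset)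
  then show "\<exists>V. openin (top_of_set \<H>) V \<and> z \<in> V \<and> finite {W \<in> (\<lambda>D. \<H> \<inter> frontier D) ` sides A. W \<inter> V \<noteq> {}}"
    using U open_subset by blast
qed

lemma side_props:
  assumes "D \<in> {side0, side1, side2}"
  shows "closed_half_plane D" "hconvex D" "closedin (top_of_set \<H>) D"
proof -
  have cl: "closedin (top_of_set \<H>) (vertical_half_plane \<sigma> c)" for \<sigma> c
  proof -
    have "closed {z. \<sigma> * Re z \<le> c}" by (intro closed_Collect_le continuous_intros)
    moreover have "vertical_half_plane \<sigma> c = \<H> \<inter> {z. \<sigma> * Re z \<le> c}" by (auto simp: vertical_half_plane_def)
    ultimately show ?thesis by (simp add: closedin_closed_Int)
  qed
  show "closed_half_plane D" "hconvex D" "closedin (top_of_set \<H>) D"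
    using assms closed_half_plane_vertical hconvex_vertical cl
    by (auto intro!: closed_half_plane_act hconvex_act closedin_act_image)
qed

lemma sides_props:
  assumes "A \<subseteq> PSL" "D \<in> sides A"
  shows "closed_half_plane D" "hconvex D" "closedin (top_of_set \<H>) D"
proof -
  obtain \<gamma> D0 where *: "\<gamma> \<in> A" "D0 \<in> {side0, side1, side2}" "D = act \<gamma> ` D0"
    using assms(2) by (rule sides_cases)
  then have "\<gamma> \<in> PSL" using assms by blast
  then show "closed_half_plane D" "hconvex D" "closedin (top_of_set \<H>) D"
    using side_props[OF *(2)] *(3) closed_half_plane_act hconvex_act closedin_act_image by simp_all
qed

text \<open>What the polygon needs to know about the lifted tree. \<open>A_induct\<close> is its
  connectedness; \<open>A_rotate\<close> says that at a vertex of type (1) an edge of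
  \<open>A\<close> is accompanied by both other edges or by neither.\<close>

locale edge_subtree =
  fixes A :: "(int^2^2) set set"
  assumes A_in: "A \<subseteq> PSL" and A_nonempty: "A \<noteq> {}"
    and A_rotate: "\<And>\<gamma>. \<gamma> \<in> A \<Longrightarrow> \<gamma> \<odot> gR \<in> A \<longleftrightarrow> \<gamma> \<odot> gR2 \<in> A"
    and A_induct: "\<And>P \<gamma>0 \<gamma>. \<gamma>0 \<in> A \<Longrightarrow> \<gamma> \<in> A \<Longrightarrow> P \<gamma>0 \<Longrightarrow>
      (\<And>\<delta> x. \<delta> \<in> A \<Longrightarrow> P \<delta> \<Longrightarrow> x \<in> {gS, gR, gR2} \<Longrightarrow> \<delta> \<odot> x \<in> A \<Longrightarrow> P (\<delta> \<odot> x)) \<Longrightarrow> P \<gamma>"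
begin

lemma A_modular: "\<gamma> \<in> A \<Longrightarrow> \<gamma> \<in> PSL"
  using A_in by blast

lemma inv_mult_one: "\<gamma> \<in> PSL \<Longrightarrow> \<delta> \<in> PSL \<Longrightarrow> \<iota> \<gamma> \<odot> \<delta> = \<e> \<Longrightarrow> \<delta> = \<gamma>"
  by (metis PSL.inv_equality PSL.inv_inv PSL.inv_closed)

text \<open>Along a path inside \<open>A\<close> the word relative to \<gamma> changes by a letter
  on the right. It can begin to start with \<open>gS\<close> only on the step from \<gamma> to
  \<gamma>\<open>gS\<close>, which leaves \<open>A\<close>.\<close>

lemma not_wordS_component:
  assumes \<gamma>: "\<gamma> \<in> A" "\<gamma> \<odot> gS \<notin> A" and \<delta>: "\<delta> \<in> A"
  shows "\<iota> \<gamma> \<odot> \<delta> \<notin> wordS"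
proof (rule A_induct[OF \<gamma>(1) \<delta>])
  show "\<iota> \<gamma> \<odot> \<gamma> \<notin> wordS" using A_modular[OF \<gamma>(1)] one_not_word by simp
next
  fix \<delta> x assume \<delta>: "\<delta> \<in> A" and y: "\<iota> \<gamma> \<odot> \<delta> \<notin> wordS" and x: "x \<in> {gS, gR, gR2}" and \<delta>x: "\<delta> \<odot> x \<in> A"
  have in_\<Gamma>: "\<gamma> \<in> PSL" "\<delta> \<in> PSL" "x \<in> PSL" using A_modular \<gamma> \<delta> x by auto
  define y where "y = \<iota> \<gamma> \<odot> \<delta>"
  have y\<Gamma>: "y \<in> PSL" and yx: "\<iota> \<gamma> \<odot> (\<delta> \<odot> x) = y \<odot> x" using in_\<Gamma> by (simp_all add: y_def PSL.m_assoc)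
  have "y \<odot> x \<notin> wordS"
  proof
    assume w: "y \<odot> x \<in> wordS"
    from x consider "x = gS" | "x = gR" | "x = gR2" by blast
    then show False
    proof cases
      case 1
      have "y \<odot> gS = gS" using wordS_right_mult(1)[OF w] y y\<Gamma> 1 by (auto simp flip: y_def)
      then have "y = \<e>" using y\<Gamma> by (metis gens_in(1) gens_mult(1) gens_mult_assoc(6))
      then have "\<delta> = \<gamma>" using inv_mult_one in_\<Gamma> by (simp add: y_def)
      then show False using \<delta>x \<gamma> 1 by simp
    next
      case 2 then show False using wordS_right_mult(3)[OF w] y y\<Gamma> by (simp flip: y_def)
    next
      case 3 then show False using wordS_right_mult(2)[OF w] y y\<Gamma> by (simp flip: y_def)
    qed
  qed
  then show "\<iota> \<gamma> \<odot> (\<delta> \<odot> x) \<notin> wordS" by (simp add: yx)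
qed

text \<open>Here there are two entrances, \<gamma>\<open>gR\<close> and \<gamma>\<open>gR2\<close>;
  the first is excluded by hypothesis and the second by \<open>A_rotate\<close>.\<close>

lemma not_wordR_component:
  assumes \<gamma>: "\<gamma> \<in> A" "\<gamma> \<odot> gR \<notin> A" and \<delta>: "\<delta> \<in> A"
  shows "\<iota> \<gamma> \<odot> \<delta> \<notin> wordR"
proof (rule A_induct[OF \<gamma>(1) \<delta>])
  show "\<iota> \<gamma> \<odot> \<gamma> \<notin> wordR" using A_modular[OF \<gamma>(1)] one_not_word by simp
next
  fix \<delta> x assume \<delta>: "\<delta> \<in> A" and y: "\<iota> \<gamma> \<odot> \<delta> \<notin> wordR" and x: "x \<in> {gS, gR, gR2}" and \<delta>x: "\<delta> \<odot> x \<in> A"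
  have in_\<Gamma>: "\<gamma> \<in> PSL" "\<delta> \<in> PSL" "x \<in> PSL" using A_modular \<gamma> \<delta> x by auto
  define y where "y = \<iota> \<gamma> \<odot> \<delta>"
  have y\<Gamma>: "y \<in> PSL" and yx: "\<iota> \<gamma> \<odot> (\<delta> \<odot> x) = y \<odot> x" using in_\<Gamma> by (simp_all add: y_def PSL.m_assoc)
  have "y \<odot> x \<notin> wordR"
  proof
    assume w: "y \<odot> x \<in> wordR"
    have stay: "y \<noteq> \<e>" if "x \<noteq> gS"
    proof
      assume "y = \<e>"
      then have "\<delta> = \<gamma>" using inv_mult_one in_\<Gamma> by (simp add: y_def)
      then show False using \<delta>x \<gamma> A_rotate[OF \<gamma>(1)] x that by auto
    qed
    from x consider "x = gS" | "x = gR" | "x = gR2" by blast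
    then show False
    proof cases
      case 1 then show False using wordR_right_mult(1)[OF w] y y\<Gamma> by (simp flip: y_def)
    next
      case 2
      then have "y \<odot> gR = gR" using wordR_right_mult(3)[OF w] y y\<Gamma> by (simp flip: y_def)
      then have "y = \<e>" using y\<Gamma> by (metis gens_in(2) gens_mult(3) gens_mult_assoc(8))
      then show False using stay 2 by simp
    next
      case 3
      then have "y \<odot> gR2 = gR2" using wordR_right_mult(2)[OF w] y y\<Gamma> by (simp flip: y_def)
      then have "y = \<e>" using y\<Gamma> by (metis gens_in(3) gens_mult(4) gens_mult_assoc(9))
      then show False using stay 3 by simp
    qed
  qed
  then show "\<iota> \<gamma> \<odot> (\<delta> \<odot> x) \<notin> wordR" by (simp add: yx)
qed

lemma tiles_upper: "tiles A \<subseteq> \<H>"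
  unfolding tiles_def using A_modular by auto

lemma tiles_subset_side:
  assumes "D \<in> sides A" shows "tiles A \<subseteq> D"
proof
  fix z assume "z \<in> tiles A"
  then obtain \<delta> w where \<delta>: "\<delta> \<in> A" and w: "w \<in> \<triangle>" "z = act \<delta> w" by (auto simp: tiles_def)
  obtain \<gamma> D0 where \<gamma>: "\<gamma> \<in> A" and D: "D = act \<gamma> ` D0"
    and D0: "D0 = side0 \<and> \<gamma> \<odot> gS \<notin> A \<or> D0 \<in> {side1, side2} \<and> \<gamma> \<odot> gR \<notin> A"
    using assms unfolding sides_def by blast
  have in_\<Gamma>: "\<gamma> \<in> PSL" "\<delta> \<in> PSL" using A_modular \<gamma> \<delta> by auto
  define u where "u = act (\<iota> \<gamma> \<odot> \<delta>) w"
  have u: "u \<in> \<H>" "z = act \<gamma> u" using in_\<Gamma> w by (simp_all add: u_def act_mult)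
  have y: "\<iota> \<gamma> \<odot> \<delta> \<in> PSL" using in_\<Gamma> by simp
  have "u \<in> D0"
    using D0
  proof
    assume *: "D0 = side0 \<and> \<gamma> \<odot> gS \<notin> A"
    then have "Re u \<ge> 0"
      unfolding u_def using not_wordS_triangle[OF y not_wordS_component[OF \<gamma> _ \<delta>] w(1)] by blast
    then show ?thesis using * u side_iff(1) by blast
  next
    assume *: "D0 \<in> {side1, side2} \<and> \<gamma> \<odot> gR \<notin> A"
    then have "Re u \<le> 1/2 \<and> 2 * Re u \<le> nsq u"
      unfolding u_def using not_wordR_triangle[OF y not_wordR_component[OF \<gamma> _ \<delta>] w(1)] by blast
    then show ?thesis using * u side_iff(2,3)[of u] by blast
  qed
  then show "z \<in> D" using D u by blast
qed

text \<open>A walk from \<open>A\<close> to \<delta> keeps the edge \<gamma> where it left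
  \<open>A\<close> and the word travelled since. If this word cancels, the walk is back at \<gamma>
  in \<open>A\<close>; otherwise its first letter still names the end of \<gamma> through which it
  left.\<close>

lemma outside_cases:
  assumes "\<delta> \<in> PSL"
  shows "\<delta> \<in> A \<or> (\<exists>\<gamma>\<in>A. \<gamma> \<odot> gS \<notin> A \<and> (\<exists>y\<in>wordS. \<delta> = \<gamma> \<odot> y)) \<or>
    (\<exists>\<gamma>\<in>A. \<gamma> \<odot> gR \<notin> A \<and> (\<exists>y\<in>wordR. \<delta> = \<gamma> \<odot> y))"
proof -
  define P where "P \<delta> \<longleftrightarrow> \<delta> \<in> A \<or> (\<exists>\<gamma>\<in>A. \<gamma> \<odot> gS \<notin> A \<and> (\<exists>y\<in>wordS. \<delta> = \<gamma> \<odot> y)) \<or>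
    (\<exists>\<gamma>\<in>A. \<gamma> \<odot> gR \<notin> A \<and> (\<exists>y\<in>wordR. \<delta> = \<gamma> \<odot> y))" for \<delta>
  have step: "P (\<delta> \<odot> x)" if \<delta>: "P \<delta>" "\<delta> \<in> PSL" and x: "x \<in> {gS, gR, gR2}" for \<delta> x
  proof -
    from \<delta>(1) consider "\<delta> \<in> A"
      | \<gamma> y where "\<gamma> \<in> A" "\<gamma> \<odot> gS \<notin> A" "y \<in> wordS" "\<delta> = \<gamma> \<odot> y"
      | \<gamma> y where "\<gamma> \<in> A" "\<gamma> \<odot> gR \<notin> A" "y \<in> wordR" "\<delta> = \<gamma> \<odot> y"
      unfolding P_def by blast
    then show ?thesis
    proof cases
      case 1
      show ?thesis
      proof (cases "\<delta> \<odot> x \<in> A")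
        case False
        from x consider "x = gS" | "x = gR" | "x = gR2" by blast
        then show ?thesis
        proof cases
          case 1 then show ?thesis unfolding P_def using False \<open>\<delta> \<in> A\<close> wordS_wordR.S by blast
        next
          case 2 then show ?thesis unfolding P_def using False \<open>\<delta> \<in> A\<close> wordS_wordR.R by blast
        next
          case 3 then show ?thesis unfolding P_def using False \<open>\<delta> \<in> A\<close> A_rotate wordS_wordR.R2 by blast
        qed
      qed (simp add: P_def)
    next
      case (2 \<gamma> y)
      have \<gamma>: "\<gamma> \<in> PSL" using A_modular 2 by blast
      have yx: "\<delta> \<odot> x = \<gamma> \<odot> (y \<odot> x)" using 2 \<gamma> x by (auto simp: PSL.m_assoc)
      have "y \<odot> x \<in> wordS \<or> y \<odot> x = \<e>" using x wordS_right_mult[OF 2(3)] by auto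
      then show ?thesis
      proof
        assume "y \<odot> x \<in> wordS" then show ?thesis unfolding P_def yx using 2 by blast
      next
        assume "y \<odot> x = \<e>" then show ?thesis unfolding P_def yx using 2 \<gamma> by simp
      qed
    next
      case (3 \<gamma> y)
      have \<gamma>: "\<gamma> \<in> PSL" using A_modular 3 by blast
      have yx: "\<delta> \<odot> x = \<gamma> \<odot> (y \<odot> x)" using 3 \<gamma> x by (auto simp: PSL.m_assoc)
      have "y \<odot> x \<in> wordR \<or> y \<odot> x = \<e>" using x wordR_right_mult[OF 3(3)] by auto
      then show ?thesis
      proof
        assume "y \<odot> x \<in> wordR" then show ?thesis unfolding P_def yx using 3 by blast
      next
        assume "y \<odot> x = \<e>" then show ?thesis unfolding P_def yx using 3 \<gamma> by simp
      qed
    qed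
  qed
  obtain \<gamma>0 where \<gamma>0: "\<gamma>0 \<in> A" using A_nonempty by blast
  have g0: "\<gamma>0 \<in> PSL" by (rule A_modular[OF \<gamma>0])
  have "P (\<gamma>0 \<odot> \<eta>)" if "\<eta> \<in> PSL" for \<eta>
    using that
  proof (induction rule: modular_right_induct)
    case one then show ?case using \<gamma>0 g0 by (simp add: P_def)
  next
    case (step \<eta> x)
    then have "P (\<gamma>0 \<odot> \<eta> \<odot> x)" using g0 \<open>\<And>\<delta> x. P \<delta> \<Longrightarrow> \<delta> \<in> PSL \<Longrightarrow> x \<in> {gS, gR, gR2} \<Longrightarrow> P (\<delta> \<odot> x)\<close> by simp
    moreover have "x \<in> PSL" using step by auto
    ultimately show ?case using g0 step by (simp add: PSL.m_assoc)
  qed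
  from this[of "\<iota> \<gamma>0 \<odot> \<delta>"] have "P \<delta>" using g0 assms by (simp flip: PSL.m_assoc)
  then show ?thesis by (simp add: P_def)
qed

text \<open>A tile outside \<open>A\<close> lies beyond some end of an edge \<gamma> of
  \<open>A\<close>, in the ping-pong region opposite the sides imposed there. A point of it
  satisfying these sides is forced into the tile of \<gamma>.\<close>

lemma tiles_eq_sides: "tiles A = \<H> \<inter> \<Inter>(sides A)"
proof
  show "tiles A \<subseteq> \<H> \<inter> \<Inter>(sides A)" using tiles_subset_side tiles_upper by blast
  show "\<H> \<inter> \<Inter>(sides A) \<subseteq> tiles A"
  proof
    fix z assume z: "z \<in> \<H> \<inter> \<Inter>(sides A)"
    obtain \<delta> w where \<delta>: "\<delta> \<in> PSL" and w: "w \<in> \<triangle>" "z = act \<delta> w"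
      using z by (auto elim: upper_triangle_cases)
    from outside_cases[OF \<delta>] consider "\<delta> \<in> A"
      | \<gamma> y where "\<gamma> \<in> A" "\<gamma> \<odot> gS \<notin> A" "y \<in> wordS" "\<delta> = \<gamma> \<odot> y"
      | \<gamma> y where "\<gamma> \<in> A" "\<gamma> \<odot> gR \<notin> A" "y \<in> wordR" "\<delta> = \<gamma> \<odot> y"
      by blast
    then show "z \<in> tiles A"
    proof cases
      case 1 then show ?thesis using w by (auto simp: tiles_def)
    next
      case (2 \<gamma> y)
      have \<gamma>: "\<gamma> \<in> PSL" using A_modular 2 by blast
      define u where "u = act y w"
      have u: "u \<in> \<H>" "z = act \<gamma> u" using w 2 \<gamma> by (simp_all add: u_def act_mult)
      have "act \<gamma> ` side0 \<in> sides A" unfolding sides_def using 2 by blast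
      then have "z \<in> act \<gamma> ` side0" using z by blast
      then have "act (\<iota> \<gamma>) z \<in> side0" using act_image_iff[OF \<gamma> vertical_upper] by blast
      then have "Re u \<ge> 0" using u \<gamma> by (simp add: side_iff)
      moreover have "Re u \<le> 0" unfolding u_def by (rule wordS_triangle[OF 2(3) w(1)])
      ultimately have "u \<in> \<triangle>" using u nsq_pos[OF u(1)] by (simp add: triangle_iff)
      then show ?thesis using u 2 by (auto simp: tiles_def)
    next
      case (3 \<gamma> y)
      have \<gamma>: "\<gamma> \<in> PSL" using A_modular 3 by blast
      define u where "u = act y w"
      have u: "u \<in> \<H>" "z = act \<gamma> u" using w 3 \<gamma> by (simp_all add: u_def act_mult)
      have "act \<gamma> ` side1 \<in> sides A" "act \<gamma> ` side2 \<in> sides A" unfolding sides_def using 3 by blast+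
      then have "z \<in> act \<gamma> ` side1" "z \<in> act \<gamma> ` side2" using z by blast+
      moreover have "side1 \<subseteq> \<H>" "side2 \<subseteq> \<H>" by (rule side_upper; blast)+
      ultimately have "act (\<iota> \<gamma>) z \<in> side1" "act (\<iota> \<gamma>) z \<in> side2"
        using act_image_iff[OF \<gamma>] by metis+
      then have "Re u \<le> 1/2 \<and> 2 * Re u \<le> nsq u" using u \<gamma> side_iff by simp
      moreover have "Re u > 0" unfolding u_def by (rule wedge_Re_pos[OF wordR_triangle[OF 3(3) w(1)]])
      ultimately have "u \<in> \<triangle>" using u by (simp add: triangle_iff)
      then show ?thesis using u 3 by (auto simp: tiles_def)
    qed
  qed
qed

section \<open>Regularity, convexity and the fundamental domain\<close>

lemma closedin_tiles: "closedin (top_of_set \<H>) (tiles A)"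
proof (cases "sides A = {}")
  case True
  then show ?thesis by (simp add: tiles_eq_sides)
next
  case False
  then have "closedin (top_of_set \<H>) (\<Inter>(sides A))"
    using sides_props(3)[OF A_in] by (intro closedin_Inter) auto
  moreover have "closedin (top_of_set \<H>) \<H>" by simp
  ultimately show ?thesis unfolding tiles_eq_sides by (rule closedin_Int[rotated])
qed

lemma tile_interior_subset: "\<gamma> \<in> A \<Longrightarrow> act \<gamma> ` interior \<triangle> \<subseteq> interior (tiles A)"
  by (rule interior_maximal[OF _ open_tile_interior[OF A_modular]])
     (use interior_subset in \<open>auto simp: tiles_def\<close>)

lemma tiles_subset_closure:
  assumes "\<And>\<gamma>. \<gamma> \<in> A \<Longrightarrow> act \<gamma> ` interior \<triangle> \<subseteq> S"
  shows "tiles A \<subseteq> closure S"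
proof
  fix z assume "z \<in> tiles A"
  then obtain \<gamma> where \<gamma>: "\<gamma> \<in> A" "z \<in> act \<gamma> ` \<triangle>" by (auto simp: tiles_def)
  then have "z \<in> closure (act \<gamma> ` interior \<triangle>)" using tile_closure_interior A_modular by blast
  then show "z \<in> closure S" using closure_mono[OF assms[OF \<gamma>(1)]] by blast
qed

lemma closure_subset_tiles:
  assumes "S \<subseteq> tiles A" shows "\<H> \<inter> closure S \<subseteq> tiles A"
proof -
  obtain K where K: "closed K" "tiles A = \<H> \<inter> K" using closedin_tiles by (auto simp: closedin_closed)
  then have "closure S \<subseteq> K" using assms by (intro closure_minimal) auto
  then show ?thesis using K by blast
qed

lemma tiles_regular: "tiles A = \<H> \<inter> closure (interior (tiles A))"
  using tiles_subset_closure[OF tile_interior_subset] tiles_upper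
    closure_subset_tiles[OF interior_subset] by blast

lemma interior_tiles_nonempty: "interior (tiles A) \<noteq> {}"
  using A_nonempty tile_interior_subset interior_triangle_nonempty by blast

lemma convex_polygon_tiles: "convex_hyperbolic_polygon (tiles A)"
proof -
  have "hconvex (tiles A)"
    unfolding hconvex_def
  proof (intro conjI ballI)
    show "tiles A \<subseteq> \<H>" by (rule tiles_upper)
    fix z w assume zw: "z \<in> tiles A" "w \<in> tiles A"
    have "hsegment z w \<subseteq> D" if "D \<in> sides A" for D
      using sides_props(2)[OF A_in that] zw tiles_subset_side[OF that] unfolding hconvex_def by blast
    moreover have "hsegment z w \<subseteq> \<H>" by (auto simp: hsegment_def)
    ultimately show "hsegment z w \<subseteq> tiles A" unfolding tiles_eq_sides by blast
  qed
  then show ?thesis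
    unfolding convex_hyperbolic_polygon_def
    using interior_tiles_nonempty sides_props(1)[OF A_in] sides_locally_finite[OF A_in] tiles_eq_sides by blast
qed

text \<open>A transversal of the cosets gives both halves: existence moves every tile into the
  polygon, and an open overlap would contain an interior point of a tile, whose label is unique, so
  two representatives would share a coset.\<close>

lemma fundamental_domain_tiles:
  assumes G: "subgroup G \<Gamma>"
    and ex: "\<And>\<delta>. \<delta> \<in> PSL \<Longrightarrow> \<exists>\<gamma>\<in>A. coset G \<gamma> = coset G \<delta>"
    and unique: "\<And>\<gamma> \<delta>. \<gamma> \<in> A \<Longrightarrow> \<delta> \<in> A \<Longrightarrow> coset G \<gamma> = coset G \<delta> \<Longrightarrow> \<gamma> = \<delta>"
  shows "fundamental_domain G (tiles A)"
  unfolding fundamental_domain_def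
proof (intro conjI ballI impI)
  have G_sub: "G \<subseteq> PSL" by (rule subgroup.subset[OF G])
  show "tiles A = \<H> \<inter> closure (interior (tiles A))" by (rule tiles_regular)
  show "interior (tiles A) \<noteq> {}" by (rule interior_tiles_nonempty)
  show "(\<Union>\<gamma>\<in>G. act \<gamma> ` tiles A) = \<H>"
  proof
    show "(\<Union>\<gamma>\<in>G. act \<gamma> ` tiles A) \<subseteq> \<H>" using G_sub tiles_upper by (auto intro!: act_in)
    show "\<H> \<subseteq> (\<Union>\<gamma>\<in>G. act \<gamma> ` tiles A)"
    proof
      fix z assume "z \<in> \<H>"
      then obtain \<delta> w where \<delta>: "\<delta> \<in> PSL" and w: "w \<in> \<triangle>" "z = act \<delta> w" by (rule upper_triangle_cases)
      obtain \<gamma> where \<gamma>: "\<gamma> \<in> A" "coset G \<gamma> = coset G \<delta>" using ex[OF \<delta>] by blast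
      then obtain g where g: "g \<in> G" "\<delta> = g \<odot> \<gamma>" using coset_eq_iff[OF G A_modular[OF \<gamma>(1)] \<delta>] by blast
      then have "z = act g (act \<gamma> w)" using w G_sub A_modular[OF \<gamma>(1)] by (auto simp: act_mult)
      then show "z \<in> (\<Union>\<gamma>\<in>G. act \<gamma> ` tiles A)" using g(1) \<gamma>(1) w by (auto simp: tiles_def)
    qed
  qed
  fix g assume g: "g \<in> G" "g \<noteq> \<e>"
  have g\<Gamma>: "g \<in> PSL" using g G_sub by blast
  show "interior (tiles A) \<inter> act g ` interior (tiles A) = {}"
  proof (rule ccontr)
    assume "interior (tiles A) \<inter> act g ` interior (tiles A) \<noteq> {}"
    then obtain z where z: "z \<in> interior (tiles A) \<inter> act g ` interior (tiles A)" by blast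
    have sub: "interior (tiles A) \<subseteq> \<H>" using interior_subset tiles_upper by (rule subset_trans)
    have "open (interior (tiles A) \<inter> act g ` interior (tiles A))"
      using sub by (intro open_Int open_interior open_act_image g\<Gamma>)
    then obtain \<delta> v where \<delta>: "\<delta> \<in> PSL" "v \<in> interior \<triangle>"
      and m: "act \<delta> v \<in> interior (tiles A) \<inter> act g ` interior (tiles A)"
      using z sub by (elim open_meets_tile_interior[of _ z]) auto
    then have "act \<delta> v \<in> tiles A" "act \<delta> v \<in> act g ` tiles A" using interior_subset by blast+
    then obtain \<gamma> \<gamma>' where \<gamma>: "\<gamma> \<in> A" "act \<delta> v \<in> act \<gamma> ` \<triangle>"
      and \<gamma>': "\<gamma>' \<in> A" "act \<delta> v \<in> act g ` act \<gamma>' ` \<triangle>" unfolding tiles_def by blast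
    have "\<gamma> = \<delta>" using tile_interior_unique[OF A_modular[OF \<gamma>(1)] \<delta> \<gamma>(2)] .
    moreover have "g \<odot> \<gamma>' = \<delta>"
      using tile_interior_unique[of "g \<odot> \<gamma>'" \<delta> v] \<delta> \<gamma>' g\<Gamma> A_modular[OF \<gamma>'(1)]
        act_image_mult[OF g\<Gamma> A_modular[OF \<gamma>'(1)] triangle_upper] by simp
    ultimately have eq: "\<gamma> = g \<odot> \<gamma>'" by simp
    then have "coset G \<gamma>' = coset G \<gamma>"
      using coset_eq_iff[OF G A_modular[OF \<gamma>'(1)] A_modular[OF \<gamma>(1)]] g(1) by blast
    then have "\<gamma>' = \<gamma>" using unique \<gamma> \<gamma>' by blast
    then have "g = \<e>" using eq g\<Gamma> A_modular[OF \<gamma>(1)] by (metis PSL.r_cancel_one)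
    then show False using g by simp
  qed
qed

text \<open>The preimage exceeds the tiles only by fibres over vertices \<gamma>\<rho> where
  \<open>A\<close> stops. These lie on sides of tiles, so they contribute no interior.\<close>

lemma retraction_preimage:
  assumes p: "equivariant_retraction p" "adapted p"
  defines "P \<equiv> {z \<in> \<H>. p z \<in> (\<Union>\<gamma>\<in>A. act \<gamma> ` hsegment \<i> \<rho>)}"
  shows "\<H> \<inter> closure (interior P) = tiles A"
    and "P = tiles A \<union> {z \<in> \<H>. p z \<in> {act \<gamma> \<rho> |\<gamma>. \<gamma> \<in> A \<and> \<gamma> \<odot> gR \<notin> A}}"
proof -
  note edge_iff = retr_in_edge_iff[OF p]
  have P_tiles: "tiles A \<subseteq> P"
  proof
    fix z assume z: "z \<in> tiles A"
    then obtain \<gamma> where \<gamma>: "\<gamma> \<in> A" "z \<in> act \<gamma> ` \<triangle>" by (auto simp: tiles_def)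
    have zH: "z \<in> \<H>" using z tiles_upper by blast
    then have "p z \<in> act \<gamma> ` hsegment \<i> \<rho>" using edge_iff[OF A_modular[OF \<gamma>(1)] zH] \<gamma>(2) by blast
    then show "z \<in> P" using zH \<gamma>(1) unfolding P_def by blast
  qed
  have "act \<gamma> ` interior \<triangle> \<subseteq> interior P" if "\<gamma> \<in> A" for \<gamma>
    using tile_interior_subset[OF that] interior_mono[OF P_tiles] by blast
  then have 1: "tiles A \<subseteq> closure (interior P)" by (rule tiles_subset_closure)
  have "interior P \<subseteq> tiles A"
  proof (rule ccontr)
    assume "\<not> interior P \<subseteq> tiles A"
    then obtain z where z: "z \<in> interior P" "z \<notin> tiles A" by blast
    have PH: "interior P \<subseteq> \<H>" using interior_subset unfolding P_def by blast
    obtain K where K: "closed K" "tiles A = \<H> \<inter> K" using closedin_tiles by (auto simp: closedin_closed)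
    \<comment> \<open>A nonempty open set contains an interior point of some tile, and
      \<open>p\<close> sends such a point to the open edge of that same tile; so the tile would
      belong to \<open>A\<close>.\<close>
    have "open (interior P - K)" using K by (intro open_Diff open_interior)
    moreover have "z \<in> interior P - K" "z \<in> \<H>" using z PH K by auto
    ultimately obtain \<delta> v where \<delta>: "\<delta> \<in> PSL" "v \<in> interior \<triangle>" "act \<delta> v \<in> interior P - K"
      by (rule open_meets_tile_interior)
    then have "act \<delta> v \<in> P" using interior_subset by blast
    then obtain \<gamma> where \<gamma>: "\<gamma> \<in> A" "p (act \<delta> v) \<in> act \<gamma> ` hsegment \<i> \<rho>" unfolding P_def by blast
    have "\<gamma> = \<delta>" using retr_interior[OF p A_modular[OF \<gamma>(1)] \<delta>(1,2) \<gamma>(2)] .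
    then have "act \<delta> v \<in> tiles A" using \<gamma>(1) \<delta>(2) interior_subset unfolding tiles_def by blast
    then show False using \<delta>(3) K by blast
  qed
  then show "\<H> \<inter> closure (interior P) = tiles A"
    using closure_subset_tiles 1 tiles_upper by blast
  let ?L = "{act \<gamma> \<rho> |\<gamma>. \<gamma> \<in> A \<and> \<gamma> \<odot> gR \<notin> A}"
  have "z \<in> tiles A \<union> {z \<in> \<H>. p z \<in> ?L}" if z: "z \<in> P" for z
  proof -
    have zH: "z \<in> \<H>" using z unfolding P_def by blast
    obtain \<gamma> where \<gamma>: "\<gamma> \<in> A" "p z \<in> act \<gamma> ` hsegment \<i> \<rho>" using z unfolding P_def by blast
    have g: "\<gamma> \<in> PSL" by (rule A_modular[OF \<gamma>(1)])
    consider "z \<in> act \<gamma> ` \<triangle>" | "p z = act \<gamma> \<rho>" using edge_iff[OF g zH] \<gamma>(2) by blast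
    then show ?thesis
    proof cases
      case 1 then show ?thesis using \<gamma>(1) unfolding tiles_def by blast
    next
      case 2
      show ?thesis
      proof (cases "\<gamma> \<odot> gR \<in> A")
        case True
        then have "\<gamma> \<odot> gR2 \<in> A" using A_rotate[OF \<gamma>(1)] by simp
        moreover have "\<gamma> \<odot> \<e> \<in> A" using \<gamma>(1) g by simp
        ultimately have "\<gamma> \<odot> x \<in> A" if "x \<in> {\<e>, gR, gR2}" for x using that True by blast
        moreover obtain x where "x \<in> {\<e>, gR, gR2}" "z \<in> act (\<gamma> \<odot> x) ` \<triangle>"
          using retr_eq_rho[OF p g zH 2] by blast
        ultimately show ?thesis unfolding tiles_def by blast
      next
        case False
        then show ?thesis using 2 zH \<gamma>(1) by blast
      qed
    qed
  qed
  moreover have "{z \<in> \<H>. p z \<in> ?L} \<subseteq> P"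
    unfolding P_def using hseg_ends(2) by blast
  ultimately show "P = tiles A \<union> {z \<in> \<H>. p z \<in> ?L}" using P_tiles by blast
qed

end

theorem theorem2p1:
  fixes G :: "(int^2^2) set set"
  assumes "subgroup G \<Gamma>"
  shows "(realisation (Ycomb G)) homotopy_equivalent_space (Y G) \<and>
    (\<forall>f p C jV jE.
       tree_isomorphism f \<longrightarrow>
       equivariant_retraction p \<longrightarrow> adapted p \<longrightarrow>
       C \<subseteq> {v \<in> verts (Ycomb G). valency (Ycomb G) v = 2} \<longrightarrow>
       undirected_tree (cut_graph (Ycomb G) C) \<longrightarrow>
       is_lift G C jV jE \<longrightarrow>
       (let Y' = cut_graph (Ycomb G) C;
            P = {z \<in> \<H>. p z \<in> f ` realise_map jV jE ` points Y'};
            V = {v \<in> verts Y'. uncut v \<in> range Inr \<and> valency Y' v = 1};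
            Q = \<H> \<inter> closure (interior P)
        in P = Q \<union> {z \<in> \<H>. p z \<in> f ` realise_map jV jE ` Inl ` V} \<and>
           convex_hyperbolic_polygon Q \<and>
           (\<exists>A. A \<subseteq> carrier \<Gamma> \<and> Q = (\<Union>\<gamma>\<in>A. act \<gamma> ` \<triangle>)) \<and>
           fundamental_domain G Q))"
proof (intro conjI allI impI, goal_cases)
  case 1
  show ?case
    by (rule graph_homotopy_equivalent_surface[OF assms])
next
  case (2 f p C jV jE)
  note f = 2(1) and p = 2(2,3) and C = 2(4) and tree = 2(5) and lift = 2(6)
  have conn: "Digraph_Component.connected (cut_graph (Ycomb G) C)"
    using tree by (simp add: undirected_tree_def)
  note ctxt = assms C conn lift
  define A where "A = lifted G jE"
  have A_in: "A \<subseteq> PSL" unfolding A_def lifted_def by blast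
  have rot: "\<gamma> \<odot> gR \<in> A \<longleftrightarrow> \<gamma> \<odot> gR2 \<in> A" if "\<gamma> \<in> A" for \<gamma>
    using lifted_rotate[OF ctxt] that unfolding A_def by blast
  have A0: "A \<noteq> {}" unfolding A_def by (rule lifted_nonempty[OF ctxt])
  interpret edge_subtree A
  proof
    fix P :: "(int^2^2) set \<Rightarrow> bool" and \<gamma>0 \<gamma>
    assume "\<gamma>0 \<in> A" "\<gamma> \<in> A" "P \<gamma>0"
      "\<And>\<delta> x. \<delta> \<in> A \<Longrightarrow> P \<delta> \<Longrightarrow> x \<in> {gS, gR, gR2} \<Longrightarrow> \<delta> \<odot> x \<in> A \<Longrightarrow> P (\<delta> \<odot> x)"
    then show "P \<gamma>" by (rule lifted_induct[where P = P, OF ctxt, folded A_def])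
  qed (use A_in A0 rot in auto)
  have ex: "\<exists>\<gamma>\<in>A. coset G \<gamma> = coset G \<delta>" if "\<delta> \<in> PSL" for \<delta>
  proof -
    have "coset G \<delta> \<in> rcosets\<^bsub>\<Gamma>\<^esub> G" using that by (auto simp: RCOSETS_def)
    then show ?thesis unfolding A_def using lift_edge[OF ctxt] by metis
  qed
  have unique: "\<gamma> = \<delta>" if "\<gamma> \<in> A" "\<delta> \<in> A" "coset G \<gamma> = coset G \<delta>" for \<gamma> \<delta>
    using lifted_unique[OF ctxt] that unfolding A_def by blast
  note P = image_points_cut[OF ctxt f, folded A_def]
  note V = image_leaves[OF ctxt f, folded A_def]
  note pre = retraction_preimage[OF p]
  show ?case
    unfolding Let_def P V pre(1)
  proof (intro conjI)
    show "convex_hyperbolic_polygon (tiles A)" by (rule convex_polygon_tiles)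
    show "\<exists>B\<subseteq>PSL. tiles A = (\<Union>\<gamma>\<in>B. act \<gamma> ` \<triangle>)" using A_in unfolding tiles_def by blast
    show "fundamental_domain G (tiles A)"
      by (rule fundamental_domain_tiles[OF assms ex unique])
  qed (rule pre(2))
qed

end
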